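(* Let $(X_k^S)$ be the SGLD recursion $$X_{k+1}^S=(1-\lambda\eta)X_k^S-\eta\,\widehat g_S(X_k^S,U_k)+\xi_k,\qquad X_0^S\sim\mu_0,$$ with $\eta>0$, $\lambda>0$, $\eta\lambda<1$, $(\xi_k)$ i.i.d. $\mathcal N(0,\sigma^2I_d)$, $\sigma>0$. Let $P(x,\cdot)=\mathcal N((1-\lambda\eta)x,\sigma^2I_d)$ and let $\pi=\mathcal N(0,\sigma_\pi^2I_d)$, $\sigma_\pi=\sigma/\sqrt{1-(1-\lambda\eta)^2}$, be its invariant distribution. Assume that the Compatibility Assumption (stated in the context) holds and that the loss is $\Sigma^2$-subgaussian (in the sense defined in the context). Let $\zeta\in(0,1)$. Then, with probability at least $1-\zeta$ over $S\sim\mu_z^{\otimes n}$, for all $T>0$, $$\mathbb E\left[G_S(Y_T^S)\mid S\right]\le\frac{2\Sigma}{\sqrt n}\left(\frac{\eta^2(2-\lambda\eta)}{2\sigma^2}\int_0^Te^{-\lambda\eta(T-t)}\,\mathbb E\left[\|\widehat g_S(Y_t^S,U)\|^2\mid S\right]dt+K_T+\log\frac3\zeta\right)^{1/2},$$ with $K_T:=e^{-\lambda\eta T}\,\mathrm{KL}(\mu_0\|\pi)$ and $U\sim\mu_U$ independent of $Y_t^S$.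
   Context: $\mathcal P(\mathbb R^d)$ is the set of Borel probability measures on $\mathbb R^d$; for a Markov kernel $K$, $\mu K(A)=\int K(x,A)\,d\mu(x)$. $(\mathcal Z,\mathcal F)$ is a measurable space with a probability measure $\mu_z$, $n\ge1$, $\ell:\mathbb R^d\times\mathcal Z\to\mathbb R_+$ is a loss. For $S=(z_1,\dots,z_n)\in\mathcal Z^n$: $\mathcal R(w)=\int\ell(w,z)\,d\mu_z(z)$, $\widehat{\mathcal R}_S(w)=\frac1n\sum_i\ell(w,z_i)$, $G_S=\mathcal R-\widehat{\mathcal R}_S$. The loss is called $\Sigma^2$-subgaussian if for all $\lambda'>0$ and all $w\in\mathbb R^d$, $\mathbb E_{Z\sim\mu_z}[e^{\lambda'(\ell(w,Z)-\mathcal R(w))}]\le e^{\lambda'^2\Sigma^2/2}$. $\widehat g_S(x,u)$ is a stochastic gradient; $(U_k)$ (batch randomness) are i.i.d. with law $\mu_U$, independent of $(\xi_k)$, of $S$ and of $X_0^S$. $P_S$ is the Markov kernel of $(X_k^S)$. $(N_t)_{t\ge0}$ is a Poisson process of intensity $1$ independent of all other random variables; $Y^S_t:=X^S_{N_t}$ and $\rho_t^S$ is the law of $Y_t^S$ given $S$. It is assumed that $\mu_0\ll\pi$; $v_t:=\frac{d\rho_t^S}{d\pi}$. Dual operator: if $K$ is a Markov kernel such that $\mu\ll\pi\Rightarrow\mu K\ll\pi$, then $K^\star:L^1(\pi)\to L^1(\pi)$ is defined on non-negative $f$ with $\int f\,d\pi=1$ by $K^\star f=\frac{d(\mu K)}{d\pi}$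 with $d\mu=f\,d\pi$, and extended linearly. Compatibility Assumption: $\mathrm{KL}(\mu_0\|\pi)<+\infty$; $v_0=d\mu_0/d\pi$ is bounded away from $0$; for all $t\ge0$ the map $S\mapsto\mathrm{KL}(\rho_t^S\|\pi)$ is $\mathcal F^{\otimes n}$-measurable; and for all $S\in\mathcal Z^n$: (H.1) for all $\mu\in\mathcal P(\mathbb R^d)$, $\mu\ll\pi$ implies $\mu P_S\ll\pi$; (H.2) for all $t\ge0$, $\Phi(P_S^\star v_t)\in L^1(\pi)$, where $\Phi(x)=x\log x$, $\Phi(0)=0$.
   Formalization: The subgaussian moment bound is assumed for all real λ', not only λ' > 0; with λ' > 0 alone the claim is false (n=1, zero gradient, μ_0=π, loss z on {0,1} with P(z=0)=0.001, Σ²=p(1-p), ζ just below p). *)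

theory Defs
  imports "HOL-Probability.Probability"
begin

section \<open>Gaussian measures, Kullback-Leibler divergence, Markov kernels\<close>

text \<open>\<open>N(m, s\<^sup>2 I)\<close>, with standard deviation \<open>s\<close> as parameter as in \<^const>\<open>normal_density\<close>.\<close>

definition iso_gaussian :: "'a::euclidean_space \<Rightarrow> real \<Rightarrow> 'a measure" where
  "iso_gaussian m s =
     density lborel (\<lambda>x. ennreal (\<Prod>b\<in>Basis. normal_density (m \<bullet> b) s (x \<bullet> b)))"

lemma prob_space_iso_gaussian:
  fixes m :: "'a::euclidean_space"
  assumes "s > 0"
  shows "prob_space (iso_gaussian m s)"
proof
  have "emeasure (iso_gaussian m s) (space (iso_gaussian m s)) =
      (\<integral>\<^sup>+x. (\<Prod>b\<in>Basis. ennreal (normal_density (m \<bullet> b) s (x \<bullet> b))) \<partial>lborel)"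
    by (simp add: iso_gaussian_def emeasure_density prod_ennreal)
  also have "\<dots> = (\<Prod>b\<in>(Basis::'a set). \<integral>\<^sup>+x. ennreal (normal_density (m \<bullet> b) s x) \<partial>lborel)"
    by (rule nn_integral_lborel_prod) auto
  also have "\<dots> = 1"
  proof (rule prod.neutral, intro ballI)
    fix b :: 'a
    have "(\<integral>\<^sup>+x. ennreal (normal_density (m \<bullet> b) s x) \<partial>lborel) =
        ennreal (\<integral>x. normal_density (m \<bullet> b) s x \<partial>lborel)"
      using assms by (intro nn_integral_eq_integral) auto
    then show "(\<integral>\<^sup>+x. ennreal (normal_density (m \<bullet> b) s x) \<partial>lborel) = 1"
      using assms by simp
  qed
  finally show "emeasure (iso_gaussian m s) (space (iso_gaussian m s)) = 1" .
qed

text \<open>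
  \<open>KL(\<mu> \<parallel> \<nu>)\<close> for probability measures on the same measurable space, with value \<open>\<infinity>\<close> allowed.
  The library's \<^const>\<open>KL_divergence\<close> has its arguments in the opposite order, and its integral
  silently takes the value 0 where the divergence is infinite. The negative part of the
  log-density is always \<open>\<mu>\<close>-integrable, so non-integrability means that the divergence is \<open>\<infinity>\<close>.
\<close>

definition KL :: "'a measure \<Rightarrow> 'a measure \<Rightarrow> ennreal" where
  "KL \<mu> \<nu> =
     (if absolutely_continuous \<nu> \<mu> \<and> integrable \<mu> (entropy_density (exp 1) \<nu> \<mu>)
      then ennreal (KL_divergence (exp 1) \<nu> \<mu>) else \<infinity>)"

definition rdens :: "'a measure \<Rightarrow> 'a measure \<Rightarrow> 'a \<Rightarrow> real" where
  "rdens \<pi> \<mu> x = enn2real (RN_deriv \<pi> \<mu> x)"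

text \<open>
  The measure \<open>\<mu> K\<close> is \<^term>\<open>bind \<mu> K\<close>. The dual operator \<open>K\<^sup>\<star>\<close> is given by its defining formula on
  probability densities; it is not applied to any other function below.
\<close>

definition dual_op :: "'a measure \<Rightarrow> ('a \<Rightarrow> 'a measure) \<Rightarrow> ('a \<Rightarrow> real) \<Rightarrow> 'a \<Rightarrow> real" where
  "dual_op \<pi> K f = rdens \<pi> (bind (density \<pi> (\<lambda>x. ennreal (f x))) K)"

definition Phi :: "real \<Rightarrow> real" where
  "Phi x = (if x = 0 then 0 else x * ln x)"

section \<open>The stochastic gradient kernel\<close>

text \<open>Law of \<open>(1 - lam \<eta>) x - \<eta> g(x, u) + e\<close> for independent \<open>u \<sim> \<mu>U\<close> and \<open>e \<sim> N(0, \<sigma>\<^sup>2 I)\<close>.\<close>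

definition sgld_kernel ::
  "real \<Rightarrow> real \<Rightarrow> real \<Rightarrow> 'u measure \<Rightarrow> ('a::euclidean_space \<Rightarrow> 'u \<Rightarrow> 'a) \<Rightarrow> 'a \<Rightarrow> 'a measure" where
  "sgld_kernel lam \<eta> \<sigma> \<mu>U g x =
     distr (\<mu>U \<Otimes>\<^sub>M iso_gaussian 0 \<sigma>) borel
       (\<lambda>(u, e). (1 - lam * \<eta>) *\<^sub>R x - \<eta> *\<^sub>R g x u + e)"

lemma sgld_kernel_measurable:
  fixes g :: "'a::euclidean_space \<Rightarrow> 'u \<Rightarrow> 'a"
  assumes g: "(\<lambda>(x, u). g x u) \<in> borel_measurable (borel \<Otimes>\<^sub>M \<mu>U)"
    and \<mu>U: "prob_space \<mu>U" and \<sigma>: "\<sigma> > 0"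
  shows "sgld_kernel lam \<eta> \<sigma> \<mu>U g \<in> borel \<rightarrow>\<^sub>M prob_algebra borel"
proof -
  let ?Q = "\<mu>U \<Otimes>\<^sub>M iso_gaussian (0::'a) \<sigma>"
  interpret U: prob_space \<mu>U by fact
  interpret G: prob_space "iso_gaussian (0::'a) \<sigma>" using \<sigma> by (rule prob_space_iso_gaussian)
  interpret Q: pair_prob_space \<mu>U "iso_gaussian (0::'a) \<sigma>" ..
  have Gs [measurable_cong]: "sets (iso_gaussian (0::'a) \<sigma>) = sets borel"
    by (simp add: iso_gaussian_def)
  have [measurable]: "(\<lambda>p. g (fst p) (snd p)) \<in> borel_measurable (borel \<Otimes>\<^sub>M \<mu>U)"
    using g by (simp add: case_prod_beta')
  have gm: "(\<lambda>p. g (fst p) (fst (snd p))) \<in> borel_measurable (borel \<Otimes>\<^sub>M ?Q)"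
    using measurable_compose[of "\<lambda>p. (fst p, fst (snd p))" "borel \<Otimes>\<^sub>M ?Q" "borel \<Otimes>\<^sub>M \<mu>U"
        "\<lambda>p. g (fst p) (snd p)" borel]
    by simp
  have em: "(\<lambda>p. snd (snd p)) \<in> borel_measurable (borel \<Otimes>\<^sub>M ?Q)"
    by measurable
  have m: "(\<lambda>(x, u, e). (1 - lam * \<eta>) *\<^sub>R x - \<eta> *\<^sub>R g x u + e)
      \<in> borel_measurable (borel \<Otimes>\<^sub>M ?Q)"
    using gm em unfolding case_prod_beta' by measurable
  have Q: "(\<lambda>_. ?Q) \<in> borel \<rightarrow>\<^sub>M prob_algebra ?Q"
    using Q.prob_space_axioms by (intro measurable_const) (simp add: space_prob_algebra)
  have "(\<lambda>x. distr ?Q borel (\<lambda>y. case (x, y) of (x, u, e) \<Rightarrow>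
        (1 - lam * \<eta>) *\<^sub>R x - \<eta> *\<^sub>R g x u + e)) \<in> borel \<rightarrow>\<^sub>M prob_algebra borel"
    by (rule measurable_distr_prob_space2[OF Q]) (use m in \<open>simp add: case_prod_beta'\<close>)
  then show ?thesis
    by (simp add: sgld_kernel_def[abs_def] case_prod_beta')
qed

section \<open>Sources of randomness\<close>

definition poisson_process :: "'w measure \<Rightarrow> real \<Rightarrow> (real \<Rightarrow> 'w \<Rightarrow> nat) \<Rightarrow> bool" where
  "poisson_process M r N \<longleftrightarrow>
     (\<forall>t\<ge>0. N t \<in> M \<rightarrow>\<^sub>M count_space UNIV) \<and>
     (AE \<omega> in M. N 0 \<omega> = 0) \<and>
     (AE \<omega> in M. mono_on {0..} (\<lambda>t. N t \<omega>)) \<and>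
     (AE \<omega> in M. \<forall>t\<ge>0. continuous (at_right t) (\<lambda>s. N s \<omega>)) \<and>
     (\<forall>s t. 0 \<le> s \<longrightarrow> s < t \<longrightarrow>
        distr M (count_space UNIV) (\<lambda>\<omega>. N t \<omega> - N s \<omega>) = measure_pmf (poisson_pmf (r * (t - s)))) \<and>
     (\<forall>t :: nat \<Rightarrow> real. 0 \<le> t 0 \<longrightarrow> mono t \<longrightarrow>
        prob_space.indep_vars M (\<lambda>_. count_space UNIV)
          (\<lambda>i \<omega>. N (t (Suc i)) \<omega> - N (t i) \<omega>) UNIV)"

datatype source = Init | Batch nat | Noise nat | Clock

text \<open>
  Mutual independence of the initial state, the batches, the Gaussian noises and the whole clock
  process. It is stated for the generated \<open>\<sigma>\<close>-algebras because these objects take values in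
  different spaces, which \<open>indep_vars\<close> does not allow.
\<close>

definition independent_sources ::
  "'w measure \<Rightarrow> 'u measure \<Rightarrow> ('w \<Rightarrow> 'a::euclidean_space) \<Rightarrow> (nat \<Rightarrow> 'w \<Rightarrow> 'u) \<Rightarrow>
   (nat \<Rightarrow> 'w \<Rightarrow> 'a) \<Rightarrow> (real \<Rightarrow> 'w \<Rightarrow> nat) \<Rightarrow> bool" where
  "independent_sources M \<mu>U X0 U \<xi> N \<longleftrightarrow>
     prob_space.indep_sets M
       (\<lambda>i. case i of
          Init \<Rightarrow> sets (vimage_algebra (space M) X0 borel)
        | Batch k \<Rightarrow> sets (vimage_algebra (space M) (U k) \<mu>U)
        | Noise k \<Rightarrow> sets (vimage_algebra (space M) (\<xi> k) borel)
        | Clock \<Rightarrow> sets (vimage_algebra (space M) (\<lambda>\<omega>. \<lambda>t\<in>{0..}. N t \<omega>)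
                       (\<Pi>\<^sub>M t\<in>{0..}. count_space UNIV)))
       UNIV"

definition time_changed :: "(nat \<Rightarrow> 'w \<Rightarrow> 'a) \<Rightarrow> (real \<Rightarrow> 'w \<Rightarrow> nat) \<Rightarrow> real \<Rightarrow> 'w \<Rightarrow> 'a" where
  "time_changed X N t \<omega> = X (N t \<omega>) \<omega>"

section \<open>Losses and samples\<close>

text \<open>A sample \<open>S = (z\<^sub>1, \<dots>, z\<^sub>n)\<close> is a function on \<open>{..<n}\<close>, i.e. the indices are shifted to \<open>0, \<dots>, n - 1\<close>.\<close>

abbreviation samples :: "nat \<Rightarrow> 'z measure \<Rightarrow> (nat \<Rightarrow> 'z) measure" where
  "samples n \<mu>z \<equiv> \<Pi>\<^sub>M i\<in>{..<n}. \<mu>z"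

definition risk :: "'z measure \<Rightarrow> ('a \<Rightarrow> 'z \<Rightarrow> real) \<Rightarrow> 'a \<Rightarrow> real" where
  "risk \<mu>z l w = (\<integral>z. l w z \<partial>\<mu>z)"

definition emp_risk :: "nat \<Rightarrow> ('a \<Rightarrow> 'z \<Rightarrow> real) \<Rightarrow> (nat \<Rightarrow> 'z) \<Rightarrow> 'a \<Rightarrow> real" where
  "emp_risk n l S w = (\<Sum>i<n. l w (S i)) / real n"

definition gen_gap :: "'z measure \<Rightarrow> nat \<Rightarrow> ('a \<Rightarrow> 'z \<Rightarrow> real) \<Rightarrow> (nat \<Rightarrow> 'z) \<Rightarrow> 'a \<Rightarrow> real" where
  "gen_gap \<mu>z n l S w = risk \<mu>z l w - emp_risk n l S w"

text \<open>
  Subgaussianity is two-sided, as usual: \<open>t\<close> ranges over all reals. The bound for \<open>t > 0\<close> alone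
  only controls the upper tail of the loss, while upper bounds on \<^const>\<open>gen_gap\<close> concern the
  lower tail. The expectation is a nonnegative integral, so its finiteness is part of the
  condition (and implies integrability of \<open>l w\<close>, so that the risk is meaningful).
\<close>

definition subgaussian_loss :: "'z measure \<Rightarrow> real \<Rightarrow> ('a \<Rightarrow> 'z \<Rightarrow> real) \<Rightarrow> bool" where
  "subgaussian_loss \<mu>z Sig l \<longleftrightarrow>
     (\<forall>t w. (\<integral>\<^sup>+z. ennreal (exp (t * (l w z - risk \<mu>z l w))) \<partial>\<mu>z)
              \<le> ennreal (exp (t\<^sup>2 * Sig\<^sup>2 / 2)))"

section \<open>The compatibility assumption\<close>

text \<open>
  \<open>Z\<close> is the measure space of samples, \<open>P S\<close> the kernel and \<open>\<rho> S t\<close> the law at time \<open>t\<close> of the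
  process for the sample \<open>S\<close>.
\<close>

definition compatible ::
  "(nat \<Rightarrow> 'z) measure \<Rightarrow> 'a::euclidean_space measure \<Rightarrow> 'a measure \<Rightarrow>
   ((nat \<Rightarrow> 'z) \<Rightarrow> 'a \<Rightarrow> 'a measure) \<Rightarrow> ((nat \<Rightarrow> 'z) \<Rightarrow> real \<Rightarrow> 'a measure) \<Rightarrow> bool" where
  "compatible Z \<mu>0 \<pi> P \<rho> \<longleftrightarrow>
     KL \<mu>0 \<pi> < \<infinity> \<and>
     (\<exists>c>0. AE x in \<pi>. c \<le> rdens \<pi> \<mu>0 x) \<and>
     (\<forall>t\<ge>0. (\<lambda>S. KL (\<rho> S t) \<pi>) \<in> borel_measurable Z) \<and>
     (\<forall>S\<in>space Z.
        (\<forall>\<mu>. prob_space \<mu> \<longrightarrow> sets \<mu> = sets borel \<longrightarrow> absolutely_continuous \<pi> \<mu> \<longrightarrow>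
             absolutely_continuous \<pi> (bind \<mu> (P S))) \<and>
        (\<forall>t\<ge>0. integrable \<pi> (\<lambda>x. Phi (dual_op \<pi> (P S) (rdens \<pi> (\<rho> S t)) x))))"

text \<open>Square root on \<open>[0, \<infinity>]\<close>.\<close>

definition esqrt :: "ennreal \<Rightarrow> ereal" where
  "esqrt x = (if x = \<infinity> then \<infinity> else ereal (sqrt (enn2real x)))"

end

theory Submission
  imports Defs
begin

text \<open>
  Write \<open>a = 1 - lam \<eta>\<close> and \<open>K\<^sub>k\<close> for the relative entropy of the law of \<open>X\<^sub>k\<close> with respect to \<open>\<pi>\<close>.
  The heart of the matter is the one-step estimate
  \<open>K\<^sub>k\<^sub>+\<^sub>1 \<le> a K\<^sub>k + \<eta>\<^sup>2 (1 + a) / (2 \<sigma>\<^sup>2) E |g(X\<^sub>k, U)|\<^sup>2\<close>. To get it, the noise is split into two independent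
  Gaussians. The first one turns \<open>a X\<^sub>k\<close> into a rescaled Ornstein--Uhlenbeck evolution of \<open>X\<^sub>k\<close>, which contracts
  the entropy by the factor \<open>a\<close>; the second one pays for the shift by the gradient, by the
  Donsker--Varadhan formula and the translation of a Gaussian.

  The contraction is obtained without a logarithmic Sobolev inequality: if \<open>X\<close> of law \<open>\<pi>\<close> is written as
  \<open>sqrt p A + sqrt p B + sqrt r C\<close> with independent \<open>A, B, C\<close> of law \<open>\<pi>\<close> and \<open>2 p + r = 1\<close>, submodularity of the
  entropy says that the entropy after the Ornstein--Uhlenbeck evolution is midpoint convex in the
  squared correlation, and it vanishes at correlation 0.

  The law at time \<open>T\<close> is the Poisson mixture of the laws of the \<open>X\<^sub>k\<close>, so by convexity its entropy is at most
  the Poisson average of the \<open>K\<^sub>k\<close>. Unrolling the one-step estimate, the coefficient of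
  \<open>E |g(X\<^sub>j, U)|\<^sup>2\<close> is a Poisson tail sum that equals the integral of \<open>exp (- lam \<eta> (T - t)) P(N\<^sub>t = j)\<close>.

  The bound on the gap follows from \<open>E exp (n G\<^sup>2 / (4 Sig\<^sup>2)) \<le> sqrt 2 < 3\<close>, Markov's inequality and the
  Donsker--Varadhan formula, which hold for all \<open>T\<close> at once. If the right-hand side is infinite, only
  integrability is at stake; it follows from (H.2), since the law at time \<open>T\<close> is dominated by
  \<open>\<mu>\<^sub>0\<close> plus \<open>T\<close> times its own image under the kernel.
\<close>

section \<open>Relative entropy and its variational formula\<close>

text \<open>Using all of the noise as an Ornstein--Uhlenbeck step would contract the entropy by
  \<open>a\<^sup>2\<close>, but would leave nothing to pay for the gradient. In units of the
  variance of \<pi>, the noise has variance \<open>1 - a\<^sup>2\<close>, which is split as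
  \<open>a * (1 - a)\<close> plus \<open>1 - a\<close>. The first share makes \<open>a x\<close>
  into \<open>sqrt a\<close> times an Ornstein--Uhlenbeck evolution of squared correlation
  \<open>a\<close>. The second share has variance \<open>\<sigma>\<^sup>2 / (1 + a)\<close>, so a
  shift by \<eta> times the gradient costs its squared norm times
  \<open>\<eta>\<^sup>2 * (1 + a) / (2 * \<sigma>\<^sup>2)\<close>; and \<open>1 + a\<close> is the
  factor \<open>2 - lam * \<eta>\<close> of the theorem. The rate
  \<open>exp (- lam * \<eta> * T)\<close> is the mean of \<open>a ^ k\<close> for a Poisson variable
  \<open>k\<close> of mean \<open>T\<close>.

  Divergences and gradient moments may be infinite, while a divergent Bochner integral silently
  takes the value 0. Entropies are therefore nonnegative integrals, and most upper bounds on a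
  divergence are proved by testing against bounded functions, with no disintegration of joint
  laws.\<close>

definition ent_fun :: "real \<Rightarrow> real" where
  "ent_fun x = x * ln x - x + 1"

lemma ent_fun_measurable [measurable]: "ent_fun \<in> borel_measurable borel"
  unfolding ent_fun_def[abs_def] by measurable

lemma ent_fun_0 [simp]: "ent_fun 0 = 1" and ent_fun_1 [simp]: "ent_fun 1 = 0"
  by (simp_all add: ent_fun_def)

text \<open>Fenchel--Young: the conjugate of \<open>ent_fun\<close> at \<open>ln y\<close> is
  \<open>y - 1\<close>, with equality at \<open>y = x\<close>. Nonnegativity and the inequalities of
  Jensen and Gibbs are read off from it.\<close>

lemma ent_fun_Young:
  assumes "0 \<le> x" "0 < y"
  shows "x * ln y \<le> ent_fun x - 1 + y"
proof (cases "x = 0")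
  case False
  with assms have x: "x > 0" by simp
  have "ln (y / x) \<le> y / x - 1"
    using assms x by (intro ln_le_minus_one) simp
  then have "x * ln (y / x) \<le> x * (y / x - 1)"
    using x by (intro mult_left_mono) auto
  then show ?thesis
    using assms x by (simp add: ent_fun_def ln_div algebra_simps)
qed (use assms in auto)

lemma ent_fun_nonneg: "0 \<le> x \<Longrightarrow> 0 \<le> ent_fun x"
  using ent_fun_Young[of x 1] by simp

lemma ent_fun_Jensen:
  assumes "prob_space P" and [measurable]: "f \<in> borel_measurable P"
    and nn: "\<And>x. 0 \<le> f x" and int: "integrable P f"
  shows "ennreal (ent_fun (\<integral>x. f x \<partial>P)) \<le> (\<integral>\<^sup>+x. ennreal (ent_fun (f x)) \<partial>P)"
proof -
  interpret prob_space P by fact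
  define m where "m = (\<integral>x. f x \<partial>P)"
  have m0: "0 \<le> m" unfolding m_def using nn by simp
  show ?thesis
  proof (cases "m = 0")
    \<comment> \<open>At mean 0 there is no tangent of finite slope, so this case is separate;
      \<open>f\<close> then vanishes almost everywhere.\<close>
    case True
    then have "AE x in P. f x = 0"
      unfolding m_def using int nn by (subst (asm) integral_nonneg_eq_0_iff_AE) auto
    then have "(\<integral>\<^sup>+x. ennreal (ent_fun (f x)) \<partial>P) = (\<integral>\<^sup>+x. 1 \<partial>P)"
      by (intro nn_integral_cong_AE) auto
    then show ?thesis using True by (simp add: m_def emeasure_space_1)
  next
    case False
    with m0 have m: "m > 0" by simp
    show ?thesis
    proof (cases "integrable P (\<lambda>x. ent_fun (f x))")
      case True
      \<comment> \<open>The tangent of \<open>ent_fun\<close> at \<open>m\<close> lies below it and,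
        being affine, integrates to the value at \<open>m\<close>.\<close>
      have "(\<integral>x. f x * ln m - m + 1 \<partial>P) \<le> (\<integral>x. ent_fun (f x) \<partial>P)"
      proof (intro integral_mono)
      show "f x * ln m - m + 1 \<le> ent_fun (f x)" for x
        using ent_fun_Young[OF nn m, of x] by simp
    qed (use int True in auto)
      also have "(\<integral>x. f x * ln m - m + 1 \<partial>P) = ent_fun m"
        using int by (simp add: prob_space m_def ent_fun_def)
      finally show ?thesis
        using True nn
        by (subst nn_integral_eq_integral) (auto simp: m_def ent_fun_nonneg intro!: ennreal_leI)
    next
      case False
      then have "(\<integral>\<^sup>+x. ennreal (ent_fun (f x)) \<partial>P) = \<infinity>"
        using nn by (intro nn_integral_nonneg_infinite) (auto simp: ent_fun_nonneg)
      then show ?thesis by simp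
    qed
  qed
qed

lemma
  fixes f :: "'a \<Rightarrow> real"
  assumes "prob_space (density P (\<lambda>x. ennreal (f x)))" and [measurable]: "f \<in> borel_measurable P"
    and nn: "\<And>x. 0 \<le> f x"
  shows integrable_prob_density: "integrable P f"
    and integral_prob_density: "(\<integral>x. f x \<partial>P) = 1"
proof -
  have "(\<integral>\<^sup>+x. ennreal (f x) \<partial>P) = 1"
    using prob_space.emeasure_space_1[OF assms(1)] by (simp add: emeasure_density)
  then have "has_bochner_integral P f 1"
    using nn by (intro has_bochner_integral_nn_integral) auto
  then show "integrable P f" "(\<integral>x. f x \<partial>P) = 1"
    by (simp_all add: has_bochner_integral_iff)
qed

lemma integrable_ent_fun_iff:
  fixes f :: "'a \<Rightarrow> real"
  assumes "prob_space P" and "integrable P f"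
  shows "integrable P (\<lambda>x. ent_fun (f x)) \<longleftrightarrow> integrable P (\<lambda>x. f x * ln (f x))"
proof -
  interpret prob_space P by fact
  show ?thesis
  proof
    assume "integrable P (\<lambda>x. ent_fun (f x))"
    then have "integrable P (\<lambda>x. ent_fun (f x) + f x - 1)"
      using assms(2) by auto
    then show "integrable P (\<lambda>x. f x * ln (f x))"
      by (simp add: ent_fun_def)
  next
    assume "integrable P (\<lambda>x. f x * ln (f x))"
    then show "integrable P (\<lambda>x. ent_fun (f x))"
      unfolding ent_fun_def using assms(2) by auto
  qed
qed

text \<open>Subtracting \<open>f - 1\<close> from \<open>f * ln f\<close> does not change the
  integral of a probability density but makes the integrand nonnegative. An infinite divergence
  becomes an infinite integral, so one formula covers both cases.\<close>

lemma KL_density_eq: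
  fixes f :: "'a \<Rightarrow> real"
  assumes P: "prob_space P" and f [measurable]: "f \<in> borel_measurable P" and nn: "\<And>x. 0 \<le> f x"
    and D: "prob_space (density P (\<lambda>x. ennreal (f x)))"
  shows "KL (density P (\<lambda>x. ennreal (f x))) P = (\<integral>\<^sup>+x. ennreal (ent_fun (f x)) \<partial>P)"
proof -
  interpret prob_space P by fact
  let ?D = "density P (\<lambda>x. ennreal (f x))"
  note int = integrable_prob_density[OF D f nn] and int1 = integral_prob_density[OF D f nn]
  have ac: "absolutely_continuous P ?D"
    by (rule absolutely_continuousI_density) simp
  have "density P (RN_deriv P ?D) = ?D"
    by (intro density_RN_deriv_density) auto
  then have eq: "AE x in P. RN_deriv P ?D x = f x"
    by (intro density_unique) auto
  have [measurable]: "entropy_density (exp 1) P ?D \<in> borel_measurable P"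
    by (auto simp: comp_def entropy_density_def)
  have "integrable ?D (entropy_density (exp 1) P ?D) \<longleftrightarrow>
      integrable P (\<lambda>x. f x *\<^sub>R entropy_density (exp 1) P ?D x)"
    using nn by (intro integrable_density) auto
  also have "\<dots> \<longleftrightarrow> integrable P (\<lambda>x. f x * ln (f x))"
    using eq nn
    by (intro integrable_cong_AE) (auto simp: entropy_density_def log_ln elim!: eventually_mono)
  also have "\<dots> \<longleftrightarrow> integrable P (\<lambda>x. ent_fun (f x))"
    using integrable_ent_fun_iff[OF P int] by simp
  finally have iff: "integrable ?D (entropy_density (exp 1) P ?D) \<longleftrightarrow> integrable P (\<lambda>x. ent_fun (f x))" .
  show ?thesis
  proof (cases "integrable P (\<lambda>x. ent_fun (f x))")
    case True
    then have i2: "integrable P (\<lambda>x. f x * ln (f x))"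
      using integrable_ent_fun_iff[OF P int] by simp
    have "KL_divergence (exp 1) P ?D = (\<integral>x. f x * log (exp 1) (f x) \<partial>P)"
      using nn by (intro KL_density) auto
    also have "\<dots> = (\<integral>x. f x * ln (f x) \<partial>P)"
      by (simp add: log_ln)
    also have "\<dots> = (\<integral>x. ent_fun (f x) \<partial>P)"
      unfolding ent_fun_def using int int1 i2 by (simp add: prob_space)
    finally show ?thesis
      using True iff ac nn
      by (simp add: KL_def nn_integral_eq_integral ent_fun_nonneg)
  next
    case False
    then have "(\<integral>\<^sup>+x. ennreal (ent_fun (f x)) \<partial>P) = \<infinity>"
      using nn by (intro nn_integral_nonneg_infinite) (auto simp: ent_fun_nonneg)
    then show ?thesis using False iff by (simp add: KL_def)
  qed
qed

section \<open>Densities of probability measures and Gibbs' inequality\<close>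

lemma rdens_measurable [measurable]: "rdens P \<mu> \<in> borel_measurable P"
  unfolding rdens_def[abs_def] by measurable

lemma rdens_nonneg: "0 \<le> rdens P \<mu> x"
  by (simp add: rdens_def)

lemma density_rdens:
  assumes "prob_space P" "prob_space \<mu>" "sets \<mu> = sets P" "absolutely_continuous P \<mu>"
  shows "density P (\<lambda>x. ennreal (rdens P \<mu> x)) = \<mu>"
proof -
  interpret P: prob_space P by fact
  interpret \<mu>: prob_space \<mu> by fact
  have "AE x in P. RN_deriv P \<mu> x \<noteq> \<infinity>"
    using assms by (intro P.RN_deriv_finite) (auto intro: \<mu>.sigma_finite_measure_axioms)
  then have "density P (\<lambda>x. ennreal (rdens P \<mu> x)) = density P (RN_deriv P \<mu>)"
    by (intro density_cong) (auto simp: rdens_def top.not_eq_extremum elim!: eventually_mono)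
  also have "\<dots> = \<mu>"
    using assms by (intro P.density_RN_deriv) auto
  finally show ?thesis .
qed

lemma
  fixes \<phi> :: "'a \<Rightarrow> real"
  assumes "prob_space P" "prob_space \<mu>" "sets \<mu> = sets P" "absolutely_continuous P \<mu>"
    and \<phi>: "\<phi> \<in> borel_measurable P"
  shows integrable_rdens_iff: "integrable \<mu> \<phi> \<longleftrightarrow> integrable P (\<lambda>x. rdens P \<mu> x * \<phi> x)"
    and integral_rdens: "(\<integral>x. \<phi> x \<partial>\<mu>) = (\<integral>x. rdens P \<mu> x * \<phi> x \<partial>P)"
  using integrable_density[OF \<phi> rdens_measurable, of \<mu>] integral_density[OF \<phi> rdens_measurable, of \<mu>]
  by (simp_all add: rdens_nonneg density_rdens[OF assms(1-4)])

lemma KL_eq_rdens: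
  assumes "prob_space P" "prob_space \<mu>" "sets \<mu> = sets P" "absolutely_continuous P \<mu>"
  shows "KL \<mu> P = (\<integral>\<^sup>+x. ennreal (ent_fun (rdens P \<mu> x)) \<partial>P)"
  using KL_density_eq[of P "rdens P \<mu>"] density_rdens[OF assms] assms by (simp add: rdens_nonneg)

lemma KL_finite_ac: "KL \<mu> P < \<infinity> \<Longrightarrow> absolutely_continuous P \<mu>"
  by (auto simp: KL_def split: if_splits)

text \<open>Gibbs' inequality for a subprobability density \<open>h\<close>: a form of the variational
  formula that allows unbounded test functions.\<close>

lemma Gibbs_integral_le:
  fixes f h :: "'a \<Rightarrow> real"
  assumes P: "prob_space P" and f [measurable]: "f \<in> borel_measurable P" and nn: "\<And>x. 0 \<le> f x"
    and D: "prob_space (density P (\<lambda>x. ennreal (f x)))"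
    and fin: "(\<integral>\<^sup>+x. ennreal (ent_fun (f x)) \<partial>P) < \<infinity>"
    and h [measurable]: "h \<in> borel_measurable P" and hnn: "\<And>x. 0 \<le> h x"
    and h1: "(\<integral>\<^sup>+x. ennreal (h x) \<partial>P) \<le> 1"
    and pos: "AE x in P. f x \<noteq> 0 \<longrightarrow> h x > 0"
    and int: "integrable P (\<lambda>x. f x * ln (h x))"
  shows "(\<integral>x. f x * ln (h x) \<partial>P) \<le> enn2real (\<integral>\<^sup>+x. ennreal (ent_fun (f x)) \<partial>P)"
proof -
  interpret prob_space P by fact
  have ih: "integrable P h"
    using h1 hnn by (intro integrableI_nonneg) (auto simp: le_less_trans)
  have ih1: "(\<integral>x. h x \<partial>P) \<le> 1"
    using h1 hnn by (subst (asm) nn_integral_eq_integral[OF ih]) auto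
  have ie: "integrable P (\<lambda>x. ent_fun (f x))"
    using fin nn by (intro integrableI_nonneg) (auto simp: ent_fun_nonneg)
  have "(\<integral>x. f x * ln (h x) \<partial>P) \<le> (\<integral>x. ent_fun (f x) - 1 + h x \<partial>P)"
  proof (intro integral_mono_AE)
    show "AE x in P. f x * ln (h x) \<le> ent_fun (f x) - 1 + h x"
      using pos
    proof eventually_elim
      case (elim x)
      show ?case
        using ent_fun_Young[OF nn, of "h x" x] elim hnn[of x] by (cases "f x = 0") auto
    qed
  qed (use int ie ih in auto)
  also have "\<dots> \<le> (\<integral>x. ent_fun (f x) \<partial>P)"
    using ie ih ih1 by (simp add: prob_space)
  also have "\<dots> = enn2real (\<integral>\<^sup>+x. ennreal (ent_fun (f x)) \<partial>P)"
    using ie nn by (subst nn_integral_eq_integral) (auto simp: ent_fun_nonneg)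
  finally show ?thesis .
qed

section \<open>Bounded test functions and the variational formula\<close>

lemma prob_space_integrable_bounded:
  fixes f :: "'a \<Rightarrow> real"
  assumes "prob_space P" "f \<in> borel_measurable P" "\<And>x. \<bar>f x\<bar> \<le> c"
  shows "integrable P f"
  using assms by (intro finite_measure.integrable_const_bound[of _ _ c])
    (auto simp: prob_space.finite_measure)

lemma prob_space_integral_bounds:
  fixes f :: "'a \<Rightarrow> real"
  assumes "prob_space P" "f \<in> borel_measurable P" "\<And>x. a \<le> f x" "\<And>x. f x \<le> b"
  shows "a \<le> (\<integral>x. f x \<partial>P)" "(\<integral>x. f x \<partial>P) \<le> b"
proof -
  interpret prob_space P by fact
  have "integrable P f"
    using assms by (intro prob_space_integrable_bounded[where c = "\<bar>a\<bar> + \<bar>b\<bar>"]) (auto simp: abs_le_iff, (smt (verit))+)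
  then show "a \<le> (\<integral>x. f x \<partial>P)" "(\<integral>x. f x \<partial>P) \<le> b"
    using assms by (auto intro!: integral_ge_const integral_le_const)
qed

lemma prob_space_abs_integral_le:
  fixes f :: "'a \<Rightarrow> real"
  assumes "prob_space P" "f \<in> borel_measurable P" and b: "\<And>x. \<bar>f x\<bar> \<le> c"
  shows "\<bar>\<integral>x. f x \<partial>P\<bar> \<le> c"
proof -
  have "- c \<le> f x" "f x \<le> c" for x using b[of x] by auto
  then show ?thesis
    using prob_space_integral_bounds[OF assms(1,2), of "- c" c] by auto
qed

lemma integral_exp_bounded:
  fixes \<psi> :: "'a \<Rightarrow> real"
  assumes "prob_space P" and [measurable]: "\<psi> \<in> borel_measurable P" and "\<And>x. \<bar>\<psi> x\<bar> \<le> c"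
  shows "integrable P (\<lambda>x. exp (\<psi> x))" and "exp (- c) \<le> (\<integral>x. exp (\<psi> x) \<partial>P)"
    and "(\<integral>x. exp (\<psi> x) \<partial>P) \<le> exp c" and "0 < (\<integral>x. exp (\<psi> x) \<partial>P)"
proof -
  have b: "- c \<le> \<psi> x" "\<psi> x \<le> c" for x
    using assms(3)[of x] by auto
  show "integrable P (\<lambda>x. exp (\<psi> x))"
    using assms(1) b by (intro prob_space_integrable_bounded[where c = "exp c"]) auto
  show "exp (- c) \<le> (\<integral>x. exp (\<psi> x) \<partial>P)" "(\<integral>x. exp (\<psi> x) \<partial>P) \<le> exp c"
    using assms(1) b by (auto intro!: prob_space_integral_bounds)
  then show "0 < (\<integral>x. exp (\<psi> x) \<partial>P)"
    by (meson exp_gt_zero less_le_trans)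
qed

text \<open>Gibbs' inequality is applied to the tilted density \<open>exp \<psi> / Z\<close>, which
  has mass 1 and whose logarithm differs from \<psi> by the constant \<open>ln Z\<close>.\<close>

lemma Donsker_Varadhan:
  fixes \<psi> :: "'a \<Rightarrow> real"
  assumes P: "prob_space P" and \<mu>: "prob_space \<mu>" and s: "sets \<mu> = sets P" and fin: "KL \<mu> P < \<infinity>"
    and \<psi> [measurable]: "\<psi> \<in> borel_measurable P" and b: "\<And>x. \<bar>\<psi> x\<bar> \<le> c"
  shows "(\<integral>x. \<psi> x \<partial>\<mu>) \<le> enn2real (KL \<mu> P) + ln (\<integral>x. exp (\<psi> x) \<partial>P)"
proof -
  interpret P: prob_space P by fact
  interpret \<mu>: prob_space \<mu> by fact
  note ac = KL_finite_ac[OF fin]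
  let ?f = "rdens P \<mu>"
  have d: "density P (\<lambda>x. ennreal (?f x)) = \<mu>"
    by (rule density_rdens[OF P \<mu> s ac])
  define Z where "Z = (\<integral>x. exp (\<psi> x) \<partial>P)"
  note ie = integral_exp_bounded[OF P \<psi> b]
  have Z: "Z > 0" unfolding Z_def by (rule ie)
  have \<mu>\<psi>: "integrable \<mu> \<psi>"
    using \<mu> \<psi> b s by (intro prob_space_integrable_bounded[where c = c]) (auto cong: measurable_cong_sets)
  define h where "h x = exp (\<psi> x) / Z" for x
  have lnh: "ln (h x) = \<psi> x - ln Z" for x
    using Z by (simp add: h_def ln_div)
  have [measurable]: "h \<in> borel_measurable P"
    unfolding h_def by measurable
  have i: "integrable \<mu> (\<lambda>x. ln (h x))"
    unfolding lnh using \<mu>\<psi> by simp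
  have i': "integrable P (\<lambda>x. ?f x * ln (h x))"
    using i integrable_rdens_iff[OF P \<mu> s ac, of "\<lambda>x. ln (h x)"] by simp
  have "(\<integral>x. \<psi> x \<partial>\<mu>) - ln Z = (\<integral>x. ln (h x) \<partial>\<mu>)"
    unfolding lnh using \<mu>\<psi> by (simp add: \<mu>.prob_space)
  also have "\<dots> = (\<integral>x. ?f x * ln (h x) \<partial>P)"
    by (rule integral_rdens[OF P \<mu> s ac]) measurable
  also have "\<dots> \<le> enn2real (\<integral>\<^sup>+x. ennreal (ent_fun (?f x)) \<partial>P)"
  proof (rule Gibbs_integral_le[OF P])
    show "prob_space (density P (\<lambda>x. ennreal (?f x)))"
      using \<mu> by (simp add: d)
    show "(\<integral>\<^sup>+x. ennreal (ent_fun (?f x)) \<partial>P) < \<infinity>"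
      using fin KL_eq_rdens[OF P \<mu> s ac] by simp
    have "(\<integral>\<^sup>+x. ennreal (h x) \<partial>P) = ennreal (\<integral>x. h x \<partial>P)"
      using ie(1) Z by (intro nn_integral_eq_integral) (auto simp: h_def)
    also have "\<dots> = 1"
      using Z by (simp add: h_def Z_def[symmetric])
    finally show "(\<integral>\<^sup>+x. ennreal (h x) \<partial>P) \<le> 1" by simp
  qed (use Z i' in \<open>auto simp: rdens_nonneg h_def\<close>)
  finally show ?thesis
    using KL_eq_rdens[OF P \<mu> s ac] by (simp add: Z_def)
qed

text \<open>Converse of the Donsker--Varadhan formula. The optimal test function is the logarithm of
  the density, which may be unbounded; it is truncated, and Fatou's lemma removes the truncation.
  Data processing, the one-step estimate and the mixture bound all rest on this criterion.\<close>

lemma KL_leI: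
  assumes P: "prob_space P" and \<mu>: "prob_space \<mu>" and s: "sets \<mu> = sets P" and B: "0 \<le> B"
    and dv: "\<And>\<psi> c. \<psi> \<in> borel_measurable P \<Longrightarrow> (\<And>x. \<bar>\<psi> x\<bar> \<le> (c::real)) \<Longrightarrow>
        (\<integral>x. \<psi> x \<partial>\<mu>) \<le> B + ln (\<integral>x. exp (\<psi> x) \<partial>P)"
  shows "KL \<mu> P \<le> ennreal B"
proof -
  interpret P: prob_space P by fact
  interpret \<mu>: prob_space \<mu> by fact
  have ac: "absolutely_continuous P \<mu>"
    unfolding absolutely_continuous_def
  proof (intro subsetI)
    fix A assume A: "A \<in> null_sets P"
    then have [measurable]: "A \<in> sets P" "A \<in> sets \<mu>" using s by auto
    \<comment> \<open>On a null set of \<open>P\<close> the test function does not affect the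
      logarithmic term, so \<open>k\<close> times the \<mu>-measure of that set stays bounded as
      \<open>k\<close> grows.\<close>
    have "real k * measure \<mu> A \<le> B" for k
    proof -
      have "(\<integral>x. real k * indicator A x \<partial>\<mu>) \<le> B + ln (\<integral>x. exp (real k * indicator A x) \<partial>P)"
        by (rule dv[where c = "real k"]) (auto simp: indicator_def)
      moreover have "(\<integral>x. exp (real k * indicator A x) \<partial>P) = (\<integral>x. 1 \<partial>P)"
      proof (intro integral_cong_AE)
        show "AE x in P. exp (real k * indicator A x) = 1"
          using AE_not_in[OF A] by eventually_elim simp
      qed auto
      ultimately show ?thesis by (simp add: P.prob_space \<mu>.emeasure_eq_measure)
    qed
    then have "measure \<mu> A = 0"
      by (metis B ex_less_of_nat_mult measure_nonneg not_less order_less_le)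
    then show "A \<in> null_sets \<mu>"
      by (simp add: null_sets_def \<mu>.emeasure_eq_measure)
  qed
  let ?f = "rdens P \<mu>"
  have d: "density P (\<lambda>x. ennreal (?f x)) = \<mu>"
    by (rule density_rdens[OF P \<mu> s ac])
  note fnn = rdens_nonneg[of P \<mu>]
  have D: "prob_space (density P (\<lambda>x. ennreal (?f x)))"
    using \<mu> by (simp add: d)
  have intf: "integrable P ?f"
    by (rule integrable_prob_density[OF D]) (auto simp: fnn)
  \<comment> \<open>Truncation on both sides keeps \<open>ln (h n x)\<close> bounded. The terms
    \<open>- h n x + 1\<close> in \<open>G n x\<close> are there to absorb the logarithm of the mass
    of \<open>h n\<close>.\<close>
  define h where "h n x = max (1 / real (Suc n)) (min (?f x) (real (Suc n)))" for n x
  define G where "G n x = ?f x * ln (h n x) - h n x + 1" for n x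
  have hpos: "h n x > 0" for n x unfolding h_def by (simp add: less_max_iff_disj)
  have hb: "1 / real (Suc n) \<le> h n x" "h n x \<le> real (Suc n)" for n x
    unfolding h_def by (auto simp: field_simps)
  have lnh: "\<bar>ln (h n x)\<bar> \<le> ln (real (Suc n))" for n x
  proof -
    have "ln (1 / real (Suc n)) \<le> ln (h n x)" "ln (h n x) \<le> ln (real (Suc n))"
      using hb[of n x] hpos[of n x] by (auto simp del: of_nat_Suc)
    then show ?thesis by (simp add: ln_div del: of_nat_Suc)
  qed
  have [measurable]: "h n \<in> borel_measurable P" for n
    unfolding h_def by measurable
  have [measurable]: "G n \<in> borel_measurable P" for n
    unfolding G_def by measurable
  \<comment> \<open>Fatou's lemma needs this sign. Where the density is cut at \<open>N\<close> or
    \<open>1 / N\<close>, \<open>ln (h n x)\<close> has the sign for which replacing the density by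
    \<open>h n x\<close> decreases the product, so \<open>G n x\<close> is at least
    \<open>ent_fun (h n x)\<close>.\<close>
  have G0: "0 \<le> G n x" for n x
  proof -
    define N where "N = real (Suc n)"
    have N: "N \<ge> 1" by (simp add: N_def)
    have hN: "h n x = max (1 / N) (min (?f x) N)" by (simp add: h_def N_def)
    consider "?f x > N" | "?f x < 1 / N" | "1 / N \<le> ?f x" "?f x \<le> N" by linarith
    then show ?thesis
    proof cases
      case 1
      with N have h: "h n x = N" unfolding hN
        by (smt (verit) divide_le_eq_1 less_divide_eq_1_pos)
      have "N * ln N \<le> ?f x * ln N"
        using 1 N by (intro mult_right_mono) auto
      with ent_fun_nonneg[of N] N show ?thesis by (simp add: G_def h ent_fun_def)
    next
      case 2
      with N have h: "h n x = 1 / N" unfolding hN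
        by (smt (verit) divide_le_eq_1)
      have "1 / N * ln (1 / N) \<le> ?f x * ln (1 / N)"
        using 2 N by (intro mult_right_mono_neg) (auto simp: ln_div)
      with ent_fun_nonneg[of "1 / N"] N show ?thesis by (simp add: G_def h ent_fun_def)
    next
      case 3
      then have "h n x = ?f x" unfolding hN by simp
      with ent_fun_nonneg[OF fnn] show ?thesis by (simp add: G_def ent_fun_def)
    qed
  qed
  have GB: "(\<integral>\<^sup>+x. ennreal (G n x) \<partial>P) \<le> ennreal B" for n
  proof -
    have ih: "integrable P (h n)"
      using P hpos[of n] hb[of n]
      by (intro prob_space_integrable_bounded[where c = "real (Suc n)"]) (auto simp: abs_of_pos)
    have il: "integrable \<mu> (\<lambda>x. ln (h n x))"
      using \<mu> lnh[of n] by (intro prob_space_integrable_bounded[where c = "ln (real (Suc n))"])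
        (auto simp: measurable_cong_sets[OF s refl])
    have ifl: "integrable P (\<lambda>x. ?f x * ln (h n x))"
      using il integrable_rdens_iff[OF P \<mu> s ac, of "\<lambda>x. ln (h n x)"] by simp
    have iG: "integrable P (G n)"
      unfolding G_def using ifl ih by auto
    define Z where "Z = (\<integral>x. h n x \<partial>P)"
    have Z: "Z > 0"
      using prob_space_integral_bounds(1)[OF P, of "h n" "1 / real (Suc n)"] hb[of n]
      by (smt (verit) Z_def \<open>\<And>n. h n \<in> borel_measurable P\<close> divide_pos_pos of_nat_0_less_iff zero_less_Suc)
    have "(\<integral>x. G n x \<partial>P) = (\<integral>x. ?f x * ln (h n x) \<partial>P) - Z + 1"
      unfolding G_def Z_def using ifl ih by (simp add: P.prob_space)
    also have "(\<integral>x. ?f x * ln (h n x) \<partial>P) = (\<integral>x. ln (h n x) \<partial>\<mu>)"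
      by (rule integral_rdens[OF P \<mu> s ac, symmetric]) measurable
    also have "\<dots> \<le> B + ln (\<integral>x. exp (ln (h n x)) \<partial>P)"
      by (rule dv[OF _ lnh]) measurable
    also have "(\<integral>x. exp (ln (h n x)) \<partial>P) = Z"
      using hpos by (simp add: Z_def)
    \<comment> \<open>The inequality \<open>ln Z \<le> Z - 1\<close> cancels what the missing
      normalisation of \<open>h n\<close> left behind.\<close>
    finally have "(\<integral>x. G n x \<partial>P) \<le> B"
      using ln_le_minus_one[OF Z] by simp
    then show ?thesis
      using iG G0 by (subst nn_integral_eq_integral) (auto intro!: ennreal_leI)
  qed
  have lim: "(\<lambda>n. G n x) \<longlonglongrightarrow> ent_fun (?f x)" for x
  proof (cases "?f x = 0")
    case True
    have "h n x = 1 / real (Suc n)" for n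
      using True by (simp add: h_def)
    then have "(\<lambda>n. G n x) = (\<lambda>n. - (1 / real (Suc n)) + 1)"
      using True by (simp add: G_def)
    moreover have "(\<lambda>n. - (1 / real (Suc n)) + 1) \<longlonglongrightarrow> - 0 + 1"
      by (intro tendsto_intros LIMSEQ_Suc lim_1_over_n)
    ultimately show ?thesis using True by simp
  next
    case False
    then have f: "?f x > 0" using fnn[of x] by simp
    have "\<forall>\<^sub>F n in sequentially. 1 / real (Suc n) < ?f x"
      using order_tendstoD(2)[OF LIMSEQ_Suc[OF lim_1_over_n] f] by simp
    moreover have "\<forall>\<^sub>F n in sequentially. ?f x < real (Suc n)"
      using filterlim_compose[OF filterlim_real_sequentially filterlim_Suc]
      by (auto simp: filterlim_at_top_dense)
    ultimately have "\<forall>\<^sub>F n in sequentially. G n x = ent_fun (?f x)"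
      by eventually_elim (simp add: G_def h_def ent_fun_def)
    then show ?thesis by (rule tendsto_eventually)
  qed
  have "KL \<mu> P = (\<integral>\<^sup>+x. ennreal (ent_fun (?f x)) \<partial>P)"
    by (rule KL_eq_rdens[OF P \<mu> s ac])
  also have "\<dots> = (\<integral>\<^sup>+x. liminf (\<lambda>n. ennreal (G n x)) \<partial>P)"
    using lim by (intro nn_integral_cong lim_imp_Liminf[symmetric]) (auto intro!: tendsto_ennrealI)
  also have "\<dots> \<le> liminf (\<lambda>n. \<integral>\<^sup>+x. ennreal (G n x) \<partial>P)"
    by (intro nn_integral_liminf) measurable
  also have "\<dots> \<le> ennreal B"
    using GB by (intro Liminf_le) (auto intro: always_eventually)
  finally show ?thesis .
qed

section \<open>Isotropic Gaussian measures\<close>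

text \<open>The radial form of the density: rotations, dilations and translations reduce to
  identities for the norm.\<close>

definition gauss_dens :: "real \<Rightarrow> 'a::euclidean_space \<Rightarrow> real" where
  "gauss_dens s x = (1 / sqrt (2 * pi * s\<^sup>2)) ^ DIM('a) * exp (- (norm x)\<^sup>2 / (2 * s\<^sup>2))"

lemma gauss_dens_measurable [measurable]: "gauss_dens s \<in> borel_measurable borel"
  unfolding gauss_dens_def[abs_def] by measurable

lemma gauss_dens_nonneg: "0 \<le> gauss_dens s x"
  by (simp add: gauss_dens_def)

lemma iso_gaussian_eq:
  "iso_gaussian m s = density lborel (\<lambda>x::'a::euclidean_space. ennreal (gauss_dens s (x - m)))"
proof -
  have "(\<Prod>b\<in>Basis. normal_density (m \<bullet> b) s (x \<bullet> b)) = gauss_dens s (x - m)" for x :: 'a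
  proof -
    have "(\<Prod>b\<in>Basis. normal_density (m \<bullet> b) s (x \<bullet> b)) =
        (1 / sqrt (2 * pi * s\<^sup>2)) ^ DIM('a) * (\<Prod>b\<in>Basis. exp (- (x \<bullet> b - m \<bullet> b)\<^sup>2 / (2 * s\<^sup>2)))"
      by (simp add: normal_density_def prod.distrib prod_dividef power_divide)
    also have "(\<Prod>b\<in>Basis. exp (- (x \<bullet> b - m \<bullet> b)\<^sup>2 / (2 * s\<^sup>2))) =
        exp (\<Sum>b\<in>Basis. - (x \<bullet> b - m \<bullet> b)\<^sup>2 / (2 * s\<^sup>2))"
      by (simp add: exp_sum)
    also have "(\<Sum>b\<in>Basis. - (x \<bullet> b - m \<bullet> b)\<^sup>2 / (2 * s\<^sup>2)) = - (norm (x - m))\<^sup>2 / (2 * s\<^sup>2)"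
      unfolding power2_norm_eq_inner
      by (subst euclidean_inner)
        (simp add: inner_diff_left power2_eq_square sum_negf sum_divide_distrib)
    finally show ?thesis by (simp add: gauss_dens_def)
  qed
  then show ?thesis by (simp add: iso_gaussian_def)
qed

lemma sets_iso_gaussian [simp, measurable_cong]: "sets (iso_gaussian m s) = sets borel"
  by (simp add: iso_gaussian_def)

lemma space_iso_gaussian [simp]: "space (iso_gaussian m s) = UNIV"
  by (simp add: iso_gaussian_def)

abbreviation (input) gauss :: "real \<Rightarrow> 'a::euclidean_space measure" where
  "gauss \<equiv> iso_gaussian 0"

lemma nn_integral_iso_gaussian:
  assumes [measurable]: "F \<in> borel_measurable borel"
  shows "(\<integral>\<^sup>+x. F x \<partial>gauss s) =
    (\<integral>\<^sup>+x. ennreal (gauss_dens s (x::'a::euclidean_space)) * F x \<partial>lborel)"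
  by (simp add: iso_gaussian_eq nn_integral_density)

lemma nn_integral_lborel_affine:
  fixes t :: "'a::euclidean_space"
  assumes "c \<noteq> 0" and [measurable]: "F \<in> borel_measurable borel"
  shows "(\<integral>\<^sup>+x. F x \<partial>lborel) = ennreal (\<bar>c\<bar> ^ DIM('a)) * (\<integral>\<^sup>+x. F (t + c *\<^sub>R x) \<partial>lborel)"
  by (subst lborel_affine[OF assms(1), of t])
    (simp add: nn_integral_density nn_integral_distr nn_integral_cmult)

text \<open>The linear map is orthogonal on the product space, so the product of the radial
  densities is preserved. The change of variables is composed of two affine substitutions, each in
  one factor and with the other factor frozen; they divide by \<open>c\<close>, hence
  \<open>c > 0\<close>.\<close>

lemma iso_gaussian_rotation:
  fixes F :: "'a::euclidean_space \<times> 'a \<Rightarrow> ennreal"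
  assumes s: "s > 0" and ct: "c\<^sup>2 + t\<^sup>2 = 1" and c: "c > 0"
    and F [measurable]: "F \<in> borel_measurable (borel \<Otimes>\<^sub>M borel)"
  shows "(\<integral>\<^sup>+x. \<integral>\<^sup>+z. F (c *\<^sub>R x + t *\<^sub>R z, t *\<^sub>R x - c *\<^sub>R z) \<partial>gauss s \<partial>gauss s)
    = (\<integral>\<^sup>+x. \<integral>\<^sup>+z. F (x, z) \<partial>gauss s \<partial>gauss s)"
proof -
  define H where "H x y = ennreal (gauss_dens s x) * ennreal (gauss_dens s y) * F (x, y)" for x y :: 'a
  have [measurable]: "(\<lambda>p. H (fst p) (snd p)) \<in> borel_measurable (borel \<Otimes>\<^sub>M borel)"
    unfolding H_def by measurable
  then have Hm [measurable (raw)]: "(\<lambda>w. H (f w) (h w)) \<in> borel_measurable M"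
    if "f \<in> borel_measurable M" "h \<in> borel_measurable M" for f h and M :: "'b measure"
    using measurable_compose[OF measurable_Pair[OF that] \<open>(\<lambda>p. H (fst p) (snd p)) \<in> _\<close>] by simp
  have Fm [measurable (raw)]: "(\<lambda>w. F (f w, h w)) \<in> borel_measurable M"
    if "f \<in> borel_measurable M" "h \<in> borel_measurable M" for f h and M :: "'b measure"
    using measurable_compose[OF measurable_Pair[OF that] F] by simp
  have nrm: "(norm (c *\<^sub>R x + t *\<^sub>R z))\<^sup>2 + (norm (t *\<^sub>R x - c *\<^sub>R z))\<^sup>2 = (norm x)\<^sup>2 + (norm z)\<^sup>2"
    for x z :: 'a
  proof -
    have "(norm (c *\<^sub>R x + t *\<^sub>R z))\<^sup>2 + (norm (t *\<^sub>R x - c *\<^sub>R z))\<^sup>2 =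
        (c\<^sup>2 + t\<^sup>2) * (x \<bullet> x) + (c\<^sup>2 + t\<^sup>2) * (z \<bullet> z)"
      unfolding power2_norm_eq_inner
      by (simp add: inner_add_left inner_add_right inner_diff_left
          inner_diff_right inner_commute algebra_simps power2_eq_square)
    then show ?thesis by (simp add: ct power2_norm_eq_inner)
  qed
  have dens: "gauss_dens s (c *\<^sub>R x + t *\<^sub>R z) * gauss_dens s (t *\<^sub>R x - c *\<^sub>R z) =
      gauss_dens s x * gauss_dens s z" for x z :: 'a
  proof -
    have "exp (- (norm (c *\<^sub>R x + t *\<^sub>R z))\<^sup>2 / (2 * s\<^sup>2)) * exp (- (norm (t *\<^sub>R x - c *\<^sub>R z))\<^sup>2 / (2 * s\<^sup>2))
      = exp (- (norm x)\<^sup>2 / (2 * s\<^sup>2)) * exp (- (norm z)\<^sup>2 / (2 * s\<^sup>2))"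
      unfolding exp_add[symmetric] add_divide_distrib[symmetric] using nrm[of x z]
      by (smt (verit, best))
    then show ?thesis by (simp add: gauss_dens_def)
  qed
  have E: "(\<integral>\<^sup>+x. \<integral>\<^sup>+z. G x z \<partial>gauss s \<partial>gauss s) =
      (\<integral>\<^sup>+x. \<integral>\<^sup>+z. ennreal (gauss_dens s x) * ennreal (gauss_dens s z) * G x z \<partial>lborel \<partial>lborel)"
    if [measurable]: "(\<lambda>p. G (fst p) (snd p)) \<in> borel_measurable (borel \<Otimes>\<^sub>M borel)"
    for G :: "'a \<Rightarrow> 'a \<Rightarrow> ennreal"
  proof -
    have Gm: "(\<lambda>w. G (f w) (h w)) \<in> borel_measurable M"
      if "f \<in> borel_measurable M" "h \<in> borel_measurable M" for f h and M :: "'c measure"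
      using measurable_compose[OF measurable_Pair[OF that] \<open>(\<lambda>p. G (fst p) (snd p)) \<in> _\<close>] by simp
    have [measurable]: "G x \<in> borel_measurable borel" for x
      by (rule Gm) auto
    have [measurable]: "(\<lambda>p. G (fst p) (snd p)) \<in> borel_measurable (borel \<Otimes>\<^sub>M lborel)"
      by (rule measurable_compose_rev[OF that]) auto
    have "(\<lambda>x. \<integral>\<^sup>+z. ennreal (gauss_dens s z) * G x z \<partial>lborel) \<in> borel_measurable borel"
      by measurable
    then show ?thesis
      by (simp add: nn_integral_iso_gaussian nn_integral_cmult[symmetric] mult.assoc)
  qed
  have "(\<integral>\<^sup>+x. \<integral>\<^sup>+z. F (x, z) \<partial>gauss s \<partial>gauss s) = (\<integral>\<^sup>+x. \<integral>\<^sup>+y. H x y \<partial>lborel \<partial>lborel)"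
    unfolding H_def by (subst E) auto
  \<comment> \<open>For fixed \<open>x\<close> the second variable is substituted; after exchanging
    the integrals, \<open>x\<close> is replaced by \<open>t z + c x\<close> for fixed
    \<open>z\<close>. The Jacobians are reciprocal and cancel at the end.\<close>
  also have "\<dots> = (\<integral>\<^sup>+x. ennreal (\<bar>- 1 / c\<bar> ^ DIM('a)) *
      (\<integral>\<^sup>+z. H x ((t / c) *\<^sub>R x + (- 1 / c) *\<^sub>R z) \<partial>lborel) \<partial>lborel)"
    using c by (intro nn_integral_cong nn_integral_lborel_affine) auto
  also have "\<dots> = ennreal (\<bar>- 1 / c\<bar> ^ DIM('a)) *
      (\<integral>\<^sup>+x. \<integral>\<^sup>+z. H x ((t / c) *\<^sub>R x + (- 1 / c) *\<^sub>R z) \<partial>lborel \<partial>lborel)"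
    by (rule nn_integral_cmult) measurable
  also have "(\<integral>\<^sup>+x. \<integral>\<^sup>+z. H x ((t / c) *\<^sub>R x + (- 1 / c) *\<^sub>R z) \<partial>lborel \<partial>lborel) =
      (\<integral>\<^sup>+z. \<integral>\<^sup>+x. H x ((t / c) *\<^sub>R x + (- 1 / c) *\<^sub>R z) \<partial>lborel \<partial>lborel)"
    by (rule lborel_pair.Fubini') measurable
  also have "\<dots> = (\<integral>\<^sup>+z. ennreal (\<bar>c\<bar> ^ DIM('a)) * (\<integral>\<^sup>+x. H (t *\<^sub>R z + c *\<^sub>R x)
      ((t / c) *\<^sub>R (t *\<^sub>R z + c *\<^sub>R x) + (- 1 / c) *\<^sub>R z) \<partial>lborel) \<partial>lborel)"
    using c by (intro nn_integral_cong nn_integral_lborel_affine) auto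
  also have "\<dots> = ennreal (\<bar>c\<bar> ^ DIM('a)) * (\<integral>\<^sup>+z. \<integral>\<^sup>+x. H (t *\<^sub>R z + c *\<^sub>R x)
      ((t / c) *\<^sub>R (t *\<^sub>R z + c *\<^sub>R x) + (- 1 / c) *\<^sub>R z) \<partial>lborel \<partial>lborel)"
    by (rule nn_integral_cmult) measurable
  also have "(\<integral>\<^sup>+z. \<integral>\<^sup>+x. H (t *\<^sub>R z + c *\<^sub>R x)
      ((t / c) *\<^sub>R (t *\<^sub>R z + c *\<^sub>R x) + (- 1 / c) *\<^sub>R z) \<partial>lborel \<partial>lborel) =
      (\<integral>\<^sup>+z. \<integral>\<^sup>+x. ennreal (gauss_dens s x) * ennreal (gauss_dens s z) *
        F (c *\<^sub>R x + t *\<^sub>R z, t *\<^sub>R x - c *\<^sub>R z) \<partial>lborel \<partial>lborel)"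
  proof (intro nn_integral_cong)
    fix x z :: 'a
    have "(t / c) *\<^sub>R (t *\<^sub>R z + c *\<^sub>R x) + (- 1 / c) *\<^sub>R z = t *\<^sub>R x + ((t\<^sup>2 - 1) / c) *\<^sub>R z"
      using c by (simp add: algebra_simps diff_divide_distrib power2_eq_square)
    also have "(t\<^sup>2 - 1) / c = - c"
      using c ct by (simp add: field_simps power2_eq_square)
    finally have "(t / c) *\<^sub>R (t *\<^sub>R z + c *\<^sub>R x) + (- 1 / c) *\<^sub>R z = t *\<^sub>R x - c *\<^sub>R z"
      by simp
    then show "H (t *\<^sub>R z + c *\<^sub>R x) ((t / c) *\<^sub>R (t *\<^sub>R z + c *\<^sub>R x) + (- 1 / c) *\<^sub>R z) =
        ennreal (gauss_dens s x) * ennreal (gauss_dens s z) *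
        F (c *\<^sub>R x + t *\<^sub>R z, t *\<^sub>R x - c *\<^sub>R z)"
      using dens[of x z]
      by (simp add: H_def ennreal_mult[symmetric] gauss_dens_nonneg add.commute)
  qed
  also have "\<dots> = (\<integral>\<^sup>+x. \<integral>\<^sup>+z. ennreal (gauss_dens s x) * ennreal (gauss_dens s z) *
        F (c *\<^sub>R x + t *\<^sub>R z, t *\<^sub>R x - c *\<^sub>R z) \<partial>lborel \<partial>lborel)"
    by (rule lborel_pair.Fubini') measurable
  also have "\<dots> = (\<integral>\<^sup>+x. \<integral>\<^sup>+z. F (c *\<^sub>R x + t *\<^sub>R z, t *\<^sub>R x - c *\<^sub>R z)
      \<partial>gauss s \<partial>gauss s)"
    by (subst E) auto
  also have "ennreal (\<bar>- 1 / c\<bar> ^ DIM('a)) * (ennreal (\<bar>c\<bar> ^ DIM('a)) * \<dots>) = \<dots>"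
    using c by (simp add: mult.assoc[symmetric] ennreal_mult[symmetric] power_mult_distrib[symmetric])
  finally show ?thesis by simp
qed

lemma iso_gaussian_add_unit:
  fixes \<psi> :: "'a::euclidean_space \<Rightarrow> ennreal"
  assumes s: "s > 0" and pq: "p\<^sup>2 + q\<^sup>2 = 1" "0 \<le> p" "0 \<le> q"
    and [measurable]: "\<psi> \<in> borel_measurable borel"
  shows "(\<integral>\<^sup>+x. \<integral>\<^sup>+z. \<psi> (p *\<^sub>R x + q *\<^sub>R z) \<partial>gauss s \<partial>gauss s) =
    (\<integral>\<^sup>+x. \<psi> x \<partial>gauss s)"
proof -
  interpret prob_space "iso_gaussian (0::'a) s" by (rule prob_space_iso_gaussian[OF s])
  show ?thesis
  proof (cases "p = 0")
    case True
    with pq have "q = 1" by (simp add: power2_eq_1_iff)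
    with True show ?thesis by (simp add: emeasure_space_1[simplified])
  next
    case False
    have "(\<lambda>x. \<psi> (fst x)) \<in> borel_measurable (borel \<Otimes>\<^sub>M borel)" by measurable
    from iso_gaussian_rotation[OF s pq(1) _ this] False pq show ?thesis
      by (simp add: emeasure_space_1[simplified])
  qed
qed

text \<open>Stated with an image measure rather than with \<open>iso_gaussian 0 (r * s)\<close>, so
  that \<open>r = 0\<close>, where the law is a point mass, is included.\<close>

lemma iso_gaussian_add:
  fixes s :: real
  assumes s: "s > 0" and pq: "p\<^sup>2 + q\<^sup>2 = r\<^sup>2" "0 \<le> p" "0 \<le> q" "0 \<le> r"
  shows "distr (gauss s \<Otimes>\<^sub>M gauss s) borel (\<lambda>(x, z). p *\<^sub>R x + q *\<^sub>R z) =
    distr (gauss s) borel (\<lambda>x. r *\<^sub>R (x::'a::euclidean_space))"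
proof (rule measure_eqI)
  let ?P = "gauss s :: 'a measure"
  interpret prob_space ?P by (rule prob_space_iso_gaussian[OF s])
  interpret pp: pair_prob_space ?P ?P ..
  fix A assume "A \<in> sets (distr (?P \<Otimes>\<^sub>M ?P) borel (\<lambda>(x, z). p *\<^sub>R x + q *\<^sub>R z))"
  then have [measurable]: "A \<in> sets borel" by simp
  have "emeasure (distr (?P \<Otimes>\<^sub>M ?P) borel (\<lambda>(x, z). p *\<^sub>R x + q *\<^sub>R z)) A =
      (\<integral>\<^sup>+x. indicator A x \<partial>distr (?P \<Otimes>\<^sub>M ?P) borel (\<lambda>(x, z). p *\<^sub>R x + q *\<^sub>R z))"
    by simp
  also have "\<dots> = (\<integral>\<^sup>+y. indicator A (p *\<^sub>R fst y + q *\<^sub>R snd y) \<partial>(?P \<Otimes>\<^sub>M ?P))"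
    by (subst nn_integral_distr) (auto simp: case_prod_beta')
  also have "\<dots> = (\<integral>\<^sup>+x. \<integral>\<^sup>+z. indicator A (p *\<^sub>R x + q *\<^sub>R z) \<partial>?P \<partial>?P)"
    by (subst nn_integral_fst[symmetric]) auto
  also have "\<dots> = (\<integral>\<^sup>+x. indicator A (r *\<^sub>R x) \<partial>?P)"
  proof (cases "r = 0")
    case True
    then have "p = 0" "q = 0" using pq by (auto simp: sum_power2_eq_zero_iff)
    with True show ?thesis by (simp add: emeasure_space_1[simplified])
  next
    case False
    have "(p / r)\<^sup>2 + (q / r)\<^sup>2 = 1"
      using False pq by (simp add: power_divide add_divide_distrib[symmetric])
    from iso_gaussian_add_unit[OF s this, of "\<lambda>x. indicator A (r *\<^sub>R x)"] pq False
    show ?thesis by (simp add: scaleR_add_right)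
  qed
  also have "\<dots> = emeasure (distr ?P borel (\<lambda>x. r *\<^sub>R x)) A"
    by (subst nn_integral_distr[symmetric, where M' = borel]) auto
  finally show "emeasure (distr (?P \<Otimes>\<^sub>M ?P) borel (\<lambda>(x, z). p *\<^sub>R x + q *\<^sub>R z)) A =
      emeasure (distr ?P borel (\<lambda>x. r *\<^sub>R x)) A" .
qed simp

lemma iso_gaussian_scale:
  assumes c: "c > 0" and s: "s > 0"
  shows "iso_gaussian 0 (c * s) = distr (gauss s) borel (\<lambda>x. c *\<^sub>R (x::'a::euclidean_space))"
proof (rule measure_eqI)
  fix A assume "A \<in> sets (iso_gaussian (0::'a) (c * s))"
  then have [measurable]: "A \<in> sets borel" by simp
  have d: "gauss_dens (c * s) (c *\<^sub>R x) = (1 / c) ^ DIM('a) * gauss_dens s x" for x :: 'a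
  proof -
    have "(1 / sqrt (2 * pi * (c * s)\<^sup>2)) = (1 / c) * (1 / sqrt (2 * pi * s\<^sup>2))"
      using c by (simp add: power_mult_distrib real_sqrt_mult)
    then show ?thesis
      using c by (simp add: gauss_dens_def power_mult_distrib power_divide field_simps)
  qed
  have "emeasure (iso_gaussian 0 (c * s)) A = (\<integral>\<^sup>+x. indicator A x \<partial>iso_gaussian (0::'a) (c * s))"
    by simp
  also have "\<dots> = (\<integral>\<^sup>+x. ennreal (gauss_dens (c * s) x) * indicator A x \<partial>lborel)"
    by (rule nn_integral_iso_gaussian) measurable
  also have "\<dots> = ennreal (\<bar>c\<bar> ^ DIM('a)) *
      (\<integral>\<^sup>+x. ennreal (gauss_dens (c * s) (0 + c *\<^sub>R x)) * indicator A (0 + c *\<^sub>R x) \<partial>lborel)"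
    using c by (intro nn_integral_lborel_affine) auto
  also have "\<dots> = (\<integral>\<^sup>+x. ennreal (gauss_dens s x) * indicator A (c *\<^sub>R x) \<partial>lborel)"
    using c
    by (subst nn_integral_cmult[symmetric], simp)
      (auto intro!: nn_integral_cong simp: d ennreal_mult[symmetric] mult.assoc[symmetric]
        power_mult_distrib[symmetric] gauss_dens_nonneg)
  also have "\<dots> = (\<integral>\<^sup>+x. indicator A (c *\<^sub>R x) \<partial>gauss s)"
    by (rule nn_integral_iso_gaussian[symmetric]) measurable
  also have "\<dots> = emeasure (distr (gauss s) borel (\<lambda>x. c *\<^sub>R x)) A"
    by (subst nn_integral_distr[symmetric, where M' = borel]) auto
  finally show "emeasure (iso_gaussian 0 (c * s)) A =
      emeasure (distr (gauss s) borel (\<lambda>x. c *\<^sub>R x)) A" .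
qed simp

text \<open>The map in \<open>iso_gaussian_rotation\<close> is its own inverse, because of the minus
  sign in its second component. So the kernel that sends \<open>x\<close> to
  \<open>c x + t z\<close> is symmetric for the Gaussian law, and evolving a measure amounts to
  evolving its density.\<close>

lemma iso_gaussian_reversible:
  fixes f \<psi> :: "'a::euclidean_space \<Rightarrow> ennreal"
  assumes s: "s > 0" and ct: "c\<^sup>2 + t\<^sup>2 = 1" and c: "c > 0"
    and [measurable]: "f \<in> borel_measurable borel" "\<psi> \<in> borel_measurable borel"
  shows "(\<integral>\<^sup>+x. f x * (\<integral>\<^sup>+z. \<psi> (c *\<^sub>R x + t *\<^sub>R z) \<partial>gauss s) \<partial>gauss s) =
    (\<integral>\<^sup>+x. \<psi> x * (\<integral>\<^sup>+z. f (c *\<^sub>R x + t *\<^sub>R z) \<partial>gauss s) \<partial>gauss s)"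
proof -
  have "c *\<^sub>R (c *\<^sub>R x + t *\<^sub>R z) + t *\<^sub>R (t *\<^sub>R x - c *\<^sub>R z) = x" for x z :: 'a
  proof -
    have "c *\<^sub>R (c *\<^sub>R x + t *\<^sub>R z) + t *\<^sub>R (t *\<^sub>R x - c *\<^sub>R z) = (c\<^sup>2 + t\<^sup>2) *\<^sub>R x"
      by (simp add: algebra_simps power2_eq_square)
    then show ?thesis by (simp add: ct)
  qed
  then show ?thesis
    using iso_gaussian_rotation[OF s ct c, of "\<lambda>p. \<psi> (fst p) * f (c *\<^sub>R fst p + t *\<^sub>R snd p)"]
    by (simp add: nn_integral_cmult nn_integral_multc mult.commute)
qed

text \<open>Cameron--Martin formula: the exponential is the density of the Gaussian translated by
  \<delta>.\<close>

lemma iso_gaussian_shift: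
  fixes F :: "'a::euclidean_space \<Rightarrow> ennreal"
  assumes s: "s > 0" and [measurable]: "F \<in> borel_measurable borel"
  shows "(\<integral>\<^sup>+z. F z \<partial>gauss s) =
    (\<integral>\<^sup>+z. ennreal (exp ((z \<bullet> \<delta>) / s\<^sup>2 - (norm \<delta>)\<^sup>2 / (2 * s\<^sup>2))) * F (z - \<delta>) \<partial>gauss s)"
proof -
  have d: "gauss_dens s (z - \<delta>) = gauss_dens s z * exp ((z \<bullet> \<delta>) / s\<^sup>2 - (norm \<delta>)\<^sup>2 / (2 * s\<^sup>2))" for z
  proof -
    have "(norm (z - \<delta>))\<^sup>2 = (norm z)\<^sup>2 - 2 * (z \<bullet> \<delta>) + (norm \<delta>)\<^sup>2"
      by (simp add: power2_norm_eq_inner algebra_simps inner_commute)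
    then have "- (norm (z - \<delta>))\<^sup>2 / (2 * s\<^sup>2) =
        - (norm z)\<^sup>2 / (2 * s\<^sup>2) + ((z \<bullet> \<delta>) / s\<^sup>2 - (norm \<delta>)\<^sup>2 / (2 * s\<^sup>2))"
      by (simp add: diff_divide_distrib add_divide_distrib)
    then show ?thesis
      unfolding gauss_dens_def by (simp only: exp_add mult.assoc)
  qed
  have "(\<integral>\<^sup>+z. F z \<partial>gauss s) = (\<integral>\<^sup>+x. ennreal (gauss_dens s x) * F x \<partial>lborel)"
    by (rule nn_integral_iso_gaussian) measurable
  also have "\<dots> = (\<integral>\<^sup>+x. ennreal (gauss_dens s (x - \<delta>)) * F (x - \<delta>) \<partial>lborel)"
    using nn_integral_lborel_affine[of 1 "\<lambda>x. ennreal (gauss_dens s x) * F x" "- \<delta>"] by simp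
  also have "\<dots> = (\<integral>\<^sup>+x. ennreal (gauss_dens s x) *
      (ennreal (exp ((x \<bullet> \<delta>) / s\<^sup>2 - (norm \<delta>)\<^sup>2 / (2 * s\<^sup>2))) * F (x - \<delta>)) \<partial>lborel)"
    by (intro nn_integral_cong) (simp add: d ennreal_mult gauss_dens_nonneg mult.assoc)
  also have "\<dots> = (\<integral>\<^sup>+z. ennreal (exp ((z \<bullet> \<delta>) / s\<^sup>2 - (norm \<delta>)\<^sup>2 / (2 * s\<^sup>2))) * F (z - \<delta>) \<partial>gauss s)"
    by (rule nn_integral_iso_gaussian[symmetric]) measurable
  finally show ?thesis .
qed

lemma iso_gaussian_uminus: "distr (gauss s) borel uminus = iso_gaussian (0::'a::euclidean_space) s"
proof (rule measure_eqI)
  fix A assume "A \<in> sets (distr (gauss s) borel (uminus :: 'a \<Rightarrow> 'a))"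
  then have [measurable]: "A \<in> sets borel" by simp
  have "(\<integral>\<^sup>+x. indicator A (- x) \<partial>gauss s) =
      (\<integral>\<^sup>+x. ennreal (gauss_dens s x) * indicator A (- x) \<partial>(lborel :: 'a measure))"
    by (rule nn_integral_iso_gaussian) measurable
  also have "\<dots> = (\<integral>\<^sup>+x. ennreal (gauss_dens s x) * indicator A x \<partial>(lborel :: 'a measure))"
    using nn_integral_lborel_affine[of "-1" "\<lambda>x. ennreal (gauss_dens s x) * indicator A (- x)" "0::'a"]
    by (simp add: gauss_dens_def)
  also have "\<dots> = (\<integral>\<^sup>+x. indicator A x \<partial>gauss s)"
    by (rule nn_integral_iso_gaussian[symmetric]) measurable
  finally show "emeasure (distr (gauss s) borel uminus) A = emeasure (gauss s) A"
    by (subst (asm) nn_integral_distr[symmetric, where M' = borel]) auto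
qed simp

lemma iso_gaussian_exp_inner:
  assumes "s > 0"
  shows "integrable (gauss s) (\<lambda>z. exp (((z::'a::euclidean_space) \<bullet> \<delta>) / s\<^sup>2))"
proof -
  interpret prob_space "iso_gaussian (0::'a) s" by (rule prob_space_iso_gaussian[OF assms])
  have "(\<integral>\<^sup>+z. ennreal (exp ((z \<bullet> \<delta>) / s\<^sup>2 - (norm \<delta>)\<^sup>2 / (2 * s\<^sup>2))) \<partial>gauss s) = 1"
    using iso_gaussian_shift[OF assms, of "\<lambda>_. 1" \<delta>] by (simp add: emeasure_space_1[simplified])
  then have "integrable (gauss s) (\<lambda>z. exp ((z \<bullet> \<delta>) / s\<^sup>2 - (norm \<delta>)\<^sup>2 / (2 * s\<^sup>2)))"
    by (intro integrableI_nonneg) auto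
  then have "integrable (gauss s)
      (\<lambda>z. exp ((norm \<delta>)\<^sup>2 / (2 * s\<^sup>2)) * exp ((z \<bullet> \<delta>) / s\<^sup>2 - (norm \<delta>)\<^sup>2 / (2 * s\<^sup>2)))"
    by (rule integrable_mult_right)
  then show ?thesis by (simp add: exp_add[symmetric])
qed

text \<open>Domination by \<open>exp y + exp (- y)\<close> gives integrability, and symmetry gives
  mean 0.\<close>

lemma
  fixes \<delta> :: "'a::euclidean_space"
  assumes s: "s > 0"
  shows iso_gaussian_integrable_inner: "integrable (gauss s) (\<lambda>z. z \<bullet> \<delta>)"
    and iso_gaussian_integral_inner: "(\<integral>z. z \<bullet> \<delta> \<partial>gauss s) = 0"
proof -
  have "integrable (gauss s) (\<lambda>z. (z \<bullet> \<delta>) / s\<^sup>2)"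
  proof (rule Bochner_Integration.integrable_bound)
    show "integrable (gauss s) (\<lambda>z. exp ((z \<bullet> \<delta>) / s\<^sup>2) + exp ((z \<bullet> - \<delta>) / s\<^sup>2))"
      using s by (intro Bochner_Integration.integrable_add iso_gaussian_exp_inner)
    have "\<bar>y\<bar> \<le> exp y + exp (- y)" for y :: real
      using exp_ge_add_one_self[of y] exp_ge_add_one_self[of "- y"] exp_gt_zero[of y] exp_gt_zero[of "- y"]
      by linarith
    from this[of "(z \<bullet> \<delta>) / s\<^sup>2" for z]
    show "AE z in gauss s.
        norm ((z \<bullet> \<delta>) / s\<^sup>2) \<le> norm (exp ((z \<bullet> \<delta>) / s\<^sup>2) + exp ((z \<bullet> - \<delta>) / s\<^sup>2))"
      by (auto simp: abs_of_pos add_pos_pos)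
  qed measurable
  from integrable_mult_right[OF this, of "s\<^sup>2"]
  show i: "integrable (gauss s) (\<lambda>z. z \<bullet> \<delta>)"
    using s by simp
  have "(\<integral>z. z \<bullet> \<delta> \<partial>gauss s) = (\<integral>z. z \<bullet> \<delta> \<partial>distr (gauss s) borel uminus)"
    by (simp add: iso_gaussian_uminus)
  also have "\<dots> = (\<integral>z. - z \<bullet> \<delta> \<partial>gauss s)"
    by (rule integral_distr) measurable
  finally show "(\<integral>z. z \<bullet> \<delta> \<partial>gauss s) = 0"
    by simp
qed

text \<open>The variational formula for a translated Gaussian, with its divergence made explicit.
  Cameron--Martin rewrites the mean of \<open>exp \<psi>\<close> as that of \<open>exp W\<close>;
  Jensen's inequality for the logarithm then applies to \<open>W\<close>, whose linear part has mean
  0.\<close>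

lemma iso_gaussian_DV_shift:
  fixes \<psi> :: "'a::euclidean_space \<Rightarrow> real"
  assumes s: "s > 0" and [measurable]: "\<psi> \<in> borel_measurable borel" and b: "\<And>x. \<bar>\<psi> x\<bar> \<le> c"
  shows "(\<integral>z. \<psi> (z - \<delta>) \<partial>gauss s) \<le>
    ln (\<integral>z. exp (\<psi> z) \<partial>gauss s) + (norm \<delta>)\<^sup>2 / (2 * s\<^sup>2)"
proof -
  let ?P = "gauss s :: 'a measure"
  interpret prob_space ?P by (rule prob_space_iso_gaussian[OF s])
  define \<kappa> where "\<kappa> = (norm \<delta>)\<^sup>2 / (2 * s\<^sup>2)"
  define W where "W z = \<psi> (z - \<delta>) + (z \<bullet> \<delta>) / s\<^sup>2 - \<kappa>" for z
  have [measurable]: "W \<in> borel_measurable borel" unfolding W_def by measurable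
  define Z where "Z = (\<integral>z. exp (\<psi> z) \<partial>?P)"
  have \<psi>m: "\<psi> \<in> borel_measurable ?P" by measurable
  note ie = integral_exp_bounded[OF prob_space_axioms \<psi>m b, folded Z_def]
  have "ennreal Z = (\<integral>\<^sup>+z. ennreal (exp (\<psi> z)) \<partial>?P)"
    unfolding Z_def by (rule nn_integral_eq_integral[symmetric]) (use ie(1) in auto)
  also have "\<dots> = (\<integral>\<^sup>+z. ennreal (exp (W z)) \<partial>?P)"
    by (subst iso_gaussian_shift[OF s, of _ \<delta>])
      (auto simp: W_def \<kappa>_def ennreal_mult[symmetric] exp_add[symmetric] algebra_simps intro!: nn_integral_cong)
  finally have hb: "has_bochner_integral ?P (\<lambda>z. exp (W z)) Z"
    using ie(4) by (intro has_bochner_integral_nn_integral) auto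
  have i\<psi>: "integrable ?P (\<lambda>z. \<psi> (z - \<delta>))"
    using b prob_space_axioms by (intro prob_space_integrable_bounded[where c = c]) auto
  note ii = iso_gaussian_integrable_inner[OF s, of \<delta>]
  have iW: "integrable ?P W"
    unfolding W_def using i\<psi> ii by simp
  have "(\<integral>z. W z - ln Z \<partial>?P) \<le> (\<integral>z. exp (W z) / Z - 1 \<partial>?P)"
  proof (rule integral_mono)
    show "W z - ln Z \<le> exp (W z) / Z - 1" for z
      using ln_le_minus_one[of "exp (W z) / Z"] ie(4) by (simp add: ln_div)
  qed (use iW hb in \<open>auto simp: has_bochner_integral_iff\<close>)
  also have "\<dots> = 0"
    using hb ie(4) by (simp add: has_bochner_integral_iff prob_space[simplified])
  finally have "(\<integral>z. W z \<partial>?P) \<le> ln Z"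
    using iW by (simp add: prob_space[simplified])
  also have "(\<integral>z. W z \<partial>?P) = (\<integral>z. \<psi> (z - \<delta>) \<partial>?P) - \<kappa>"
    unfolding W_def using i\<psi> ii
    by (simp add: prob_space[simplified] iso_gaussian_integral_inner[OF s])
  finally show ?thesis by (simp add: Z_def \<kappa>_def)
qed

section \<open>Entropy contraction of the Ornstein--Uhlenbeck kernel\<close>

text \<open>Data processing: a bounded test function on the target pulls back along \<open>T\<close>
  to a bounded one on the source.\<close>

lemma KL_distr_le:
  assumes P: "prob_space P" and \<mu>: "prob_space \<mu>" and s: "sets \<mu> = sets P"
    and T [measurable]: "T \<in> P \<rightarrow>\<^sub>M Q"
  shows "KL (distr \<mu> Q T) (distr P Q T) \<le> KL \<mu> P"
proof (cases "KL \<mu> P = \<infinity>")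
  case False
  then have fin: "KL \<mu> P < \<infinity>" by (simp add: less_top)
  have T' [measurable]: "T \<in> \<mu> \<rightarrow>\<^sub>M Q" using T by (simp add: measurable_cong_sets[OF s refl])
  have "KL (distr \<mu> Q T) (distr P Q T) \<le> ennreal (enn2real (KL \<mu> P))"
  proof (rule KL_leI)
    show "prob_space (distr P Q T)" "prob_space (distr \<mu> Q T)"
      using P \<mu> by (auto intro: prob_space.prob_space_distr)
    fix \<psi> :: "_ \<Rightarrow> real" and c
    assume [measurable]: "\<psi> \<in> borel_measurable (distr P Q T)" and b: "\<And>x. \<bar>\<psi> x\<bar> \<le> c"
    then have [measurable]: "\<psi> \<in> borel_measurable Q" by simp
    have "(\<integral>x. \<psi> (T x) \<partial>\<mu>) \<le> enn2real (KL \<mu> P) + ln (\<integral>x. exp (\<psi> (T x)) \<partial>P)"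
      using b by (intro Donsker_Varadhan[OF P \<mu> s fin]) auto
    then show "(\<integral>x. \<psi> x \<partial>distr \<mu> Q T) \<le> enn2real (KL \<mu> P) + ln (\<integral>x. exp (\<psi> x) \<partial>distr P Q T)"
      by (simp add: integral_distr)
  qed simp_all
  then show ?thesis using fin by simp
qed simp

text \<open>Writing the entropy of a marginal as an integral over the common space \<open>P\<close>
  makes several marginals comparable. The positivity statement will allow the logarithm of a
  quotient of marginal densities to be split.\<close>

lemma
  fixes F :: "'a \<Rightarrow> real" and k :: "'b \<Rightarrow> real"
  assumes Q: "prob_space Q" and D: "prob_space (density P (\<lambda>x. ennreal (F x)))"
    and F [measurable]: "F \<in> borel_measurable P" "\<And>x. 0 \<le> F x"
    and \<alpha> [measurable]: "\<alpha> \<in> P \<rightarrow>\<^sub>M Q"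
    and k [measurable]: "k \<in> borel_measurable Q" "\<And>x. 0 \<le> k x"
    and d: "distr (density P (\<lambda>x. ennreal (F x))) Q \<alpha> = density Q (\<lambda>x. ennreal (k x))"
    and fin: "(\<integral>\<^sup>+x. ennreal (ent_fun (k x)) \<partial>Q) < \<infinity>"
  shows integrable_ln_marginal: "integrable P (\<lambda>x. F x * ln (k (\<alpha> x)))"
    and integral_ln_marginal:
      "(\<integral>x. F x * ln (k (\<alpha> x)) \<partial>P) = enn2real (\<integral>\<^sup>+x. ennreal (ent_fun (k x)) \<partial>Q)"
    and AE_marginal_pos: "AE x in P. F x \<noteq> 0 \<longrightarrow> k (\<alpha> x) > 0"
proof -
  interpret Q: prob_space Q by fact
  let ?D = "density P (\<lambda>x. ennreal (F x))" and ?K = "density Q (\<lambda>x. ennreal (k x))"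
  have \<alpha>D [measurable]: "\<alpha> \<in> ?D \<rightarrow>\<^sub>M Q" by simp
  have K: "prob_space ?K"
    using prob_space.prob_space_distr[OF D \<alpha>D] d by simp
  have ik: "integrable Q k" and ik1: "(\<integral>x. k x \<partial>Q) = 1"
    using K k by (auto intro: integrable_prob_density integral_prob_density)
  have ie: "integrable Q (\<lambda>x. ent_fun (k x))"
    using fin k(2) by (intro integrableI_nonneg) (auto simp: ent_fun_nonneg)
  then have il: "integrable Q (\<lambda>x. k x * ln (k x))"
    using integrable_ent_fun_iff[OF Q ik] by simp
  have "integrable ?K (\<lambda>x. ln (k x))"
    using il k by (subst integrable_density) auto
  then have "integrable (distr ?D Q \<alpha>) (\<lambda>x. ln (k x))"
    by (simp add: d)
  then have "integrable ?D (\<lambda>x. ln (k (\<alpha> x)))"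
    by (subst (asm) integrable_distr_eq) auto
  then show "integrable P (\<lambda>x. F x * ln (k (\<alpha> x)))"
    using F by (subst (asm) integrable_density) auto
  have "(\<integral>x. F x * ln (k (\<alpha> x)) \<partial>P) = (\<integral>x. ln (k (\<alpha> x)) \<partial>?D)"
    using F by (subst integral_density) auto
  also have "\<dots> = (\<integral>x. ln (k x) \<partial>distr ?D Q \<alpha>)"
    by (subst integral_distr) auto
  also have "\<dots> = (\<integral>x. k x * ln (k x) \<partial>Q)"
    unfolding d using k by (subst integral_density) auto
  also have "\<dots> = (\<integral>x. ent_fun (k x) \<partial>Q)"
    unfolding ent_fun_def using il ik ik1 by (simp add: Q.prob_space)
  also have "\<dots> = enn2real (\<integral>\<^sup>+x. ennreal (ent_fun (k x)) \<partial>Q)"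
    using ie k(2) by (subst nn_integral_eq_integral) (auto simp: ent_fun_nonneg)
  finally show "(\<integral>x. F x * ln (k (\<alpha> x)) \<partial>P) = enn2real (\<integral>\<^sup>+x. ennreal (ent_fun (k x)) \<partial>Q)" .
  have "AE x in ?K. k x > 0"
    by (subst AE_density) auto
  then have "AE x in ?D. k (\<alpha> x) > 0"
    unfolding d[symmetric] by (subst (asm) AE_distr_iff) auto
  then show "AE x in P. F x \<noteq> 0 \<longrightarrow> k (\<alpha> x) > 0"
    by (subst (asm) AE_density) (use F(2) in \<open>auto simp: order_less_le elim!: eventually_mono\<close>)
qed

text \<open>Submodularity of the relative entropy for two variables \<open>\<alpha>\<close>, \<open>\<beta>\<close> which are conditionally
  independent given \<open>\<gamma>\<close> under the reference measure; the last assumption says that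
  \<open>k(\<alpha>) k(\<beta>) / h(\<gamma>)\<close> is a subprobability density.\<close>

lemma entropy_submodular:
  fixes F :: "'a \<Rightarrow> real" and k :: "'b \<Rightarrow> real" and h :: "'c \<Rightarrow> real"
  assumes P: "prob_space P" and D: "prob_space (density P (\<lambda>x. ennreal (F x)))"
    and F [measurable]: "F \<in> borel_measurable P" "\<And>x. 0 \<le> F x"
    and \<alpha> [measurable]: "\<alpha> \<in> P \<rightarrow>\<^sub>M Q" and \<beta> [measurable]: "\<beta> \<in> P \<rightarrow>\<^sub>M Q" and \<gamma> [measurable]: "\<gamma> \<in> P \<rightarrow>\<^sub>M R"
    and k [measurable]: "k \<in> borel_measurable Q" "\<And>x. 0 \<le> k x"
    and h [measurable]: "h \<in> borel_measurable R" "\<And>x. 0 \<le> h x"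
    and P\<alpha>: "distr P Q \<alpha> = Q" and P\<gamma>: "distr P R \<gamma> = R"
    and d\<alpha>: "distr (density P (\<lambda>x. ennreal (F x))) Q \<alpha> = density Q (\<lambda>x. ennreal (k x))"
    and d\<beta>: "distr (density P (\<lambda>x. ennreal (F x))) Q \<beta> = density Q (\<lambda>x. ennreal (k x))"
    and d\<gamma>: "distr (density P (\<lambda>x. ennreal (F x))) R \<gamma> = density R (\<lambda>x. ennreal (h x))"
    and subp: "(\<integral>\<^sup>+x. ennreal (k (\<alpha> x) * k (\<beta> x) / h (\<gamma> x)) \<partial>P) \<le> 1"
  shows "2 * (\<integral>\<^sup>+x. ennreal (ent_fun (k x)) \<partial>Q) \<le>
    (\<integral>\<^sup>+x. ennreal (ent_fun (F x)) \<partial>P) + (\<integral>\<^sup>+x. ennreal (ent_fun (h x)) \<partial>R)"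
    (is "2 * ?k \<le> ?F + ?h")
proof (cases "?F = \<infinity>")
  case False
  then have Ffin: "?F < \<infinity>" by (simp add: less_top)
  let ?D = "density P (\<lambda>x. ennreal (F x))"
  have Q: "prob_space Q" using prob_space.prob_space_distr[OF P \<alpha>] P\<alpha> by simp
  have R: "prob_space R" using prob_space.prob_space_distr[OF P \<gamma>] P\<gamma> by simp
  have DQ: "prob_space (density Q (\<lambda>x. ennreal (k x)))"
    using prob_space.prob_space_distr[OF D, of \<alpha> Q] d\<alpha> by simp
  have DR: "prob_space (density R (\<lambda>x. ennreal (h x)))"
    using prob_space.prob_space_distr[OF D, of \<gamma> R] d\<gamma> by simp
  \<comment> \<open>Data processing makes the marginal entropies finite, which excludes a difference
    of infinities below.\<close>
  have "?k \<le> ?F"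
    using KL_distr_le[OF P D _ \<alpha>] KL_density_eq[OF P F D] KL_density_eq[OF Q k DQ]
    by (simp add: P\<alpha> d\<alpha>)
  with Ffin have kfin: "?k < \<infinity>" by (rule le_less_trans[rotated])
  have "?h \<le> ?F"
    using KL_distr_le[OF P D _ \<gamma>] KL_density_eq[OF P F D] KL_density_eq[OF R h DR]
    by (simp add: P\<gamma> d\<gamma>)
  with Ffin have hfin: "?h < \<infinity>" by (rule le_less_trans[rotated])
  note m\<alpha> = integrable_ln_marginal[OF Q D F \<alpha> k d\<alpha> kfin] integral_ln_marginal[OF Q D F \<alpha> k d\<alpha> kfin]
    AE_marginal_pos[OF Q D F \<alpha> k d\<alpha> kfin]
  note m\<beta> = integrable_ln_marginal[OF Q D F \<beta> k d\<beta> kfin] integral_ln_marginal[OF Q D F \<beta> k d\<beta> kfin]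
    AE_marginal_pos[OF Q D F \<beta> k d\<beta> kfin]
  note m\<gamma> = integrable_ln_marginal[OF R D F \<gamma> h d\<gamma> hfin] integral_ln_marginal[OF R D F \<gamma> h d\<gamma> hfin]
    AE_marginal_pos[OF R D F \<gamma> h d\<gamma> hfin]
  \<comment> \<open>Where \<open>F\<close> is nonzero, all three marginal densities are positive
    almost everywhere and the logarithm splits; elsewhere both sides carry the factor 0.\<close>
  have eq: "AE x in P. F x * ln (k (\<alpha> x) * k (\<beta> x) / h (\<gamma> x)) =
      F x * ln (k (\<alpha> x)) + F x * ln (k (\<beta> x)) - F x * ln (h (\<gamma> x))"
    using m\<alpha>(3) m\<beta>(3) m\<gamma>(3)
  proof eventually_elim
    case (elim x)
    then show ?case by (cases "F x = 0") (auto simp: ln_mult ln_div algebra_simps)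
  qed
  have ii: "integrable P (\<lambda>x. F x * ln (k (\<alpha> x)) + F x * ln (k (\<beta> x)) - F x * ln (h (\<gamma> x)))"
    using m\<alpha>(1) m\<beta>(1) m\<gamma>(1) by auto
  then have i: "integrable P (\<lambda>x. F x * ln (k (\<alpha> x) * k (\<beta> x) / h (\<gamma> x)))"
    using eq by (subst integrable_cong_AE[OF _ _ eq]) auto
  have "enn2real ?k + enn2real ?k - enn2real ?h =
      (\<integral>x. F x * ln (k (\<alpha> x)) + F x * ln (k (\<beta> x)) - F x * ln (h (\<gamma> x)) \<partial>P)"
    using m\<alpha> m\<beta> m\<gamma> by simp
  also have "\<dots> = (\<integral>x. F x * ln (k (\<alpha> x) * k (\<beta> x) / h (\<gamma> x)) \<partial>P)"
    using eq by (intro integral_cong_AE) auto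
  also have "\<dots> \<le> enn2real ?F"
  proof (rule Gibbs_integral_le[OF P F D Ffin _ _ subp _ i])
    show "AE x in P. F x \<noteq> 0 \<longrightarrow> 0 < k (\<alpha> x) * k (\<beta> x) / h (\<gamma> x)"
      using m\<alpha>(3) m\<beta>(3) m\<gamma>(3) by eventually_elim simp
  qed (use k h in auto)
  finally have r: "2 * enn2real ?k \<le> enn2real ?F + enn2real ?h" by simp
  have "2 * ?k = ennreal (2 * enn2real ?k)"
    using kfin by (simp add: ennreal_mult less_top)
  also have "\<dots> \<le> ennreal (enn2real ?F + enn2real ?h)"
    using r by (rule ennreal_leI)
  also have "\<dots> = ?F + ?h"
    using Ffin hfin by (simp add: ennreal_plus less_top)
  finally show ?thesis .
qed simp

text \<open>\<open>u\<close> is the squared correlation of old and new state,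
  \<open>exp (- 2 t)\<close> at time \<open>t\<close> of the usual semigroup. In this parameter
  evolutions compose by multiplication and the entropy is midpoint convex.\<close>

definition OU :: "real \<Rightarrow> real \<Rightarrow> ('a::euclidean_space \<Rightarrow> real) \<Rightarrow> 'a \<Rightarrow> real" where
  "OU s u f x = (\<integral>z. f (sqrt u *\<^sub>R x + sqrt (1 - u) *\<^sub>R z) \<partial>gauss s)"

text \<open>The \<open>ennreal\<close>-valued twin of \<^const>\<open>OU\<close>. On the null set where it is infinite, \<^const>\<open>OU\<close> is 0.\<close>

definition OUn :: "real \<Rightarrow> real \<Rightarrow> ('a::euclidean_space \<Rightarrow> real) \<Rightarrow> 'a \<Rightarrow> ennreal" where
  "OUn s u f x = (\<integral>\<^sup>+z. ennreal (f (sqrt u *\<^sub>R x + sqrt (1 - u) *\<^sub>R z)) \<partial>gauss s)"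

abbreviation gauss_ent :: "real \<Rightarrow> ('a::euclidean_space \<Rightarrow> real) \<Rightarrow> ennreal" where
  "gauss_ent s f \<equiv> (\<integral>\<^sup>+x. ennreal (ent_fun (f x)) \<partial>gauss s)"

section \<open>Densities evolving under the Ornstein--Uhlenbeck kernel\<close>

context
  fixes s :: real assumes s: "s > 0"
begin

interpretation G: prob_space "iso_gaussian (0::'a::euclidean_space) s"
  by (rule prob_space_iso_gaussian[OF s])

interpretation GG: pair_prob_space "iso_gaussian (0::'a::euclidean_space) s" "iso_gaussian (0::'a) s" ..

lemma OU_measurable [measurable]:
  assumes [measurable]: "f \<in> borel_measurable borel"
  shows "OU s u f \<in> borel_measurable (borel :: 'a::euclidean_space measure)"
proof -
  have [measurable]: "(\<lambda>p. f (sqrt u *\<^sub>R fst p + sqrt (1 - u) *\<^sub>R snd p))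
      \<in> borel_measurable (borel \<Otimes>\<^sub>M iso_gaussian (0::'a) s)" by measurable
  show ?thesis unfolding OU_def[abs_def] by measurable
qed

lemma OUn_measurable [measurable]:
  assumes [measurable]: "f \<in> borel_measurable borel"
  shows "OUn s u f \<in> borel_measurable (borel :: 'a::euclidean_space measure)"
  unfolding OUn_def[abs_def] by measurable

lemma OU_nonneg: "(\<And>x. 0 \<le> f x) \<Longrightarrow> 0 \<le> OU s u f x"
  unfolding OU_def by simp

lemma OU_le_OUn:
  assumes "\<And>x. 0 \<le> f x"
  shows "ennreal (OU s u f x) \<le> OUn s u f x"
proof (cases "integrable (gauss s) (\<lambda>z. f (sqrt u *\<^sub>R x + sqrt (1 - u) *\<^sub>R z))")
  case True
  then show ?thesis unfolding OU_def OUn_def using assms by (subst nn_integral_eq_integral) auto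
next
  case False
  then show ?thesis unfolding OU_def by (simp add: not_integrable_integral_eq)
qed

lemma OUn_eq_OU:
  assumes [measurable]: "f \<in> borel_measurable borel" and "\<And>x. 0 \<le> f x" and "OUn s u f x < \<infinity>"
  shows "OUn s u f x = ennreal (OU s u f x)"
proof -
  have "integrable (gauss s) (\<lambda>z. f (sqrt u *\<^sub>R x + sqrt (1 - u) *\<^sub>R z))"
    using assms unfolding OUn_def by (intro integrableI_nonneg) auto
  then show ?thesis
    unfolding OU_def OUn_def using assms by (intro nn_integral_eq_integral) auto
qed

lemma nn_integral_gauss_add:
  fixes \<psi> :: "'a::euclidean_space \<Rightarrow> ennreal"
  assumes "p\<^sup>2 + q\<^sup>2 = r\<^sup>2" "0 \<le> p" "0 \<le> q" "0 \<le> r"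
    and [measurable]: "\<psi> \<in> borel_measurable borel"
  shows "(\<integral>\<^sup>+x. \<integral>\<^sup>+z. \<psi> (p *\<^sub>R x + q *\<^sub>R z) \<partial>gauss s \<partial>gauss s) =
    (\<integral>\<^sup>+x. \<psi> (r *\<^sub>R x) \<partial>gauss s)"
proof -
  have "(\<integral>\<^sup>+x. \<integral>\<^sup>+z. \<psi> (p *\<^sub>R x + q *\<^sub>R z) \<partial>gauss s \<partial>gauss s) =
      (\<integral>\<^sup>+y. \<psi> (p *\<^sub>R fst y + q *\<^sub>R snd y) \<partial>(gauss s \<Otimes>\<^sub>M gauss s))"
    by (subst G.nn_integral_fst[symmetric]) auto
  also have "\<dots> = (\<integral>\<^sup>+x. \<psi> x \<partial>distr (gauss s \<Otimes>\<^sub>M gauss s) borel (\<lambda>(x, z). p *\<^sub>R x + q *\<^sub>R z))"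
    by (subst nn_integral_distr) (auto simp: case_prod_beta')
  also have "\<dots> = (\<integral>\<^sup>+x. \<psi> (r *\<^sub>R x) \<partial>gauss s)"
    by (subst iso_gaussian_add[OF s assms(1-4)], subst nn_integral_distr) auto
  finally show ?thesis .
qed

lemma nn_integral_OUn:
  assumes [measurable]: "f \<in> borel_measurable borel" and u: "0 \<le> u" "u \<le> 1"
  shows "(\<integral>\<^sup>+x. OUn s u f x \<partial>gauss s) = (\<integral>\<^sup>+x. ennreal (f (x::'a::euclidean_space)) \<partial>gauss s)"
  unfolding OUn_def
  using nn_integral_gauss_add[of "sqrt u" "sqrt (1 - u)" 1 "\<lambda>x. ennreal (f x)"] u by simp

lemma AE_OUn:
  assumes [measurable]: "f \<in> borel_measurable borel" and "\<And>x. 0 \<le> f x" and u: "0 \<le> u" "u \<le> 1"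
    and f1: "(\<integral>\<^sup>+x. ennreal (f (x::'a::euclidean_space)) \<partial>gauss s) = 1"
  shows "AE x in gauss s. OUn s u f x = ennreal (OU s u f x)"
proof -
  have "AE x in gauss s. OUn s u f x \<noteq> \<infinity>"
    using nn_integral_OUn[OF assms(1) u] f1 by (intro nn_integral_PInf_AE) auto
  then show ?thesis
    by eventually_elim (use OUn_eq_OU[OF assms(1,2)] in \<open>simp add: less_top\<close>)
qed

lemma nn_integral_OU:
  assumes [measurable]: "f \<in> borel_measurable borel" and "\<And>x. 0 \<le> f x" and u: "0 \<le> u" "u \<le> 1"
    and f1: "(\<integral>\<^sup>+x. ennreal (f (x::'a::euclidean_space)) \<partial>gauss s) = 1"
  shows "(\<integral>\<^sup>+x. ennreal (OU s u f x) \<partial>gauss s) = 1"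
proof -
  have "(\<integral>\<^sup>+x. ennreal (OU s u f x) \<partial>gauss s) = (\<integral>\<^sup>+x. OUn s u f x \<partial>gauss s)"
    using AE_OUn[OF assms] by (intro nn_integral_cong_AE) (auto elim: eventually_mono)
  then show ?thesis by (simp add: nn_integral_OUn[OF assms(1) u] f1)
qed

text \<open>Composition multiplies squared correlations, but only almost everywhere, since
  \<open>OU\<close> is 0 where its integral diverges. The map \<open>?T\<close> carries the product
  law to the Gaussian, so almost every \<open>x\<close> and \<open>z\<close> avoid the exceptional
  null set.\<close>

lemma OU_semigroup_AE:
  assumes f [measurable]: "f \<in> borel_measurable borel" and nn: "\<And>x. 0 \<le> f x" and u: "0 \<le> u" "u \<le> 1 / 2"
    and f1: "(\<integral>\<^sup>+x. ennreal (f (x::'a::euclidean_space)) \<partial>gauss s) = 1"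
  shows "AE x in gauss s. OU s (1/2) (OU s (2 * u) f) x = OU s u f x"
proof -
  let ?P = "gauss s :: 'a measure"
  let ?T = "\<lambda>p. sqrt (1/2) *\<^sub>R fst p + sqrt (1/2) *\<^sub>R snd p :: 'a"
  define w where "w = OU s (2 * u) f"
  have w [measurable]: "w \<in> borel_measurable borel" and w0: "\<And>x. 0 \<le> w x"
    and w1: "(\<integral>\<^sup>+x. ennreal (w x) \<partial>?P) = 1"
    unfolding w_def using OU_nonneg[of f, OF nn] nn_integral_OU[of f "2 * u", OF f nn] u f1 by auto
  have "distr (?P \<Otimes>\<^sub>M ?P) borel (\<lambda>(x, z). sqrt (1/2) *\<^sub>R x + sqrt (1/2) *\<^sub>R z) = distr ?P borel (\<lambda>x. 1 *\<^sub>R x)"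
    by (rule iso_gaussian_add[OF s]) (auto simp: power_divide)
  also have "\<dots> = ?P" by (simp add: distr_id2)
  finally have dT: "distr (?P \<Otimes>\<^sub>M ?P) borel ?T = ?P" by (simp add: case_prod_beta')
  have "AE y in distr (?P \<Otimes>\<^sub>M ?P) borel ?T. OUn s (2 * u) f y = ennreal (w y)"
    unfolding dT w_def using AE_OUn[of f "2 * u"] nn u f1 by simp
  then have "AE p in ?P \<Otimes>\<^sub>M ?P. OUn s (2 * u) f (?T p) = ennreal (w (?T p))"
    by (subst (asm) AE_distr_iff) auto
  then have "AE x in ?P. AE z in ?P. OUn s (2 * u) f (?T (x, z)) = ennreal (w (?T (x, z)))"
    by (rule GG.AE_pair)
  moreover have "AE x in ?P. OUn s (1/2) w x = ennreal (OU s (1/2) w x)"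
    using w0 w1 by (intro AE_OUn) auto
  moreover have "AE x in ?P. OUn s u f x = ennreal (OU s u f x)"
    using nn u f1 by (intro AE_OUn) auto
  ultimately show ?thesis
  proof eventually_elim
    case (elim x)
    have "OUn s (1/2) w x = (\<integral>\<^sup>+z. ennreal (w (?T (x, z))) \<partial>?P)"
      by (simp add: OUn_def)
    also have "\<dots> = (\<integral>\<^sup>+z. OUn s (2 * u) f (?T (x, z)) \<partial>?P)"
      using elim(1) by (intro nn_integral_cong_AE) (auto elim!: eventually_mono)
    also have "\<dots> = (\<integral>\<^sup>+z. \<integral>\<^sup>+y. ennreal (f (sqrt u *\<^sub>R x + (sqrt u *\<^sub>R z + sqrt (1 - 2 * u) *\<^sub>R y))) \<partial>?P \<partial>?P)"
    proof -
      have e: "sqrt (2 * u) * sqrt (1 / 2) = sqrt u"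
        by (simp add: real_sqrt_mult[symmetric])
      have "sqrt (2 * u) *\<^sub>R ?T (x, z) = sqrt u *\<^sub>R x + sqrt u *\<^sub>R z" for z
        by (simp only: fst_conv snd_conv scaleR_add_right scaleR_scaleR e)
      then show ?thesis
        unfolding OUn_def by (simp only: add.assoc)
    qed
    also have "\<dots> = (\<integral>\<^sup>+z. ennreal (f (sqrt u *\<^sub>R x + sqrt (1 - u) *\<^sub>R z)) \<partial>?P)"
      using u by (intro nn_integral_gauss_add[where \<psi> = "\<lambda>y. ennreal (f (sqrt u *\<^sub>R x + y))"]) auto
    also have "\<dots> = OUn s u f x" by (simp add: OUn_def)
    finally have "ennreal (OU s (1/2) w x) = ennreal (OU s u f x)"
      using elim by simp
    then show ?case
      using OU_nonneg[of w "1/2" x, OF w0] OU_nonneg[of f u x, OF nn] by (simp add: w_def)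
  qed
qed

text \<open>The density \<open>F\<close> gives the full sum of \<open>a\<close>, \<open>b\<close>,
  \<open>c\<close> the density \<open>f\<close>. The normalised sum \<alpha> of \<open>a\<close> and
  \<open>c\<close> then has density \<open>OU s u f\<close>, because the full sum is
  \<open>sqrt u\<close> times \<alpha> plus independent noise of weight \<open>sqrt (1 - u)\<close>;
  \<beta> is its mirror image with \<open>b\<close>, and \<open>c\<close> itself has density
  \<open>OU s r f\<close>. Given \<open>c\<close>, \<alpha> and \<beta> are independent under the
  reference law, as submodularity requires.\<close>

lemma OU_entropy_midpoint:
  assumes f [measurable]: "f \<in> borel_measurable borel" and nn: "\<And>x. 0 \<le> f x" and r: "0 \<le> r" "r \<le> 1"
    and f1: "(\<integral>\<^sup>+x. ennreal (f (x::'a::euclidean_space)) \<partial>gauss s) = 1"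
  shows "2 * gauss_ent s (OU s ((1 + r) / 2) f) \<le> gauss_ent s f + gauss_ent s (OU s r f)"
proof -
  let ?\<pi> = "gauss s :: 'a measure"
  let ?P = "?\<pi> \<Otimes>\<^sub>M (?\<pi> \<Otimes>\<^sub>M ?\<pi>)"
  interpret P3: pair_prob_space ?\<pi> "?\<pi> \<Otimes>\<^sub>M ?\<pi>" ..
  define u where "u = (1 + r) / 2"
  \<comment> \<open>The conditions \<open>p + r = u\<close> and \<open>2 * p + r = 1\<close>
    determine \<open>p\<close> and force \<open>u\<close> to be the midpoint of \<open>r\<close> and
    1.\<close>
  define p where "p = (1 - r) / 2"
  have pu: "0 \<le> p" "0 < u" "u \<le> 1" "p + r = u" "1 - u = p" "2 * p + r = 1"
    using r by (auto simp: u_def p_def field_simps)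
  let ?S = "\<lambda>a b c. sqrt p *\<^sub>R a + sqrt p *\<^sub>R b + sqrt r *\<^sub>R c :: 'a"
  let ?V = "\<lambda>a c. (sqrt p / sqrt u) *\<^sub>R a + (sqrt r / sqrt u) *\<^sub>R c :: 'a"
  define F where "F = (\<lambda>(c, a, b). f (sqrt p *\<^sub>R a + sqrt p *\<^sub>R b + sqrt r *\<^sub>R (c::'a)))"
  define \<alpha> where "\<alpha> = (\<lambda>(c, a, b::'a). (sqrt p / sqrt u) *\<^sub>R a + (sqrt r / sqrt u) *\<^sub>R (c::'a))"
  define \<beta> where "\<beta> = (\<lambda>(c, a::'a, b). (sqrt p / sqrt u) *\<^sub>R b + (sqrt r / sqrt u) *\<^sub>R (c::'a))"
  define w where "w = OU s u f"
  define h where "h = OU s r f"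
  have [measurable]: "F \<in> borel_measurable ?P" unfolding F_def by measurable
  have [measurable]: "F \<in> borel_measurable (borel \<Otimes>\<^sub>M borel \<Otimes>\<^sub>M borel)"
      "\<alpha> \<in> borel_measurable (borel \<Otimes>\<^sub>M borel \<Otimes>\<^sub>M borel)"
      "\<beta> \<in> borel_measurable (borel \<Otimes>\<^sub>M borel \<Otimes>\<^sub>M borel)"
    unfolding F_def \<alpha>_def \<beta>_def by measurable
  have \<alpha>m [measurable]: "\<alpha> \<in> ?P \<rightarrow>\<^sub>M ?\<pi>" unfolding \<alpha>_def by measurable
  have \<beta>m [measurable]: "\<beta> \<in> ?P \<rightarrow>\<^sub>M ?\<pi>" unfolding \<beta>_def by measurable
  have [measurable]: "w \<in> borel_measurable borel" "h \<in> borel_measurable borel"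
    unfolding w_def h_def by auto
  have F0: "0 \<le> F x" for x unfolding F_def using nn by (auto split: prod.split)
  have w0: "0 \<le> w x" and h0: "0 \<le> h x" for x
    unfolding w_def h_def using OU_nonneg[of f, OF nn] by auto
  have AEw: "AE x in ?\<pi>. OUn s u f x = ennreal (w x)"
    unfolding w_def using nn f1 pu by (intro AE_OUn) auto
  have AEh: "AE x in ?\<pi>. OUn s r f x = ennreal (h x)"
    unfolding h_def using nn f1 r by (intro AE_OUn) auto
  have nn3: "(\<integral>\<^sup>+x. H x \<partial>?P) = (\<integral>\<^sup>+c. \<integral>\<^sup>+a. \<integral>\<^sup>+b. H (c, a, b) \<partial>?\<pi> \<partial>?\<pi> \<partial>?\<pi>)"
    if [measurable]: "H \<in> borel_measurable ?P" for H
  proof -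
    have "(\<integral>\<^sup>+x. H x \<partial>?P) = (\<integral>\<^sup>+c. \<integral>\<^sup>+y. H (c, y) \<partial>(?\<pi> \<Otimes>\<^sub>M ?\<pi>) \<partial>?\<pi>)"
      by (subst GG.P.nn_integral_fst) auto
    also have "\<dots> = (\<integral>\<^sup>+c. \<integral>\<^sup>+a. \<integral>\<^sup>+b. H (c, a, b) \<partial>?\<pi> \<partial>?\<pi> \<partial>?\<pi>)"
      by (intro nn_integral_cong, subst G.nn_integral_fst[symmetric]) auto
    finally show ?thesis .
  qed
  have su: "(sqrt p / sqrt u)\<^sup>2 + (sqrt r / sqrt u)\<^sup>2 = 1"
    using pu r by (simp add: power_divide add_divide_distrib[symmetric])
  have ac: "(\<integral>\<^sup>+c. \<integral>\<^sup>+a. \<psi> (?V a c) \<partial>?\<pi> \<partial>?\<pi>) = (\<integral>\<^sup>+x. \<psi> x \<partial>?\<pi>)"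
    if [measurable]: "\<psi> \<in> borel_measurable borel" for \<psi>
    using nn_integral_gauss_add[of "sqrt r / sqrt u" "sqrt p / sqrt u" 1 \<psi>] su pu r
    by (simp add: add.commute)
  \<comment> \<open>Given \<open>c\<close>, the variables \<open>a\<close> and \<open>b\<close>
    merge into one Gaussian of weight \<open>sqrt (1 - r)\<close>.\<close>
  have ab: "(\<integral>\<^sup>+a. \<integral>\<^sup>+b. ennreal (f (?S a b c)) \<partial>?\<pi> \<partial>?\<pi>) = OUn s r f c" for c
    using nn_integral_gauss_add[of "sqrt p" "sqrt p" "sqrt (1 - r)" "\<lambda>y. ennreal (f (y + sqrt r *\<^sub>R c))"] pu r
    by (simp add: OUn_def add.commute)
  have Fu: "?S a b c =
      sqrt u *\<^sub>R (?V a c) + sqrt (1 - u) *\<^sub>R b" for a b c :: 'a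
    using pu by (simp add: scaleR_add_right)
  have swap: "(\<integral>\<^sup>+a. \<integral>\<^sup>+b. H a b \<partial>?\<pi> \<partial>?\<pi>) = (\<integral>\<^sup>+a. \<integral>\<^sup>+b. H b a \<partial>?\<pi> \<partial>?\<pi>)"
    if "(\<lambda>p. H (fst p) (snd p)) \<in> borel_measurable (?\<pi> \<Otimes>\<^sub>M ?\<pi>)" for H :: "'a \<Rightarrow> 'a \<Rightarrow> ennreal"
    using that by (intro GG.Fubini'[symmetric]) (simp add: case_prod_beta')
  have EF: "(\<integral>\<^sup>+x. \<phi> (F x) \<partial>?P) = (\<integral>\<^sup>+x. \<phi> (f x) \<partial>?\<pi>)" if [measurable]: "\<phi> \<in> borel_measurable borel" for \<phi>
  proof -
    have "(\<integral>\<^sup>+x. \<phi> (F x) \<partial>?P) = (\<integral>\<^sup>+c. \<integral>\<^sup>+a. \<integral>\<^sup>+b. \<phi> (f (?S a b c)) \<partial>?\<pi> \<partial>?\<pi> \<partial>?\<pi>)"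
      by (subst nn3) (auto simp: F_def)
    also have "\<dots> = (\<integral>\<^sup>+c. \<integral>\<^sup>+z. \<phi> (f (sqrt (1 - r) *\<^sub>R z + sqrt r *\<^sub>R c)) \<partial>?\<pi> \<partial>?\<pi>)"
      using nn_integral_gauss_add[of "sqrt p" "sqrt p" "sqrt (1 - r)" "\<lambda>y. \<phi> (f (y + sqrt r *\<^sub>R c))" for c] pu r
      by simp
    also have "\<dots> = (\<integral>\<^sup>+x. \<phi> (f x) \<partial>?\<pi>)"
      using nn_integral_gauss_add[of "sqrt r" "sqrt (1 - r)" 1 "\<lambda>x. \<phi> (f x)"] r by (simp add: add.commute)
    finally show ?thesis .
  qed
  have D: "prob_space (density ?P (\<lambda>x. ennreal (F x)))"
  proof (intro prob_spaceI)
    have "emeasure (density ?P (\<lambda>x. ennreal (F x))) (space ?P) =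
        (\<integral>\<^sup>+x. ennreal (F x) * indicator (space ?P) x \<partial>?P)"
      by (rule emeasure_density[OF _ sets.top]) simp
    also have "\<dots> = (\<integral>\<^sup>+x. ennreal (F x) \<partial>?P)"
      by (intro nn_integral_cong) simp
    finally show "emeasure (density ?P (\<lambda>x. ennreal (F x))) (space (density ?P (\<lambda>x. ennreal (F x)))) = 1"
      using EF[of ennreal] f1 by simp
  qed
  have dist: "distr (density ?P (\<lambda>x. ennreal (F x))) ?\<pi> \<kappa> = density ?\<pi> (\<lambda>x. ennreal (k x))"
    if [measurable]: "\<kappa> \<in> ?P \<rightarrow>\<^sub>M ?\<pi>" "k \<in> borel_measurable borel"
      and e: "\<And>A. A \<in> sets borel \<Longrightarrow> (\<integral>\<^sup>+x. ennreal (F x) * indicator A (\<kappa> x) \<partial>?P) =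
        (\<integral>\<^sup>+x. ennreal (k x) * indicator A x \<partial>?\<pi>)" for \<kappa> k
  proof (rule measure_eqI)
    fix A assume "A \<in> sets (distr (density ?P (\<lambda>x. ennreal (F x))) ?\<pi> \<kappa>)"
    then have A [measurable]: "A \<in> sets borel" by simp
    have \<kappa>A: "\<kappa> -` A \<inter> space ?P \<in> sets ?P"
      by (rule measurable_sets[OF that(1)]) simp
    have "emeasure (distr (density ?P (\<lambda>x. ennreal (F x))) ?\<pi> \<kappa>) A =
        emeasure (density ?P (\<lambda>x. ennreal (F x))) (\<kappa> -` A \<inter> space ?P)"
      by (subst emeasure_distr) auto
    also have "\<dots> = (\<integral>\<^sup>+x. ennreal (F x) * indicator (\<kappa> -` A \<inter> space ?P) x \<partial>?P)"
      by (rule emeasure_density[OF _ \<kappa>A]) simp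
    also have "\<dots> = (\<integral>\<^sup>+x. ennreal (F x) * indicator A (\<kappa> x) \<partial>?P)"
      by (intro nn_integral_cong) (auto simp: indicator_def)
    finally show "emeasure (distr (density ?P (\<lambda>x. ennreal (F x))) ?\<pi> \<kappa>) A =
        emeasure (density ?\<pi> (\<lambda>x. ennreal (k x))) A"
      by (simp add: e[OF A] emeasure_density)
  qed simp
  have E\<alpha>: "(\<integral>\<^sup>+c. \<integral>\<^sup>+a. \<integral>\<^sup>+b. ennreal (f (?S a b c)) *
      indicator A (?V a c) \<partial>?\<pi> \<partial>?\<pi> \<partial>?\<pi>) =
      (\<integral>\<^sup>+x. ennreal (w x) * indicator A x \<partial>?\<pi>)" if [measurable]: "A \<in> sets borel" for A
  proof -
    have "(\<integral>\<^sup>+c. \<integral>\<^sup>+a. \<integral>\<^sup>+b. ennreal (f (?S a b c)) *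
        indicator A (?V a c) \<partial>?\<pi> \<partial>?\<pi> \<partial>?\<pi>) =
        (\<integral>\<^sup>+c. \<integral>\<^sup>+a. OUn s u f (?V a c) *
          indicator A (?V a c) \<partial>?\<pi> \<partial>?\<pi>)"
      unfolding Fu OUn_def by (intro nn_integral_cong nn_integral_multc) measurable
    also have "\<dots> = (\<integral>\<^sup>+x. OUn s u f x * indicator A x \<partial>?\<pi>)"
      by (rule ac) measurable
    also have "\<dots> = (\<integral>\<^sup>+x. ennreal (w x) * indicator A x \<partial>?\<pi>)"
      using AEw by (intro nn_integral_cong_AE) (auto elim!: eventually_mono)
    finally show ?thesis .
  qed
  have "2 * gauss_ent s w \<le> (\<integral>\<^sup>+x. ennreal (ent_fun (F x)) \<partial>?P) + gauss_ent s h"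
  proof (rule entropy_submodular[OF P3.prob_space_axioms D _ F0, where \<alpha> = \<alpha> and \<beta> = \<beta> and \<gamma> = fst])
    show "distr ?P ?\<pi> \<alpha> = ?\<pi>"
    proof (rule measure_eqI)
      fix A assume "A \<in> sets (distr ?P ?\<pi> \<alpha>)"
      then have [measurable]: "A \<in> sets borel" by simp
      have "emeasure (distr ?P ?\<pi> \<alpha>) A = (\<integral>\<^sup>+x. indicator A x \<partial>distr ?P ?\<pi> \<alpha>)" by simp
      also have "\<dots> = (\<integral>\<^sup>+x. indicator A (\<alpha> x) \<partial>?P)"
        by (rule nn_integral_distr[OF \<alpha>m]) simp
      also have "\<dots> = (\<integral>\<^sup>+c. \<integral>\<^sup>+a. \<integral>\<^sup>+b. indicator A (\<alpha> (c, a, b)) \<partial>?\<pi> \<partial>?\<pi> \<partial>?\<pi>)"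
        by (rule nn3) measurable
      also have "\<dots> = (\<integral>\<^sup>+x. indicator A x \<partial>?\<pi>)"
        using ac[of "indicator A"] by (simp add: \<alpha>_def G.emeasure_space_1[simplified])
      finally show "emeasure (distr ?P ?\<pi> \<alpha>) A = emeasure ?\<pi> A" by simp
    qed simp
    show "distr ?P ?\<pi> fst = ?\<pi>"
      by (rule GG.P.distr_pair_fst)
    show "distr (density ?P (\<lambda>x. ennreal (F x))) ?\<pi> \<alpha> = density ?\<pi> (\<lambda>x. ennreal (w x))"
    proof (rule dist)
      fix A :: "'a set" assume [measurable]: "A \<in> sets borel"
      show "(\<integral>\<^sup>+x. ennreal (F x) * indicator A (\<alpha> x) \<partial>?P) = (\<integral>\<^sup>+x. ennreal (w x) * indicator A x \<partial>?\<pi>)"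
        using E\<alpha>[of A] by (subst nn3) (auto simp: F_def \<alpha>_def)
    qed measurable
    show "distr (density ?P (\<lambda>x. ennreal (F x))) ?\<pi> \<beta> = density ?\<pi> (\<lambda>x. ennreal (w x))"
    proof (rule dist)
      fix A :: "'a set" assume [measurable]: "A \<in> sets borel"
      have "(\<integral>\<^sup>+x. ennreal (F x) * indicator A (\<beta> x) \<partial>?P) =
        (\<integral>\<^sup>+c. \<integral>\<^sup>+a. \<integral>\<^sup>+b. ennreal (f (?S a b c)) *
          indicator A (?V b c) \<partial>?\<pi> \<partial>?\<pi> \<partial>?\<pi>)"
        by (subst nn3) (auto simp: F_def \<beta>_def)
      also have "\<dots> = (\<integral>\<^sup>+c. \<integral>\<^sup>+a. \<integral>\<^sup>+b. ennreal (f (?S b a c)) *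
          indicator A (?V a c) \<partial>?\<pi> \<partial>?\<pi> \<partial>?\<pi>)"
        by (intro nn_integral_cong swap) measurable
      also have "\<dots> = (\<integral>\<^sup>+x. ennreal (w x) * indicator A x \<partial>?\<pi>)"
        using E\<alpha>[of A] by (simp add: add.commute)
      finally show "(\<integral>\<^sup>+x. ennreal (F x) * indicator A (\<beta> x) \<partial>?P) = (\<integral>\<^sup>+x. ennreal (w x) * indicator A x \<partial>?\<pi>)" .
    qed measurable
    show "distr (density ?P (\<lambda>x. ennreal (F x))) ?\<pi> fst = density ?\<pi> (\<lambda>x. ennreal (h x))"
    proof (rule dist)
      fix A :: "'a set" assume [measurable]: "A \<in> sets borel"
      have "(\<integral>\<^sup>+x. ennreal (F x) * indicator A (fst x) \<partial>?P) =
        (\<integral>\<^sup>+c. \<integral>\<^sup>+a. \<integral>\<^sup>+b. ennreal (f (?S a b c)) * indicator A c \<partial>?\<pi> \<partial>?\<pi> \<partial>?\<pi>)"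
        by (subst nn3) (auto simp: F_def)
      also have "\<dots> = (\<integral>\<^sup>+c. OUn s r f c * indicator A c \<partial>?\<pi>)"
        unfolding ab[symmetric] by (simp add: nn_integral_multc)
      also have "\<dots> = (\<integral>\<^sup>+x. ennreal (h x) * indicator A x \<partial>?\<pi>)"
        using AEh by (intro nn_integral_cong_AE) (auto elim!: eventually_mono)
      finally show "(\<integral>\<^sup>+x. ennreal (F x) * indicator A (fst x) \<partial>?P) = (\<integral>\<^sup>+x. ennreal (h x) * indicator A x \<partial>?\<pi>)" .
    qed measurable
    \<comment> \<open>Given \<open>c\<close>, the product of the two marginal densities integrates
      to \<open>V c * V c\<close>. Pointwise only an upper bound for \<open>V c\<close> holds, since
      \<open>w\<close> is 0 where its defining integral diverges; submodularity accordingly asks for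
      a subprobability density only.\<close>
    define V where "V c = (\<integral>\<^sup>+a. ennreal (w (?V a c)) \<partial>?\<pi>)" for c
    have V: "V c \<le> OUn s r f c" for c
    proof -
      have "V c \<le> (\<integral>\<^sup>+a. OUn s u f (?V a c) \<partial>?\<pi>)"
        unfolding V_def w_def using nn by (intro nn_integral_mono OU_le_OUn)
      also have "\<dots> = (\<integral>\<^sup>+a. \<integral>\<^sup>+b. ennreal (f (?S a b c)) \<partial>?\<pi> \<partial>?\<pi>)"
        unfolding Fu OUn_def ..
      finally show ?thesis unfolding ab .
    qed
    have "(\<integral>\<^sup>+x. ennreal (w (\<alpha> x) * w (\<beta> x) / h (fst x)) \<partial>?P) =
        (\<integral>\<^sup>+c. \<integral>\<^sup>+a. \<integral>\<^sup>+b. ennreal (1 / h c) * (ennreal (w (?V a c)) *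
          ennreal (w (?V b c))) \<partial>?\<pi> \<partial>?\<pi> \<partial>?\<pi>)"
      using w0 h0 by (subst nn3) (auto simp: \<alpha>_def \<beta>_def ennreal_mult[symmetric] intro!: nn_integral_cong)
    also have "\<dots> = (\<integral>\<^sup>+c. ennreal (1 / h c) * (V c * V c) \<partial>?\<pi>)"
      by (simp add: nn_integral_cmult nn_integral_multc V_def)
    also have "\<dots> \<le> (\<integral>\<^sup>+c. ennreal (1 / h c) * (OUn s r f c * OUn s r f c) \<partial>?\<pi>)"
      using V by (intro nn_integral_mono mult_mono) auto
    \<comment> \<open>Where \<open>h c = 0\<close>, the convention \<open>1 / 0 = 0\<close> makes
      the integrand 0, as needed.\<close>
    also have "\<dots> = (\<integral>\<^sup>+c. ennreal (h c) \<partial>?\<pi>)"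
      using AEh
    proof (intro nn_integral_cong_AE, eventually_elim)
      case (elim c)
      then show ?case using h0[of c] by (auto simp: ennreal_mult[symmetric])
    qed
    also have "\<dots> = 1"
      unfolding h_def using nn f1 r by (intro nn_integral_OU) auto
    finally show "(\<integral>\<^sup>+x. ennreal (w (\<alpha> x) * w (\<beta> x) / h (fst x)) \<partial>?P) \<le> 1" by simp
  qed (use w0 h0 in auto)
  then show ?thesis
    using EF[of "\<lambda>x. ennreal (ent_fun x)"] by (simp add: w_def h_def u_def)
qed

text \<open>Jensen's inequality in the inner integral, then invariance of the Gaussian law. This
  factor 1 is the starting point of the iteration that improves it to \<open>u\<close>.\<close>

lemma OU_entropy_mono:
  assumes f [measurable]: "f \<in> borel_measurable borel" and nn: "\<And>x. 0 \<le> f x" and u: "0 \<le> u" "u \<le> 1"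
    and f1: "(\<integral>\<^sup>+x. ennreal (f (x::'a::euclidean_space)) \<partial>gauss s) = 1"
  shows "gauss_ent s (OU s u f) \<le> gauss_ent s f"
proof -
  let ?\<pi> = "gauss s :: 'a measure"
  have "AE x in ?\<pi>. OUn s u f x \<noteq> \<infinity>"
    using AE_OUn[OF f nn u f1] by eventually_elim simp
  then have "gauss_ent s (OU s u f) \<le>
      (\<integral>\<^sup>+x. \<integral>\<^sup>+z. ennreal (ent_fun (f (sqrt u *\<^sub>R x + sqrt (1 - u) *\<^sub>R z))) \<partial>?\<pi> \<partial>?\<pi>)"
  proof (intro nn_integral_mono_AE, eventually_elim)
    case (elim x)
    have "integrable ?\<pi> (\<lambda>z. f (sqrt u *\<^sub>R x + sqrt (1 - u) *\<^sub>R z))"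
      using elim nn unfolding OUn_def by (intro integrableI_nonneg) (auto simp: less_top)
    then show ?case
      unfolding OU_def using nn by (intro ent_fun_Jensen[OF G.prob_space_axioms]) auto
  qed
  also have "\<dots> = gauss_ent s f"
    using nn_integral_gauss_add[of "sqrt u" "sqrt (1 - u)" 1 "\<lambda>x. ennreal (ent_fun (f x))"] u by simp
  finally show ?thesis .
qed

text \<open>Halving the defect: for \<open>u \<ge> 1/2\<close> the midpoint inequality is applied to \<open>f\<close>, for \<open>u < 1/2\<close>
  to the image of \<open>f\<close> at \<open>2 u\<close>.\<close>

lemma OU_entropy_defect:
  assumes f [measurable]: "f \<in> borel_measurable borel" and nn: "\<And>x. 0 \<le> f x" and u: "0 \<le> u" "u \<le> 1"
    and f1: "(\<integral>\<^sup>+x. ennreal (f (x::'a::euclidean_space)) \<partial>gauss s) = 1"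
  shows "gauss_ent s (OU s u f) \<le> ennreal (u + 1 / 2 ^ n) * gauss_ent s f"
  using assms
proof (induction n arbitrary: f u)
  case 0
  have "gauss_ent s (OU s u f) \<le> 1 * gauss_ent s f"
    using OU_entropy_mono[of f u] 0 by simp
  also have "\<dots> \<le> ennreal (u + 1 / 2 ^ 0) * gauss_ent s f"
    using 0 by (intro mult_right_mono) (auto simp flip: ennreal_1 intro!: ennreal_leI)
  finally show ?case .
next
  case (Suc n)
  note f [measurable] = Suc.prems(1) and nn = Suc.prems(2)
  have half: "x \<le> ennreal ((v + 1 / 2 ^ n) / 2) * y" if "2 * x \<le> ennreal (v + 1 / 2 ^ n) * y" "0 \<le> v"
    for x y :: ennreal and v
  proof -
    have "ennreal (1 / 2) * 2 = 1"
      using ennreal_mult[of "1/2" 2] by simp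
    then have "x = ennreal (1 / 2) * (2 * x)"
      by (simp add: mult.assoc[symmetric])
    also have "\<dots> \<le> ennreal (1 / 2) * (ennreal (v + 1 / 2 ^ n) * y)"
      using that by (intro mult_left_mono) auto
    also have "\<dots> = ennreal ((v + 1 / 2 ^ n) / 2) * y"
    proof -
      have "ennreal ((v + 1 / 2 ^ n) / 2) = ennreal (1 / 2) * ennreal (v + 1 / 2 ^ n)"
        using that by (subst ennreal_mult[symmetric]) (auto simp del: ennreal_half)
      then show ?thesis by (simp only: mult.assoc)
    qed
    finally show ?thesis .
  qed
  show ?case
  proof (cases "u \<ge> 1 / 2")
    case True
    \<comment> \<open>\<open>u\<close> is the midpoint of 1 and \<open>r\<close>: averaging
      reproduces \<open>u\<close> and halves the error in the induction hypothesis.\<close>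
    define r where "r = 2 * u - 1"
    have r: "0 \<le> r" "r \<le> 1" "u = (1 + r) / 2" using True Suc.prems by (auto simp: r_def)
    have "2 * gauss_ent s (OU s u f) \<le> gauss_ent s f + gauss_ent s (OU s r f)"
      unfolding r(3) by (rule OU_entropy_midpoint) (use r Suc.prems in auto)
    also have "\<dots> \<le> gauss_ent s f + ennreal (r + 1 / 2 ^ n) * gauss_ent s f"
      using r Suc.prems by (intro add_left_mono Suc.IH) auto
    also have "\<dots> = ennreal ((1 + r) + 1 / 2 ^ n) * gauss_ent s f"
      using r by (subst add.assoc, subst ennreal_plus) (auto simp: distrib_right)
    finally have "2 * gauss_ent s (OU s u f) \<le> ennreal ((1 + r) + 1 / 2 ^ n) * gauss_ent s f" .
    then have "gauss_ent s (OU s u f) \<le> ennreal (((1 + r) + 1 / 2 ^ n) / 2) * gauss_ent s f"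
      by (rule half) (use r in auto)
    also have "((1 + r) + 1 / 2 ^ n) / 2 = u + 1 / 2 ^ Suc n"
      unfolding r(3) by (simp add: field_simps)
    finally show ?thesis .
  next
    case False
    define w where "w = OU s (2 * u) f"
    have w [measurable]: "w \<in> borel_measurable borel" and w0: "\<And>x. 0 \<le> w x"
      and w1: "(\<integral>\<^sup>+x. ennreal (w x) \<partial>gauss s) = 1"
      unfolding w_def using OU_nonneg[of f, OF nn] nn_integral_OU[of f "2 * u", OF f nn] False Suc.prems by auto
    have "gauss_ent s (OU s u f) = gauss_ent s (OU s (1/2) w)"
    proof (intro nn_integral_cong_AE)
      have "AE x in gauss s. OU s (1/2) w x = OU s u f x"
        unfolding w_def using False Suc.prems by (intro OU_semigroup_AE) auto
      then show "AE x in gauss s. ennreal (ent_fun (OU s u f x)) = ennreal (ent_fun (OU s (1/2) w x))"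
        by eventually_elim simp
    qed
    \<comment> \<open>At correlation 0 the evolution returns the constant 1, the mean of
      \<open>w\<close>. The midpoint inequality with \<open>r = 0\<close> therefore gains the full
      factor 2.\<close>
    moreover have "gauss_ent s (OU s 0 w) = 0"
    proof -
      have "integral\<^sup>L (gauss s) w = 1"
        using w1 w0 by (subst integral_eq_nn_integral) auto
      then show ?thesis unfolding OU_def by simp
    qed
    ultimately have "2 * gauss_ent s (OU s u f) \<le> gauss_ent s w"
      using OU_entropy_midpoint[of w 0] w0 w1 by simp
    also have "\<dots> \<le> ennreal (2 * u + 1 / 2 ^ n) * gauss_ent s f"
      unfolding w_def using False Suc.prems by (intro Suc.IH) auto
    finally have "gauss_ent s (OU s u f) \<le> ennreal ((2 * u + 1 / 2 ^ n) / 2) * gauss_ent s f"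
      using Suc.prems by (intro half) auto
    also have "(2 * u + 1 / 2 ^ n) / 2 = u + 1 / 2 ^ Suc n"
      by (simp add: field_simps)
    finally show ?thesis .
  qed
qed

lemma OU_entropy_contraction:
  assumes f [measurable]: "f \<in> borel_measurable borel" and nn: "\<And>x. 0 \<le> f x" and u: "0 < u" "u \<le> 1"
    and f1: "(\<integral>\<^sup>+x. ennreal (f (x::'a::euclidean_space)) \<partial>gauss s) = 1"
  shows "gauss_ent s (OU s u f) \<le> ennreal u * gauss_ent s f"
proof (cases "gauss_ent s f = \<infinity>")
  case True
  then show ?thesis using u by (simp add: ennreal_mult_top)
next
  case False
  have "(\<lambda>n. (1 / 2) ^ n) \<longlonglongrightarrow> (0::real)"
    by (rule LIMSEQ_realpow_zero) auto
  then have "(\<lambda>n. ennreal (u + 1 / 2 ^ n)) \<longlonglongrightarrow> ennreal (u + 0)"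
    by (intro tendsto_ennrealI tendsto_add) (auto simp: power_one_over)
  then have "(\<lambda>n. ennreal (u + 1 / 2 ^ n) * gauss_ent s f) \<longlonglongrightarrow> ennreal (u + 0) * gauss_ent s f"
    using False u by (intro tendsto_mult_ennreal tendsto_const) auto
  then show ?thesis
    using OU_entropy_defect[of f u] assms by (intro LIMSEQ_le_const) auto
qed

text \<open>By reversibility the evolved law has density \<open>OU s u f\<close>, where
  \<open>f\<close> is the density of \<mu>, so the contraction for densities applies.\<close>

lemma KL_OU_contraction:
  fixes \<mu> :: "'a::euclidean_space measure"
  assumes \<mu>: "prob_space \<mu>" and [measurable_cong]: "sets \<mu> = sets borel" and u: "0 < u" "u \<le> 1"
  shows "KL (distr (\<mu> \<Otimes>\<^sub>M gauss s) borel (\<lambda>(x, z). sqrt u *\<^sub>R x + sqrt (1 - u) *\<^sub>R z)) (gauss s)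
    \<le> ennreal u * KL \<mu> (gauss s)"
proof (cases "KL \<mu> (gauss s) = \<infinity>")
  case True
  then show ?thesis using u by (simp add: ennreal_mult_top)
next
  case False
  let ?\<pi> = "gauss s :: 'a measure"
  let ?L = "distr (\<mu> \<Otimes>\<^sub>M ?\<pi>) borel (\<lambda>(x, z). sqrt u *\<^sub>R x + sqrt (1 - u) *\<^sub>R z)"
  interpret \<mu>: prob_space \<mu> by fact
  have sb: "sets \<mu> = sets ?\<pi>" using assms by simp
  have ac: "absolutely_continuous ?\<pi> \<mu>"
    using False by (intro KL_finite_ac) (simp add: less_top)
  define f where "f = rdens ?\<pi> \<mu>"
  have f [measurable]: "f \<in> borel_measurable borel" and nn: "\<And>x. 0 \<le> f x"
    unfolding f_def using rdens_measurable[of ?\<pi> \<mu>] by (auto simp: rdens_nonneg)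
  have d: "density ?\<pi> (\<lambda>x. ennreal (f x)) = \<mu>"
    unfolding f_def by (rule density_rdens[OF G.prob_space_axioms \<mu> sb ac])
  have f1: "(\<integral>\<^sup>+x. ennreal (f x) \<partial>?\<pi>) = 1"
  proof -
    have "emeasure (density ?\<pi> (\<lambda>x. ennreal (f x))) UNIV = 1"
      using \<mu>.emeasure_space_1 sets_eq_imp_space_eq[OF sb] by (simp add: d)
    then show ?thesis by (simp add: emeasure_density)
  qed
  have L: "?L = density ?\<pi> (\<lambda>x. ennreal (OU s u f x))"
  proof (rule measure_eqI)
    fix A assume "A \<in> sets ?L"
    then have [measurable]: "A \<in> sets borel" by simp
    have "emeasure ?L A = (\<integral>\<^sup>+x. indicator A x \<partial>?L)" by simp
    also have "\<dots> = (\<integral>\<^sup>+p. indicator A (sqrt u *\<^sub>R fst p + sqrt (1 - u) *\<^sub>R snd p) \<partial>(\<mu> \<Otimes>\<^sub>M ?\<pi>))"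
      by (subst nn_integral_distr) (auto simp: case_prod_beta')
    also have "\<dots> = (\<integral>\<^sup>+x. \<integral>\<^sup>+z. indicator A (sqrt u *\<^sub>R x + sqrt (1 - u) *\<^sub>R z) \<partial>?\<pi> \<partial>\<mu>)"
      by (subst G.nn_integral_fst[symmetric]) auto
    also have "\<dots> = (\<integral>\<^sup>+x. \<integral>\<^sup>+z. indicator A (sqrt u *\<^sub>R x + sqrt (1 - u) *\<^sub>R z) \<partial>?\<pi> \<partial>density ?\<pi> (\<lambda>x. ennreal (f x)))"
      by (simp add: d)
    also have "\<dots> = (\<integral>\<^sup>+x. ennreal (f x) * (\<integral>\<^sup>+z. indicator A (sqrt u *\<^sub>R x + sqrt (1 - u) *\<^sub>R z) \<partial>?\<pi>) \<partial>?\<pi>)"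
      by (rule nn_integral_density) measurable
    also have "\<dots> = (\<integral>\<^sup>+x. indicator A x * OUn s u f x \<partial>?\<pi>)"
      unfolding OUn_def using u by (intro iso_gaussian_reversible[OF s]) auto
    also have "\<dots> = (\<integral>\<^sup>+x. ennreal (OU s u f x) * indicator A x \<partial>?\<pi>)"
      using AE_OUn[of f u, OF f nn _ _ f1] u
      by (intro nn_integral_cong_AE) (auto elim!: eventually_mono simp: mult.commute)
    finally show "emeasure ?L A = emeasure (density ?\<pi> (\<lambda>x. ennreal (OU s u f x))) A"
      by (simp add: emeasure_density)
  qed simp
  have DL: "prob_space (density ?\<pi> (\<lambda>x. ennreal (OU s u f x)))"
    using nn_integral_OU[of f u, OF f nn _ _ f1] u by (intro prob_spaceI) (simp add: emeasure_density)
  have "KL ?L ?\<pi> = gauss_ent s (OU s u f)"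
    unfolding L by (rule KL_density_eq[OF G.prob_space_axioms _ _ DL]) (use nn in \<open>auto intro: OU_nonneg\<close>)
  also have "\<dots> \<le> ennreal u * gauss_ent s f"
    by (rule OU_entropy_contraction[OF f nn u f1])
  also have "gauss_ent s f = KL \<mu> ?\<pi>"
    unfolding f_def by (rule KL_eq_rdens[OF G.prob_space_axioms \<mu> sb ac, symmetric])
  finally show ?thesis .
qed

end

section \<open>One step of the recursion, and Poisson mixtures\<close>

text \<open>The noise is split as \<open>e = sqrt (a (1 - a)) z\<^sub>1 + sqrt (1 - a) z\<^sub>2\<close> with \<open>z\<^sub>1, z\<^sub>2\<close> of law \<open>\<pi>\<close>:
  \<open>z\<^sub>1\<close> provides the contraction by the factor \<open>a\<close>, and \<open>z\<^sub>2\<close> absorbs the gradient.\<close>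

lemma sgld_step_KL:
  fixes \<mu> :: "'a::euclidean_space measure" and g :: "'a \<Rightarrow> 'u \<Rightarrow> 'a"
  assumes \<mu>: "prob_space \<mu>" and s\<mu> [measurable_cong]: "sets \<mu> = sets borel" and \<mu>U: "prob_space \<mu>U"
    and a: "0 < a" "a < 1" and \<sigma>: "\<sigma> > 0" and s_def: "s = \<sigma> / sqrt (1 - a\<^sup>2)"
    and g: "(\<lambda>(x, u). g x u) \<in> borel_measurable (borel \<Otimes>\<^sub>M \<mu>U)"
  shows "KL (distr (\<mu> \<Otimes>\<^sub>M (\<mu>U \<Otimes>\<^sub>M iso_gaussian 0 \<sigma>)) borel (\<lambda>(x, u, e). a *\<^sub>R x - \<eta> *\<^sub>R g x u + e))
      (gauss s)
    \<le> ennreal a * KL \<mu> (gauss s) +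
      ennreal (\<eta>\<^sup>2 * (1 + a) / (2 * \<sigma>\<^sup>2)) * (\<integral>\<^sup>+(x, u). ennreal ((norm (g x u))\<^sup>2) \<partial>(\<mu> \<Otimes>\<^sub>M \<mu>U))"
    (is "KL ?\<nu> ?\<pi> \<le> _ * ?K + ennreal ?C * ?H")
proof (cases "?K = \<infinity> \<or> (?C > 0 \<and> ?H = \<infinity>)")
  \<comment> \<open>In \<open>ennreal\<close>, \<open>0 * \<infinity> = 0\<close>: an infinite
    gradient moment makes the claim trivial only together with \<open>?C > 0\<close>.\<close>
  case True
  then show ?thesis using a by (auto simp: ennreal_mult_top)
next
  case False
  define D where "D = ?C"
  have a2: "0 < 1 - a\<^sup>2" "1 - a\<^sup>2 = (1 - a) * (1 + a)"
    using a by (simp_all add: power_less_one_iff, simp add: power2_eq_square algebra_simps)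
  have s: "s > 0" using \<sigma> a2 by (simp add: s_def)
  have \<sigma>s: "\<sigma> = sqrt (1 - a\<^sup>2) * s" using a2(1) by (simp add: s_def)
  let ?E = "iso_gaussian (0::'a) \<sigma>"
  interpret \<mu>: prob_space \<mu> by fact
  interpret U: prob_space \<mu>U by fact
  interpret G: prob_space ?\<pi> by (rule prob_space_iso_gaussian[OF s])
  interpret E: prob_space ?E by (rule prob_space_iso_gaussian[OF \<sigma>])
  interpret UE: pair_prob_space \<mu>U ?E ..
  interpret \<mu>UE: pair_prob_space \<mu> "\<mu>U \<Otimes>\<^sub>M ?E" ..
  interpret \<mu>U: pair_prob_space \<mu> \<mu>U ..
  interpret \<mu>G: pair_prob_space \<mu> ?\<pi> ..
  interpret GG: pair_prob_space ?\<pi> ?\<pi> ..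
  have gm [measurable (raw)]: "(\<lambda>w. g (f w) (h w)) \<in> borel_measurable N"
    if "f \<in> borel_measurable N" "h \<in> N \<rightarrow>\<^sub>M \<mu>U" for f h and N :: "'n measure"
    using measurable_compose[OF measurable_Pair[OF that] g] by simp
  define p where "p = sqrt (a * (1 - a))"
  define q where "q = sqrt (1 - a)"
  have pq: "0 \<le> p" "0 < q" "p\<^sup>2 + q\<^sup>2 = 1 - a\<^sup>2" "a + q\<^sup>2 = 1"
    using a by (auto simp: p_def q_def power2_eq_square algebra_simps)
  have p_eq: "p = sqrt a * sqrt (1 - a)" by (simp add: p_def real_sqrt_mult)
  \<comment> \<open>The second Gaussian has variance
    \<open>q\<^sup>2 * s\<^sup>2 = \<sigma>\<^sup>2 / (1 + a)\<close>, the source of the factor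
    \<open>1 + a\<close>.\<close>
  have C: "\<eta>\<^sup>2 * (norm v)\<^sup>2 / (2 * q\<^sup>2 * s\<^sup>2) = D * (norm v)\<^sup>2" for v :: 'a
  proof -
    have "q\<^sup>2 * s\<^sup>2 = \<sigma>\<^sup>2 / (1 + a)"
      using a a2 by (simp add: q_def s_def power_divide)
    then have e: "2 * q\<^sup>2 * s\<^sup>2 = 2 * \<sigma>\<^sup>2 / (1 + a)" by simp
    show ?thesis unfolding e D_def by simp
  qed
  \<comment> \<open>Since \<open>p = sqrt a * sqrt (1 - a)\<close>, a variable of law
    \<open>L\<close> multiplied by \<open>sqrt a\<close> is distributed as
    \<open>a x + p z\<close>.\<close>
  define L where "L = distr (\<mu> \<Otimes>\<^sub>M ?\<pi>) borel (\<lambda>(x, z). sqrt a *\<^sub>R x + sqrt (1 - a) *\<^sub>R z)"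
  have Lp: "prob_space L"
    unfolding L_def by (rule \<mu>G.prob_space_distr) (simp add: case_prod_beta')
  have KLa: "KL L ?\<pi> \<le> ennreal a * ?K"
    unfolding L_def using a by (intro KL_OU_contraction[OF s \<mu> s\<mu>]) auto
  have Kfin: "?K < \<infinity>" using False by (simp add: less_top)
  have KLfin: "KL L ?\<pi> < \<infinity>"
    using KLa by (rule le_less_trans) (use Kfin in \<open>simp add: ennreal_mult_less_top\<close>)
  define B where "B = enn2real (KL L ?\<pi>) + enn2real (ennreal D * ?H)"
  have CH: "ennreal D * ?H < \<infinity>"
    using False[folded D_def] by (cases "D > 0") (auto simp: ennreal_mult_less_top less_top not_less ennreal_neg)
  have iCg: "integrable (\<mu> \<Otimes>\<^sub>M \<mu>U) (\<lambda>y. D * (norm (g (fst y) (snd y)))\<^sup>2)"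
    and ICg: "(\<integral>y. D * (norm (g (fst y) (snd y)))\<^sup>2 \<partial>(\<mu> \<Otimes>\<^sub>M \<mu>U)) = enn2real (ennreal D * ?H)"
  proof -
    have C0: "D \<ge> 0" using a by (simp add: D_def)
    have "(\<integral>\<^sup>+y. ennreal (D * (norm (g (fst y) (snd y)))\<^sup>2) \<partial>(\<mu> \<Otimes>\<^sub>M \<mu>U)) = ennreal D * ?H"
    proof -
      have "(\<integral>\<^sup>+y. ennreal (D * (norm (g (fst y) (snd y)))\<^sup>2) \<partial>(\<mu> \<Otimes>\<^sub>M \<mu>U)) =
          (\<integral>\<^sup>+y. ennreal D * ennreal ((norm (g (fst y) (snd y)))\<^sup>2) \<partial>(\<mu> \<Otimes>\<^sub>M \<mu>U))"
        by (intro nn_integral_cong ennreal_mult C0) simp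
      also have "\<dots> = ennreal D * ?H"
        by (subst nn_integral_cmult) (auto simp: case_prod_beta')
      finally show ?thesis .
    qed
    moreover have "ennreal D * ?H = ennreal (enn2real (ennreal D * ?H))"
      using CH by simp
    ultimately have "has_bochner_integral (\<mu> \<Otimes>\<^sub>M \<mu>U) (\<lambda>y. D * (norm (g (fst y) (snd y)))\<^sup>2)
        (enn2real (ennreal D * ?H))"
      using C0 by (intro has_bochner_integral_nn_integral) auto
    then show "integrable (\<mu> \<Otimes>\<^sub>M \<mu>U) (\<lambda>y. D * (norm (g (fst y) (snd y)))\<^sup>2)"
      "(\<integral>y. D * (norm (g (fst y) (snd y)))\<^sup>2 \<partial>(\<mu> \<Otimes>\<^sub>M \<mu>U)) = enn2real (ennreal D * ?H)"
      by (auto simp: has_bochner_integral_iff)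
  qed
  have "KL ?\<nu> ?\<pi> \<le> ennreal B"
  proof (rule KL_leI)
    show "prob_space ?\<nu>"
      by (rule \<mu>UE.prob_space_distr) (simp add: case_prod_beta')
    show "B \<ge> 0" by (simp add: B_def)
    fix \<psi> :: "'a \<Rightarrow> real" and c
    assume "\<psi> \<in> borel_measurable ?\<pi>" and b: "\<And>x. \<bar>\<psi> x\<bar> \<le> c"
    then have [measurable]: "\<psi> \<in> borel_measurable borel" by simp
    \<comment> \<open>\<phi> is the logarithm of the average of \<open>exp \<psi>\<close> over the
      second Gaussian. The translation estimate bounds the mean of \<psi> by the mean of \<phi> plus
      the gradient cost. The variational formula for \<open>L\<close> then produces the average of
      \<open>exp \<phi>\<close>, which reassembles into that of \<open>exp \<psi>\<close> because
      \<open>a + q\<^sup>2 = 1\<close>.\<close>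
    define \<phi> where "\<phi> v = ln (\<integral>z. exp (\<psi> (v + q *\<^sub>R z)) \<partial>?\<pi>)" for v
    have [measurable]: "(\<lambda>y. exp (\<psi> (fst y + q *\<^sub>R snd y))) \<in> borel_measurable (borel \<Otimes>\<^sub>M ?\<pi>)"
      by measurable
    have \<phi>m [measurable]: "\<phi> \<in> borel_measurable borel"
      unfolding \<phi>_def[abs_def] by measurable
    have e\<phi>: "exp (- c) \<le> (\<integral>z. exp (\<psi> (v + q *\<^sub>R z)) \<partial>?\<pi>)" "(\<integral>z. exp (\<psi> (v + q *\<^sub>R z)) \<partial>?\<pi>) \<le> exp c"
      "0 < (\<integral>z. exp (\<psi> (v + q *\<^sub>R z)) \<partial>?\<pi>)" for v
      using integral_exp_bounded(2-4)[OF G.prob_space_axioms, of "\<lambda>z. \<psi> (v + q *\<^sub>R z)" c] b by auto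
    have \<phi>b: "\<bar>\<phi> v\<bar> \<le> c" for v
    proof -
      have "ln (exp (- c)) \<le> \<phi> v" "\<phi> v \<le> ln (exp c)"
        unfolding \<phi>_def using e\<phi>[of v] by (auto simp: ln_le_cancel_iff simp del: ln_exp)
      then show ?thesis by auto
    qed
    have i\<phi>: "integrable ?\<pi> (\<lambda>z. \<phi> (a *\<^sub>R x + p *\<^sub>R z))" for x
      using \<phi>b by (intro prob_space_integrable_bounded[OF G.prob_space_axioms, where c = c]) auto
    have inner: "(\<integral>e. \<psi> (a *\<^sub>R x - \<eta> *\<^sub>R g x u + e) \<partial>?E) \<le>
        (\<integral>z. \<phi> (a *\<^sub>R x + p *\<^sub>R z) \<partial>?\<pi>) + D * (norm (g x u))\<^sup>2" if u: "u \<in> space \<mu>U" for x u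
    proof -
      let ?y = "a *\<^sub>R x - \<eta> *\<^sub>R g x u"
      have "?E = distr ?\<pi> borel (\<lambda>z. sqrt (1 - a\<^sup>2) *\<^sub>R z)"
        unfolding \<sigma>s using a2 s by (intro iso_gaussian_scale) auto
      also have "\<dots> = distr (?\<pi> \<Otimes>\<^sub>M ?\<pi>) borel (\<lambda>(x, z). p *\<^sub>R x + q *\<^sub>R z)"
        using pq a2 by (intro iso_gaussian_add[OF s, symmetric]) auto
      finally have "(\<integral>e. \<psi> (?y + e) \<partial>?E) = (\<integral>w. \<psi> (?y + (p *\<^sub>R fst w + q *\<^sub>R snd w)) \<partial>(?\<pi> \<Otimes>\<^sub>M ?\<pi>))"
        by (simp add: integral_distr case_prod_beta')
      also have "\<dots> = (\<integral>z. \<integral>z'. \<psi> (?y + (p *\<^sub>R z + q *\<^sub>R z')) \<partial>?\<pi> \<partial>?\<pi>)"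
      proof -
        have "integrable (?\<pi> \<Otimes>\<^sub>M ?\<pi>) (\<lambda>w. \<psi> (?y + (p *\<^sub>R fst w + q *\<^sub>R snd w)))"
          using b by (intro prob_space_integrable_bounded[where c = c] GG.P.prob_space_axioms) auto
        from GG.integral_fst'[OF this] show ?thesis by simp
      qed
      also have "\<dots> \<le> (\<integral>z. \<phi> (a *\<^sub>R x + p *\<^sub>R z) + D * (norm (g x u))\<^sup>2 \<partial>?\<pi>)"
      proof (rule integral_mono)
        have [measurable]: "(\<lambda>w. \<psi> (?y + (p *\<^sub>R fst w + q *\<^sub>R snd w))) \<in> borel_measurable (?\<pi> \<Otimes>\<^sub>M ?\<pi>)"
          by measurable
        show "integrable ?\<pi> (\<lambda>z. \<integral>z'. \<psi> (?y + (p *\<^sub>R z + q *\<^sub>R z')) \<partial>?\<pi>)"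
        proof (rule prob_space_integrable_bounded[OF G.prob_space_axioms])
          show "\<bar>\<integral>z'. \<psi> (?y + (p *\<^sub>R z + q *\<^sub>R z')) \<partial>?\<pi>\<bar> \<le> c" for z
            using b by (intro prob_space_abs_integral_le[OF G.prob_space_axioms]) auto
        qed measurable
        show "integrable ?\<pi> (\<lambda>z. \<phi> (a *\<^sub>R x + p *\<^sub>R z) + D * (norm (g x u))\<^sup>2)"
          using i\<phi>[of x] by simp
        fix z
        \<comment> \<open>The gradient step in units of \<open>q\<close>, read as a translation of
          the second Gaussian variable.\<close>
        define \<delta> where "\<delta> = (\<eta> / q) *\<^sub>R g x u"
        have "(\<integral>z'. \<psi> (?y + (p *\<^sub>R z + q *\<^sub>R z')) \<partial>?\<pi>) =
            (\<integral>z'. \<psi> (a *\<^sub>R x + p *\<^sub>R z + q *\<^sub>R (z' - \<delta>)) \<partial>?\<pi>)"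
          using pq by (intro Bochner_Integration.integral_cong refl arg_cong[where f = \<psi>])
            (simp add: \<delta>_def algebra_simps)
        also have "\<dots> \<le> \<phi> (a *\<^sub>R x + p *\<^sub>R z) + (norm \<delta>)\<^sup>2 / (2 * s\<^sup>2)"
          unfolding \<phi>_def using b
          by (intro iso_gaussian_DV_shift[OF s, where \<psi> = "\<lambda>y. \<psi> (a *\<^sub>R x + p *\<^sub>R z + q *\<^sub>R y)"]) auto
        also have "(norm \<delta>)\<^sup>2 / (2 * s\<^sup>2) = \<eta>\<^sup>2 * (norm (g x u))\<^sup>2 / (2 * q\<^sup>2 * s\<^sup>2)"
          by (simp add: \<delta>_def power_mult_distrib power_divide)
        finally show "(\<integral>z'. \<psi> (?y + (p *\<^sub>R z + q *\<^sub>R z')) \<partial>?\<pi>) \<le>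
            \<phi> (a *\<^sub>R x + p *\<^sub>R z) + D * (norm (g x u))\<^sup>2"
          unfolding C .
      qed
      also have "\<dots> = (\<integral>z. \<phi> (a *\<^sub>R x + p *\<^sub>R z) \<partial>?\<pi>) + D * (norm (g x u))\<^sup>2"
        using i\<phi>[of x] by (simp add: G.prob_space[simplified])
      finally show ?thesis .
    qed
    define \<Phi> where "\<Phi> x = (\<integral>z. \<phi> (a *\<^sub>R x + p *\<^sub>R z) \<partial>?\<pi>)" for x
    have [measurable]: "(\<lambda>w. \<phi> (a *\<^sub>R fst w + p *\<^sub>R snd w)) \<in> borel_measurable (borel \<Otimes>\<^sub>M ?\<pi>)"
      by measurable
    have [measurable]: "\<Phi> \<in> borel_measurable borel"
      unfolding \<Phi>_def[abs_def] by measurable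
    have \<Phi>b: "\<bar>\<Phi> x\<bar> \<le> c" for x
      unfolding \<Phi>_def using \<phi>b by (intro prob_space_abs_integral_le[OF G.prob_space_axioms]) auto
    define J where "J y = (\<integral>e. \<psi> (a *\<^sub>R fst y - \<eta> *\<^sub>R g (fst y) (snd y) + e) \<partial>?E)" for y
    have [measurable]: "(\<lambda>w. \<psi> (a *\<^sub>R fst (fst w) - \<eta> *\<^sub>R g (fst (fst w)) (snd (fst w)) + snd w))
        \<in> borel_measurable ((\<mu> \<Otimes>\<^sub>M \<mu>U) \<Otimes>\<^sub>M ?E)"
      by measurable
    have [measurable]: "J \<in> borel_measurable (\<mu> \<Otimes>\<^sub>M \<mu>U)"
      unfolding J_def[abs_def] by measurable
    have Jb: "\<bar>J y\<bar> \<le> c" if "snd y \<in> space \<mu>U" for y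
      unfolding J_def using b that by (intro prob_space_abs_integral_le[OF E.prob_space_axioms]) auto
    have iJ: "integrable (\<mu> \<Otimes>\<^sub>M \<mu>U) J"
      using Jb by (intro \<mu>U.P.integrable_const_bound[where B = c]) (auto simp: space_pair_measure)
    have i3: "integrable (\<mu> \<Otimes>\<^sub>M (\<mu>U \<Otimes>\<^sub>M ?E)) (\<lambda>w. \<psi> (a *\<^sub>R fst w - \<eta> *\<^sub>R g (fst w) (fst (snd w)) + snd (snd w)))"
      using b by (intro prob_space_integrable_bounded[where c = c] \<mu>UE.P.prob_space_axioms) auto
    have "(\<integral>x. \<psi> x \<partial>?\<nu>) =
        (\<integral>w. \<psi> (a *\<^sub>R fst w - \<eta> *\<^sub>R g (fst w) (fst (snd w)) + snd (snd w)) \<partial>(\<mu> \<Otimes>\<^sub>M (\<mu>U \<Otimes>\<^sub>M ?E)))"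
      by (subst integral_distr) (auto simp: case_prod_beta')
    also have "\<dots> = (\<integral>x. \<integral>w. \<psi> (a *\<^sub>R x - \<eta> *\<^sub>R g x (fst w) + snd w) \<partial>(\<mu>U \<Otimes>\<^sub>M ?E) \<partial>\<mu>)"
      using \<mu>UE.integral_fst'[OF i3] by simp
    also have "\<dots> = (\<integral>x. \<integral>u. J (x, u) \<partial>\<mu>U \<partial>\<mu>)"
    proof (intro Bochner_Integration.integral_cong refl)
      fix x
      have "integrable (\<mu>U \<Otimes>\<^sub>M ?E) (\<lambda>w. \<psi> (a *\<^sub>R x - \<eta> *\<^sub>R g x (fst w) + snd w))"
        using b by (intro prob_space_integrable_bounded[where c = c] UE.P.prob_space_axioms) auto
      from UE.integral_fst'[OF this]
      show "(\<integral>w. \<psi> (a *\<^sub>R x - \<eta> *\<^sub>R g x (fst w) + snd w) \<partial>(\<mu>U \<Otimes>\<^sub>M ?E)) = (\<integral>u. J (x, u) \<partial>\<mu>U)"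
        by (simp add: J_def)
    qed
    also have "\<dots> = (\<integral>y. J y \<partial>(\<mu> \<Otimes>\<^sub>M \<mu>U))"
      by (rule \<mu>U.integral_fst'[OF iJ])
    also have "\<dots> \<le> (\<integral>y. \<Phi> (fst y) + D * (norm (g (fst y) (snd y)))\<^sup>2 \<partial>(\<mu> \<Otimes>\<^sub>M \<mu>U))"
    proof (rule integral_mono[OF iJ])
      have "integrable (\<mu> \<Otimes>\<^sub>M \<mu>U) (\<lambda>y. \<Phi> (fst y))"
        using \<Phi>b by (intro prob_space_integrable_bounded[where c = c] \<mu>U.P.prob_space_axioms) auto
      then show "integrable (\<mu> \<Otimes>\<^sub>M \<mu>U) (\<lambda>y. \<Phi> (fst y) + D * (norm (g (fst y) (snd y)))\<^sup>2)"
        using iCg by (rule Bochner_Integration.integrable_add)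
      show "J y \<le> \<Phi> (fst y) + D * (norm (g (fst y) (snd y)))\<^sup>2" if "y \<in> space (\<mu> \<Otimes>\<^sub>M \<mu>U)" for y
        unfolding J_def \<Phi>_def using that by (intro inner) (auto simp: space_pair_measure)
    qed
    also have "\<dots> = (\<integral>y. \<Phi> (fst y) \<partial>(\<mu> \<Otimes>\<^sub>M \<mu>U)) + enn2real (ennreal D * ?H)"
      unfolding ICg[symmetric] using \<Phi>b
      by (intro Bochner_Integration.integral_add iCg prob_space_integrable_bounded[where c = c] \<mu>U.P.prob_space_axioms) auto
    also have "(\<integral>y. \<Phi> (fst y) \<partial>(\<mu> \<Otimes>\<^sub>M \<mu>U)) = (\<integral>x. \<Phi> x \<partial>\<mu>)"
    proof -
      have "integrable (\<mu> \<Otimes>\<^sub>M \<mu>U) (\<lambda>y. \<Phi> (fst y))"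
        using \<Phi>b by (intro prob_space_integrable_bounded[where c = c] \<mu>U.P.prob_space_axioms) auto
      from \<mu>U.integral_fst'[OF this] show ?thesis by (simp add: U.prob_space)
    qed
    also have "\<dots> = (\<integral>w. \<phi> (a *\<^sub>R fst w + p *\<^sub>R snd w) \<partial>(\<mu> \<Otimes>\<^sub>M ?\<pi>))"
    proof -
      have "integrable (\<mu> \<Otimes>\<^sub>M ?\<pi>) (\<lambda>w. \<phi> (a *\<^sub>R fst w + p *\<^sub>R snd w))"
        using \<phi>b by (intro prob_space_integrable_bounded[where c = c] \<mu>G.P.prob_space_axioms) auto
      from \<mu>G.integral_fst'[OF this] show ?thesis by (simp add: \<Phi>_def)
    qed
    also have "\<dots> = (\<integral>y. \<phi> (sqrt a *\<^sub>R y) \<partial>L)"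
      unfolding L_def using a
      by (subst integral_distr) (auto simp: case_prod_beta' scaleR_add_right p_eq)
    also have "\<dots> \<le> enn2real (KL L ?\<pi>) + ln (\<integral>y. exp (\<phi> (sqrt a *\<^sub>R y)) \<partial>?\<pi>)"
      using \<phi>b by (intro Donsker_Varadhan[OF G.prob_space_axioms Lp _ KLfin, where c = c]) (auto simp: L_def)
    also have "(\<integral>y. exp (\<phi> (sqrt a *\<^sub>R y)) \<partial>?\<pi>) = (\<integral>y. \<integral>z. exp (\<psi> (sqrt a *\<^sub>R y + q *\<^sub>R z)) \<partial>?\<pi> \<partial>?\<pi>)"
      unfolding \<phi>_def using e\<phi>(3) by simp
    also have "\<dots> = (\<integral>w. exp (\<psi> (sqrt a *\<^sub>R fst w + q *\<^sub>R snd w)) \<partial>(?\<pi> \<Otimes>\<^sub>M ?\<pi>))"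
    proof -
      have "integrable (?\<pi> \<Otimes>\<^sub>M ?\<pi>) (\<lambda>w. exp (\<psi> (sqrt a *\<^sub>R fst w + q *\<^sub>R snd w)))"
        using b by (intro integral_exp_bounded(1)[OF GG.P.prob_space_axioms, where c = c]) auto
      from GG.integral_fst'[OF this] show ?thesis by simp
    qed
    also have "\<dots> = (\<integral>y. exp (\<psi> y) \<partial>distr (?\<pi> \<Otimes>\<^sub>M ?\<pi>) borel (\<lambda>(x, z). sqrt a *\<^sub>R x + q *\<^sub>R z))"
      by (subst integral_distr) (auto simp: case_prod_beta')
    also have "distr (?\<pi> \<Otimes>\<^sub>M ?\<pi>) borel (\<lambda>(x, z). sqrt a *\<^sub>R x + q *\<^sub>R z) = distr ?\<pi> borel (\<lambda>x. 1 *\<^sub>R x)"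
      using pq a by (intro iso_gaussian_add[OF s]) auto
    also have "\<dots> = ?\<pi>" by (simp add: distr_id2)
    finally show "(\<integral>x. \<psi> x \<partial>?\<nu>) \<le> B + ln (\<integral>y. exp (\<psi> y) \<partial>?\<pi>)"
      by (simp add: B_def)
  qed (auto intro: G.prob_space_axioms)
  also have "ennreal B = KL L ?\<pi> + ennreal D * ?H"
    using KLfin CH by (simp add: B_def)
  also have "\<dots> \<le> ennreal a * ?K + ennreal D * ?H"
    using KLa by (rule add_right_mono)
  finally show ?thesis unfolding D_def .
qed

section \<open>Mixtures of laws and Poisson weights\<close>

lemma nn_integral_bounded_eq:
  fixes \<psi> :: "'a \<Rightarrow> real"
  assumes "prob_space P" and [measurable]: "\<psi> \<in> borel_measurable P" and b: "\<And>x. \<bar>\<psi> x\<bar> \<le> c"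
  shows "(\<integral>\<^sup>+x. ennreal (\<psi> x + c) \<partial>P) = ennreal ((\<integral>x. \<psi> x \<partial>P) + c)"
proof -
  interpret prob_space P by fact
  have i: "integrable P \<psi>"
    using assms by (rule prob_space_integrable_bounded)
  have "0 \<le> \<psi> x + c" for x using b[of x] by linarith
  then have "(\<integral>\<^sup>+x. ennreal (\<psi> x + c) \<partial>P) = ennreal (\<integral>x. \<psi> x + c \<partial>P)"
    using i by (intro nn_integral_eq_integral) auto
  then show ?thesis using i by (simp add: prob_space)
qed

text \<open>The variational bounds of all components share the same logarithmic term, and the
  weights sum to 1. The bound \<open>c\<close> is added to \<psi> because the mixture formula is
  stated for nonnegative integrands.\<close>

lemma KL_mixture_le:
  fixes \<mu> :: "nat \<Rightarrow> 'a measure"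
  assumes P: "prob_space P" and \<rho>: "prob_space \<rho>" "sets \<rho> = sets P"
    and \<mu>: "\<And>k. prob_space (\<mu> k)" "\<And>k. sets (\<mu> k) = sets P"
    and p: "\<And>k. 0 \<le> p k" and p1: "(\<Sum>k. ennreal (p k)) = 1"
    and mix: "\<And>F. F \<in> borel_measurable P \<Longrightarrow> (\<integral>\<^sup>+x. F x \<partial>\<rho>) = (\<Sum>k. ennreal (p k) * (\<integral>\<^sup>+x. F x \<partial>\<mu> k))"
  shows "KL \<rho> P \<le> (\<Sum>k. ennreal (p k) * KL (\<mu> k) P)"
proof (cases "(\<Sum>k. ennreal (p k) * KL (\<mu> k) P) = \<infinity>")
  case False
  let ?B = "\<Sum>k. ennreal (p k) * KL (\<mu> k) P"
  have "KL \<rho> P \<le> ennreal (enn2real ?B)"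
  proof (rule KL_leI[OF P \<rho>])
    fix \<psi> :: "'a \<Rightarrow> real" and c
    assume \<psi> [measurable]: "\<psi> \<in> borel_measurable P" and b: "\<And>x. \<bar>\<psi> x\<bar> \<le> c"
    define L where "L = ln (\<integral>x. exp (\<psi> x) \<partial>P)"
    have "ln (exp (- c)) \<le> L"
      unfolding L_def using integral_exp_bounded(2,4)[OF P \<psi> b] by (subst ln_le_cancel_iff) auto
    then have Lc: "0 \<le> L + c" by simp
    have le: "ennreal (p k) * (\<integral>\<^sup>+x. ennreal (\<psi> x + c) \<partial>\<mu> k) \<le>
        ennreal (p k) * KL (\<mu> k) P + ennreal (p k) * ennreal (L + c)" for k
    proof (cases "KL (\<mu> k) P = \<infinity>")
      case True
      then show ?thesis by (cases "p k = 0") (use p[of k] in \<open>auto simp: ennreal_mult_top\<close>)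
    next
      case False
      then have fin: "KL (\<mu> k) P < \<infinity>" by (simp add: less_top)
      have "(\<integral>\<^sup>+x. ennreal (\<psi> x + c) \<partial>\<mu> k) = ennreal ((\<integral>x. \<psi> x \<partial>\<mu> k) + c)"
        by (rule nn_integral_bounded_eq[OF \<mu>(1) _ b])
          (simp add: measurable_cong_sets[OF \<mu>(2) refl])
      also have "\<dots> \<le> ennreal (enn2real (KL (\<mu> k) P) + (L + c))"
        using Donsker_Varadhan[OF P \<mu> fin \<psi> b] by (intro ennreal_leI) (simp add: L_def)
      also have "\<dots> = KL (\<mu> k) P + ennreal (L + c)"
        using fin Lc by (subst ennreal_plus) auto
      finally show ?thesis
        unfolding distrib_left[symmetric] by (rule mult_left_mono) simp
    qed
    have "ennreal ((\<integral>x. \<psi> x \<partial>\<rho>) + c) = (\<integral>\<^sup>+x. ennreal (\<psi> x + c) \<partial>\<rho>)"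
      by (rule nn_integral_bounded_eq[OF \<rho>(1) _ b, symmetric])
        (simp add: measurable_cong_sets[OF \<rho>(2) refl])
    also have "\<dots> = (\<Sum>k. ennreal (p k) * (\<integral>\<^sup>+x. ennreal (\<psi> x + c) \<partial>\<mu> k))"
      by (rule mix) measurable
    also have "\<dots> \<le> (\<Sum>k. ennreal (p k) * KL (\<mu> k) P + ennreal (p k) * ennreal (L + c))"
      by (intro suminf_le le) auto
    also have "\<dots> = ?B + ennreal (L + c)"
      by (subst suminf_add[symmetric]) (auto simp: p1)
    also have "\<dots> = ennreal (enn2real ?B + (L + c))"
      using False Lc by (subst ennreal_plus) (auto simp: less_top)
    finally show "(\<integral>x. \<psi> x \<partial>\<rho>) \<le> enn2real ?B + ln (\<integral>x. exp (\<psi> x) \<partial>P)"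
      using Lc by (subst (asm) ennreal_le_iff) (auto simp: L_def)
  qed simp
  then show ?thesis using False by (simp add: less_top)
qed simp

text \<open>The model for \<open>Q k\<close> is the discounted tail, the sum of
  \<open>a ^ m * p (k + m)\<close> over \<open>m\<close>. Stating it through its recursion lets an
  integral take its place. Each application of the bound on \<open>K (Suc k)\<close> passes the
  weight \<open>Q (Suc k)\<close> on to \<open>K k\<close> and \<open>h k\<close>.\<close>

lemma sum_recursion_le:
  fixes K h :: "nat \<Rightarrow> ennreal" and p Q :: "nat \<Rightarrow> real"
  assumes K: "\<And>k. K (Suc k) \<le> ennreal a * K k + h k" and a: "0 \<le> a"
    and p: "\<And>k. 0 \<le> p k" and Q: "\<And>k. 0 \<le> Q k" "\<And>k. Q k = p k + a * Q (Suc k)"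
  shows "(\<Sum>k. ennreal (p k) * K k) \<le> ennreal (Q 0) * K 0 + (\<Sum>k. ennreal (Q (Suc k)) * h k)"
proof -
  \<comment> \<open>The starting index is general so that the induction can advance it; at the end a
    nonnegative remainder is dropped.\<close>
  have fin: "(\<Sum>m<M. ennreal (p (i + m)) * K (i + m)) \<le>
      ennreal (Q i) * K i + (\<Sum>m<M. ennreal (Q (Suc (i + m))) * h (i + m))" for M i
  proof (induction M arbitrary: i)
    case (Suc M)
    have "(\<Sum>m<Suc M. ennreal (p (i + m)) * K (i + m)) =
        ennreal (p i) * K i + (\<Sum>m<M. ennreal (p (Suc i + m)) * K (Suc i + m))"
      by (subst sum.lessThan_Suc_shift) simp
    also have "\<dots> \<le> ennreal (p i) * K i + (ennreal (Q (Suc i)) * K (Suc i) +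
        (\<Sum>m<M. ennreal (Q (Suc (Suc i + m))) * h (Suc i + m)))"
      by (intro add_left_mono Suc.IH)
    also have "\<dots> \<le> ennreal (p i) * K i + (ennreal (Q (Suc i)) * (ennreal a * K i + h i) +
        (\<Sum>m<M. ennreal (Q (Suc (Suc i + m))) * h (Suc i + m)))"
      by (intro add_left_mono add_right_mono mult_left_mono K) auto
    also have "\<dots> = (ennreal (p i) + ennreal (Q (Suc i)) * ennreal a) * K i + (ennreal (Q (Suc i)) * h i +
        (\<Sum>m<M. ennreal (Q (Suc (Suc i + m))) * h (Suc i + m)))"
      by (simp add: algebra_simps)
    also have "ennreal (p i) + ennreal (Q (Suc i)) * ennreal a = ennreal (Q i)"
      using p[of i] Q(1)[of "Suc i"] a
      by (subst Q(2)[of i]) (simp add: ennreal_plus ennreal_mult mult.commute)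
    also have "ennreal (Q (Suc i)) * h i + (\<Sum>m<M. ennreal (Q (Suc (Suc i + m))) * h (Suc i + m)) =
        (\<Sum>m<Suc M. ennreal (Q (Suc (i + m))) * h (i + m))"
      by (subst sum.lessThan_Suc_shift) simp
    finally show ?case .
  qed simp
  show ?thesis
  proof (rule suminf_le_const)
    fix M
    have "(\<Sum>k<M. ennreal (p k) * K k) \<le> ennreal (Q 0) * K 0 + (\<Sum>k<M. ennreal (Q (Suc k)) * h k)"
      using fin[of 0 M] by simp
    also have "\<dots> \<le> ennreal (Q 0) * K 0 + (\<Sum>k. ennreal (Q (Suc k)) * h k)"
      by (intro add_left_mono sum_le_suminf) auto
    finally show "(\<Sum>k<M. ennreal (p k) * K k) \<le> ennreal (Q 0) * K 0 + (\<Sum>k. ennreal (Q (Suc k)) * h k)" .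
  qed auto
qed

definition pois :: "real \<Rightarrow> nat \<Rightarrow> real" where
  "pois t k = t ^ k / fact k * exp (- t)"

text \<open>The exponential is an integrating factor: it turns the forward equation of the Poisson
  weights into one whose integral over \<open>{0..T}\<close> is exactly the recursion asked for in
  \<open>sum_recursion_le\<close>.\<close>

abbreviation damped_pois :: "real \<Rightarrow> real \<Rightarrow> nat \<Rightarrow> real \<Rightarrow> real" where
  "damped_pois a T j t \<equiv> exp (- (1 - a) * (T - t)) * pois t j"

lemma pois_nonneg: "0 \<le> t \<Longrightarrow> 0 \<le> pois t k"
  by (simp add: pois_def)

lemma suminf_pois: "0 \<le> t \<Longrightarrow> (\<Sum>k. ennreal (pois t k)) = 1"
proof -
  assume t: "0 \<le> t"
  have "(\<lambda>k. pois t k) sums (exp t * exp (- t))"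
    unfolding pois_def using exp_converges[of t] by (intro sums_mult2) (simp add: divide_inverse_commute)
  then have "(\<lambda>k. ennreal (pois t k)) sums ennreal (exp t * exp (- t))"
    using t by (subst sums_ennreal) (auto simp: pois_nonneg)
  then show ?thesis by (simp add: sums_iff exp_minus)
qed

lemma pois_0_deriv:
  "((\<lambda>t. damped_pois a T 0 t) has_real_derivative
    - a * (damped_pois a T 0 t)) (at t)"
  unfolding pois_def by (auto intro!: derivative_eq_intros simp: algebra_simps)

lemma pois_Suc_deriv:
  "((\<lambda>t. damped_pois a T (Suc j) t) has_real_derivative
    damped_pois a T j t - a * (damped_pois a T (Suc j) t)) (at t)"
proof -
  have d: "((\<lambda>t. t ^ Suc j / fact (Suc j) :: real) has_real_derivative (t ^ j / fact j)) (at t)"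
    by (rule DERIV_cong, rule DERIV_cdivide, rule DERIV_pow) (simp del: of_nat_Suc)
  have e: "((\<lambda>t. exp (- (1 - a) * (T - t)) * exp (- t)) has_real_derivative
      - a * (exp (- (1 - a) * (T - t)) * exp (- t))) (at t)"
    by (auto intro!: derivative_eq_intros simp: algebra_simps)
  have "(\<lambda>t. damped_pois a T (Suc j) t) =
      (\<lambda>t. exp (- (1 - a) * (T - t)) * exp (- t) * (t ^ Suc j / fact (Suc j)))"
    by (simp add: pois_def mult_ac del: fact_Suc power_Suc)
  then show ?thesis
    using DERIV_mult[OF e d]
    by (simp only:) (erule DERIV_cong, simp add: pois_def algebra_simps del: fact_Suc power_Suc)
qed

text \<open>\<open>q j\<close> is the coefficient of the \<open>j\<close>-th gradient term in the final bound.\<close>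

lemma
  fixes T a :: real
  assumes T: "T \<ge> 0"
  defines "q \<equiv> \<lambda>j. \<integral>t. damped_pois a T j t * indicator {0..T} t \<partial>lborel"
  shows pois_integral_nonneg: "0 \<le> q j"
    and pois_integral_0: "exp (- (1 - a) * T) = pois T 0 + a * q 0"
    and pois_integral_Suc: "q j = pois T (Suc j) + a * q (Suc j)"
    and nn_integral_pois: "(\<integral>\<^sup>+t\<in>{0..T}. ennreal (damped_pois a T j t) \<partial>lborel) = ennreal (q j)"
proof -
  have cont: "continuous_on {0..T} (\<lambda>t. damped_pois a T j t)" for j
    unfolding pois_def by (intro continuous_intros) auto
  have isC0: "isCont (\<lambda>t. - a * (damped_pois a T 0 t)) t" for t
    unfolding pois_def by (intro continuous_intros) auto
  have isC1: "isCont (\<lambda>t. damped_pois a T j t -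
      a * (damped_pois a T (Suc j) t)) t" for j t
    unfolding pois_def by (intro continuous_intros) auto
  have int: "integrable lborel (\<lambda>t. damped_pois a T j t * indicator {0..T} t)" for j
    using borel_integrable_atLeastAtMost'[OF cont[of j]]
    by (simp add: set_integrable_def mult.commute)
  have nn: "0 \<le> damped_pois a T j t * indicator {0..T} t" for t j
    by (auto simp: indicator_def pois_nonneg)
  show "0 \<le> q j"
    unfolding q_def using nn by simp
  \<comment> \<open>For count 0 the boundary term at time 0 is \<open>exp (- (1 - a) * T)\<close>,
    which becomes the coefficient of the initial divergence; for positive counts that boundary term
    vanishes.\<close>
  have "(\<integral>t. - a * (damped_pois a T 0 t) * indicator {0..T} t \<partial>lborel) =
      exp (- (1 - a) * (T - T)) * pois T 0 - exp (- (1 - a) * (T - 0)) * pois 0 0"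
    by (intro integral_FTC_Icc_real[OF T pois_0_deriv] isC0)
  moreover have "(\<integral>t. - a * (damped_pois a T 0 t) * indicator {0..T} t \<partial>lborel) = - a * q 0"
    unfolding q_def by (subst integral_mult_right_zero[symmetric]) (simp add: mult.assoc)
  ultimately show "exp (- (1 - a) * T) = pois T 0 + a * q 0"
    by (simp add: pois_def)
  have "(\<integral>t. (damped_pois a T j t - a * (damped_pois a T (Suc j) t)) *
      indicator {0..T} t \<partial>lborel) =
      exp (- (1 - a) * (T - T)) * pois T (Suc j) - exp (- (1 - a) * (T - 0)) * pois 0 (Suc j)"
    by (intro integral_FTC_Icc_real[OF T pois_Suc_deriv] isC1)
  moreover have "(\<integral>t. (damped_pois a T j t - a * (damped_pois a T (Suc j) t)) *
      indicator {0..T} t \<partial>lborel) = q j - a * q (Suc j)"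
  proof -
    have "(damped_pois a T j t - a * (damped_pois a T (Suc j) t)) * indicator {0..T} t
      = damped_pois a T j t * indicator {0..T} t -
        a * (damped_pois a T (Suc j) t * indicator {0..T} t)" for t
      by (simp add: algebra_simps)
    then show ?thesis
      unfolding q_def using int by (simp only: integral_mult_right_zero[symmetric])
        (subst Bochner_Integration.integral_diff, auto)
  qed
  ultimately show "q j = pois T (Suc j) + a * q (Suc j)"
    by (simp add: pois_def)
  have "(\<integral>\<^sup>+t\<in>{0..T}. ennreal (damped_pois a T j t) \<partial>lborel) =
      (\<integral>\<^sup>+t. ennreal (damped_pois a T j t * indicator {0..T} t) \<partial>lborel)"
    by (intro nn_integral_cong) (auto simp: indicator_def)
  also have "\<dots> = ennreal (q j)"
    unfolding q_def by (rule nn_integral_eq_integral[OF int]) (use nn in auto)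
  finally show "(\<integral>\<^sup>+t\<in>{0..T}. ennreal (damped_pois a T j t) \<partial>lborel) = ennreal (q j)" .
qed

section \<open>The law of the time-changed process\<close>

lemma sets_vimage_algebra_subset_Pow: "sets (vimage_algebra \<Omega> f R) \<subseteq> Pow \<Omega>"
  using sets.space_closed[of "vimage_algebra \<Omega> f R"] by simp

text \<open>One sample is fixed: \<open>g\<close> and \<open>X\<close> are those of this sample, so
  conditional laws given the sample are plain laws under \<open>M\<close>.\<close>

locale sgld_process = prob_space M + U: prob_space \<mu>U
  for M :: "'w measure" and \<mu>U :: "'u measure" +
  fixes \<mu>0 :: "'a::euclidean_space measure" and g :: "'a \<Rightarrow> 'u \<Rightarrow> 'a"
    and X :: "nat \<Rightarrow> 'w \<Rightarrow> 'a" and U :: "nat \<Rightarrow> 'w \<Rightarrow> 'u" and \<xi> :: "nat \<Rightarrow> 'w \<Rightarrow> 'a"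
    and N :: "real \<Rightarrow> 'w \<Rightarrow> nat" and lam \<eta> \<sigma> s :: real
  assumes param: "0 < lam * \<eta>" "lam * \<eta> < 1" "0 < \<sigma>"
    and s_eq: "s = \<sigma> / sqrt (1 - (1 - lam * \<eta>)\<^sup>2)"
    and g: "(\<lambda>(x, u). g x u) \<in> borel_measurable (borel \<Otimes>\<^sub>M \<mu>U)"
    and X0 [measurable]: "X 0 \<in> borel_measurable M" and X0_law: "distr M borel (X 0) = \<mu>0"
    and U [measurable]: "\<And>k. U k \<in> M \<rightarrow>\<^sub>M \<mu>U" and U_law: "\<And>k. distr M \<mu>U (U k) = \<mu>U"
    and \<xi> [measurable]: "\<And>k. \<xi> k \<in> borel_measurable M"
    and \<xi>_law: "\<And>k. distr M borel (\<xi> k) = iso_gaussian 0 \<sigma>"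
    and clock: "poisson_process M 1 N"
    and indep: "independent_sources M \<mu>U (X 0) U \<xi> N"
    and rec: "\<And>k \<omega>. \<omega> \<in> space M \<Longrightarrow>
      X (Suc k) \<omega> = (1 - lam * \<eta>) *\<^sub>R X k \<omega> - \<eta> *\<^sub>R g (X k \<omega>) (U k \<omega>) + \<xi> k \<omega>"
begin

section \<open>Independent sources and the \<sigma>-algebras they generate\<close>

definition src :: "source \<Rightarrow> 'w set set" where
  "src i = (case i of
     Init \<Rightarrow> sets (vimage_algebra (space M) (X 0) borel)
   | Batch k \<Rightarrow> sets (vimage_algebra (space M) (U k) \<mu>U)
   | Noise k \<Rightarrow> sets (vimage_algebra (space M) (\<xi> k) borel)
   | Clock \<Rightarrow> sets (vimage_algebra (space M) (\<lambda>\<omega>. \<lambda>t\<in>{0..}. N t \<omega>) (\<Pi>\<^sub>M t\<in>{0..}. count_space UNIV)))"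

definition gen :: "source set \<Rightarrow> 'w measure" where
  "gen K = sigma (space M) (\<Union>i\<in>K. src i)"

text \<open>Indices strictly below \<open>k\<close>: the set is disjoint from
  \<open>Batch k\<close>, \<open>Noise k\<close> and \<open>Clock\<close>, whence \<open>X k\<close>
  is independent of the next step's randomness and of the clock.\<close>

definition past :: "nat \<Rightarrow> source set" where
  "past k = insert Init (Batch ` {..<k} \<union> Noise ` {..<k})"

lemma indep_src: "indep_sets src UNIV"
  using indep unfolding independent_sources_def src_def[abs_def] .

lemma src_Pow: "src i \<subseteq> Pow (space M)"
  unfolding src_def by (cases i) (simp_all add: sets_vimage_algebra_subset_Pow)

lemma space_gen [simp]: "space (gen K) = space M"
  unfolding gen_def by (rule space_measure_of) (use src_Pow in blast)

lemma sets_gen: "sets (gen K) = sigma_sets (space M) (\<Union>i\<in>K. src i)"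
  unfolding gen_def by (rule sets_measure_of) (use src_Pow in blast)

lemma sets_gen_subset: "sets (gen K) \<subseteq> sets M"
  unfolding sets_gen
proof (rule sets.sigma_sets_subset)
  show "(\<Union>i\<in>K. src i) \<subseteq> sets M"
    using indep_src unfolding indep_sets_def by auto
qed

lemma gen_mono: "K \<subseteq> L \<Longrightarrow> sets (gen K) \<subseteq> sets (gen L)"
  unfolding sets_gen by (intro sigma_sets_mono') auto

lemma measurable_gen_mono: "f \<in> gen K \<rightarrow>\<^sub>M R \<Longrightarrow> K \<subseteq> L \<Longrightarrow> f \<in> gen L \<rightarrow>\<^sub>M R"
  using gen_mono[of K L] by (auto simp: measurable_def)

lemma measurable_gen_M: "f \<in> gen K \<rightarrow>\<^sub>M R \<Longrightarrow> f \<in> M \<rightarrow>\<^sub>M R"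
  using sets_gen_subset[of K] by (auto simp: measurable_def)

lemma measurable_genI:
  assumes f: "f \<in> space M \<rightarrow> space R" and "sets (vimage_algebra (space M) f R) \<subseteq> src i" "i \<in> K"
  shows "f \<in> gen K \<rightarrow>\<^sub>M R"
proof (rule measurableI)
  fix A assume "A \<in> sets R"
  then have "f -` A \<inter> space M \<in> sets (vimage_algebra (space M) f R)"
    by (rule in_vimage_algebra)
  then show "f -` A \<inter> space (gen K) \<in> sets (gen K)"
    using assms(2,3) unfolding sets_gen by auto
qed (use f in auto)

lemma X0_gen: "X 0 \<in> gen (past k) \<rightarrow>\<^sub>M borel"
  by (rule measurable_genI[where i = Init]) (auto simp: src_def past_def)

lemma U_gen: "Batch k \<in> K \<Longrightarrow> U k \<in> gen K \<rightarrow>\<^sub>M \<mu>U"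
  using measurable_space[OF U] by (intro measurable_genI[where i = "Batch k"]) (auto simp: src_def)

lemma \<xi>_gen: "Noise k \<in> K \<Longrightarrow> \<xi> k \<in> gen K \<rightarrow>\<^sub>M borel"
  by (intro measurable_genI[where i = "Noise k"]) (auto simp: src_def)

lemma N_gen: "0 \<le> t \<Longrightarrow> N t \<in> gen {Clock} \<rightarrow>\<^sub>M count_space UNIV"
proof -
  assume t: "0 \<le> t"
  have "(\<lambda>\<omega>. \<lambda>t\<in>{0..}. N t \<omega>) \<in> gen {Clock} \<rightarrow>\<^sub>M (\<Pi>\<^sub>M t\<in>{0::real..}. count_space UNIV)"
    by (rule measurable_genI[where i = Clock]) (auto simp: src_def space_PiM)
  from measurable_compose[OF this measurable_component_singleton[of t]] t
  show ?thesis by simp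
qed

lemma g_compose_measurable [measurable (raw)]:
  assumes "f \<in> borel_measurable R" "h \<in> R \<rightarrow>\<^sub>M \<mu>U"
  shows "(\<lambda>w. g (f w) (h w)) \<in> borel_measurable R"
  using measurable_compose[OF measurable_Pair[OF assms] g] by simp

lemma X_gen: "X k \<in> gen (past k) \<rightarrow>\<^sub>M borel"
proof (induction k)
  case 0
  show ?case by (rule X0_gen)
next
  case (Suc k)
  have [measurable]: "X k \<in> gen (past (Suc k)) \<rightarrow>\<^sub>M borel"
    by (rule measurable_gen_mono[OF Suc]) (auto simp: past_def)
  have [measurable]: "U k \<in> gen (past (Suc k)) \<rightarrow>\<^sub>M \<mu>U" "\<xi> k \<in> gen (past (Suc k)) \<rightarrow>\<^sub>M borel"
    by (auto intro!: U_gen \<xi>_gen simp: past_def)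
  have "(\<lambda>\<omega>. (1 - lam * \<eta>) *\<^sub>R X k \<omega> - \<eta> *\<^sub>R g (X k \<omega>) (U k \<omega>) + \<xi> k \<omega>) \<in> gen (past (Suc k)) \<rightarrow>\<^sub>M borel"
    by measurable
  then show ?case
    by (subst measurable_cong[OF rec]) auto
qed

lemma X_measurable [measurable]: "X k \<in> borel_measurable M"
  by (rule measurable_gen_M[OF X_gen])

lemma N_measurable [measurable]: "0 \<le> t \<Longrightarrow> N t \<in> M \<rightarrow>\<^sub>M count_space UNIV"
  by (rule measurable_gen_M[OF N_gen])

text \<open>Independence passes to disjoint groups of sources; the two groups are treated as a
  family indexed by \<open>bool\<close>.\<close>

lemma prob_Int_gen:
  assumes KL: "K \<inter> L = {}" and A: "A \<in> sets (gen K)" and B: "B \<in> sets (gen L)"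
  shows "prob (A \<inter> B) = prob A * prob B"
proof -
  have "indep_sets (\<lambda>j. sigma_sets (space M) (\<Union>i\<in>case_bool K L j. src i)) UNIV"
  proof (rule indep_sets_collect_sigma)
    show "indep_sets src (\<Union>j\<in>UNIV. case_bool K L j)"
      using indep_sets_mono_index[OF subset_UNIV indep_src] .
    show "Int_stable (src i)" for i
      unfolding src_def by (cases i) (simp_all add: sets.Int_stable)
    show "disjoint_family_on (case_bool K L) UNIV"
      using KL by (auto simp: disjoint_family_on_def split: bool.split)
  qed
  then have "indep_set (sets (gen K)) (sets (gen L))"
    unfolding indep_set_def sets_gen
    by (rule back_subst[where P = "\<lambda>F. indep_sets F UNIV"]) (auto simp: fun_eq_iff split: bool.split)
  then show ?thesis using A B by (rule indep_setD)
qed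

lemma distr_pair_gen:
  assumes KL: "K \<inter> L = {}" and f: "f \<in> gen K \<rightarrow>\<^sub>M R" and h: "h \<in> gen L \<rightarrow>\<^sub>M Q"
  shows "distr M (R \<Otimes>\<^sub>M Q) (\<lambda>\<omega>. (f \<omega>, h \<omega>)) = distr M R f \<Otimes>\<^sub>M distr M Q h"
proof (rule pair_measure_eqI[symmetric])
  note [measurable] = measurable_gen_M[OF f] measurable_gen_M[OF h]
  show "sigma_finite_measure (distr M R f)" "sigma_finite_measure (distr M Q h)"
    by (auto intro!: prob_space_imp_sigma_finite prob_space_distr)
  fix A B assume "A \<in> sets (distr M R f)" "B \<in> sets (distr M Q h)"
  then have [measurable]: "A \<in> sets R" "B \<in> sets Q" by auto
  have "prob ((f -` A \<inter> space M) \<inter> (h -` B \<inter> space M)) = prob (f -` A \<inter> space M) * prob (h -` B \<inter> space M)"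
    using measurable_sets[OF f, of A] measurable_sets[OF h, of B] by (intro prob_Int_gen[OF KL]) auto
  moreover have "(\<lambda>\<omega>. (f \<omega>, h \<omega>)) -` (A \<times> B) \<inter> space M = (f -` A \<inter> space M) \<inter> (h -` B \<inter> space M)"
    by auto
  ultimately show "emeasure (distr M R f) A * emeasure (distr M Q h) B =
      emeasure (distr M (R \<Otimes>\<^sub>M Q) (\<lambda>\<omega>. (f \<omega>, h \<omega>))) (A \<times> B)"
    by (simp add: emeasure_distr emeasure_eq_measure ennreal_mult)
qed simp

section \<open>Laws of the chain and of the chain at a Poisson time\<close>

abbreviation sgld_step :: "'a \<times> 'u \<times> 'a \<Rightarrow> 'a" where
  "sgld_step \<equiv> \<lambda>(x, u, e). (1 - lam * \<eta>) *\<^sub>R x - \<eta> *\<^sub>R g x u + e"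

abbreviation law :: "nat \<Rightarrow> 'a measure" where "law k \<equiv> distr M borel (X k)"

lemma prob_space_law: "prob_space (law k)"
  by (rule prob_space_distr) simp

lemma law_Suc:
  "law (Suc k) = distr (law k \<Otimes>\<^sub>M (\<mu>U \<Otimes>\<^sub>M iso_gaussian 0 \<sigma>)) borel sgld_step"
proof -
  have e1: "distr M (\<mu>U \<Otimes>\<^sub>M borel) (\<lambda>\<omega>. (U k \<omega>, \<xi> k \<omega>)) = \<mu>U \<Otimes>\<^sub>M iso_gaussian 0 \<sigma>"
    using distr_pair_gen[of "{Batch k}" "{Noise k}", OF _ U_gen \<xi>_gen, of k k] by (simp add: U_law \<xi>_law)
  have "(\<lambda>\<omega>. (U k \<omega>, \<xi> k \<omega>)) \<in> gen {Batch k, Noise k} \<rightarrow>\<^sub>M \<mu>U \<Otimes>\<^sub>M borel"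
    by (intro measurable_Pair U_gen \<xi>_gen) auto
  from distr_pair_gen[OF _ X_gen this, of k]
  have e2: "distr M (borel \<Otimes>\<^sub>M (\<mu>U \<Otimes>\<^sub>M borel)) (\<lambda>\<omega>. (X k \<omega>, U k \<omega>, \<xi> k \<omega>)) =
      law k \<Otimes>\<^sub>M (\<mu>U \<Otimes>\<^sub>M iso_gaussian 0 \<sigma>)"
    by (auto simp: e1 past_def)
  have [measurable]: "sgld_step
      \<in> borel \<Otimes>\<^sub>M (\<mu>U \<Otimes>\<^sub>M borel) \<rightarrow>\<^sub>M borel"
    unfolding case_prod_beta' by measurable
  have "law (Suc k) = distr M borel (\<lambda>\<omega>. sgld_step (X k \<omega>, U k \<omega>, \<xi> k \<omega>))"
    by (intro distr_cong) (auto simp: rec)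
  also have "\<dots> = distr (distr M (borel \<Otimes>\<^sub>M (\<mu>U \<Otimes>\<^sub>M borel)) (\<lambda>\<omega>. (X k \<omega>, U k \<omega>, \<xi> k \<omega>))) borel sgld_step"
    by (subst distr_distr) (auto simp: comp_def)
  finally show ?thesis unfolding e2 .
qed

abbreviation kernel :: "'a \<Rightarrow> 'a measure" where
  "kernel \<equiv> sgld_kernel lam \<eta> \<sigma> \<mu>U g"

lemma kernel_measurable:
  assumes "sets \<mu> = sets borel"
  shows "kernel \<in> \<mu> \<rightarrow>\<^sub>M subprob_algebra borel"
proof -
  have "kernel \<in> borel \<rightarrow>\<^sub>M prob_algebra borel"
    by (rule sgld_kernel_measurable[OF g U.prob_space_axioms param(3)])
  then have "kernel \<in> borel \<rightarrow>\<^sub>M subprob_algebra borel"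
    by (rule measurable_prob_algebraD)
  then show ?thesis by (simp add: measurable_cong_sets[OF assms refl])
qed

lemma bind_kernel:
  assumes \<mu>: "prob_space \<mu>" and s\<mu> [measurable_cong]: "sets \<mu> = sets borel"
  shows "bind \<mu> kernel = distr (\<mu> \<Otimes>\<^sub>M (\<mu>U \<Otimes>\<^sub>M iso_gaussian 0 \<sigma>)) borel sgld_step"
proof (rule measure_eqI)
  interpret \<mu>: prob_space \<mu> by fact
  interpret E: prob_space "iso_gaussian (0::'a) \<sigma>" by (rule prob_space_iso_gaussian[OF param(3)])
  interpret UE: pair_prob_space \<mu>U "iso_gaussian (0::'a) \<sigma>" ..
  have sb: "sets (bind \<mu> kernel) = sets borel"
    using \<mu>.not_empty sets_bind[of \<mu> kernel borel] sgld_kernel_def[of lam \<eta> \<sigma> \<mu>U g] by simp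
  then show "sets (bind \<mu> kernel) = sets (distr (\<mu> \<Otimes>\<^sub>M (\<mu>U \<Otimes>\<^sub>M iso_gaussian 0 \<sigma>)) borel sgld_step)" by simp
  fix A assume "A \<in> sets (bind \<mu> kernel)"
  then have [measurable]: "A \<in> sets borel" by (simp add: sb)
  have "emeasure (bind \<mu> kernel) A = (\<integral>\<^sup>+x. emeasure (kernel x) A \<partial>\<mu>)"
    by (rule emeasure_bind[OF \<mu>.not_empty kernel_measurable[OF s\<mu>]]) simp
  also have "\<dots> = (\<integral>\<^sup>+x. \<integral>\<^sup>+w. indicator A ((1 - lam * \<eta>) *\<^sub>R x - \<eta> *\<^sub>R g x (fst w) + snd w)
      \<partial>(\<mu>U \<Otimes>\<^sub>M iso_gaussian 0 \<sigma>) \<partial>\<mu>)"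
  proof (intro nn_integral_cong)
    fix x
    have "emeasure (kernel x) A = (\<integral>\<^sup>+y. indicator A y \<partial>kernel x)"
      by (simp add: sgld_kernel_def)
    also have "\<dots> = (\<integral>\<^sup>+w. indicator A ((1 - lam * \<eta>) *\<^sub>R x - \<eta> *\<^sub>R g x (fst w) + snd w)
      \<partial>(\<mu>U \<Otimes>\<^sub>M iso_gaussian 0 \<sigma>))"
      unfolding sgld_kernel_def by (subst nn_integral_distr) (auto simp: case_prod_beta')
    finally show "emeasure (kernel x) A = \<dots>" .
  qed
  also have "\<dots> = (\<integral>\<^sup>+w. indicator A ((1 - lam * \<eta>) *\<^sub>R fst w - \<eta> *\<^sub>R g (fst w) (fst (snd w)) + snd (snd w))
      \<partial>(\<mu> \<Otimes>\<^sub>M (\<mu>U \<Otimes>\<^sub>M iso_gaussian 0 \<sigma>)))"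
    by (subst UE.P.nn_integral_fst[symmetric]) auto
  also have "\<dots> = (\<integral>\<^sup>+y. indicator A y \<partial>distr (\<mu> \<Otimes>\<^sub>M (\<mu>U \<Otimes>\<^sub>M iso_gaussian 0 \<sigma>)) borel sgld_step)"
    by (subst nn_integral_distr) (auto simp: case_prod_beta')
  finally show "emeasure (bind \<mu> kernel) A = emeasure (distr (\<mu> \<Otimes>\<^sub>M (\<mu>U \<Otimes>\<^sub>M iso_gaussian 0 \<sigma>)) borel sgld_step) A" by simp
qed

lemma law_Suc_bind: "law (Suc k) = bind (law k) kernel"
  by (simp add: law_Suc bind_kernel prob_space_law)

lemma emeasure_clock:
  assumes t: "0 < t"
  shows "emeasure M {\<omega> \<in> space M. N t \<omega> = j} = ennreal (pois t j)"
proof -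
  have [measurable]: "N t \<in> M \<rightarrow>\<^sub>M count_space UNIV" "N 0 \<in> M \<rightarrow>\<^sub>M count_space UNIV"
    using t by auto
  have "AE \<omega> in M. N 0 \<omega> = 0"
    using clock by (simp add: poisson_process_def)
  then have "emeasure M {\<omega> \<in> space M. N t \<omega> = j} = emeasure M {\<omega> \<in> space M. N t \<omega> - N 0 \<omega> = j}"
    by (intro emeasure_eq_AE) (auto elim: eventually_mono)
  also have "{\<omega> \<in> space M. N t \<omega> - N 0 \<omega> = j} = (\<lambda>\<omega>. N t \<omega> - N 0 \<omega>) -` {j} \<inter> space M"
    by auto
  also have "emeasure M \<dots> = emeasure (distr M (count_space UNIV) (\<lambda>\<omega>. N t \<omega> - N 0 \<omega>)) {j}"
    by (subst emeasure_distr) auto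
  also have "distr M (count_space UNIV) (\<lambda>\<omega>. N t \<omega> - N 0 \<omega>) = measure_pmf (poisson_pmf t)"
    using clock t by (simp add: poisson_process_def)
  also have "emeasure (measure_pmf (poisson_pmf t)) {j} = ennreal (pois t j)"
    using t by (simp add: emeasure_pmf_single pois_def)
  finally show ?thesis .
qed

abbreviation Yp :: "real \<Rightarrow> 'w \<Rightarrow> 'a" where "Yp \<equiv> time_changed X N"

lemma Yp_measurable [measurable]: "0 \<le> t \<Longrightarrow> Yp t \<in> borel_measurable M"
  unfolding time_changed_def[abs_def]
  by (rule measurable_compose_countable[OF _ N_measurable]) auto

text \<open>The integral is split by the value of the clock; \<open>X k\<close> is independent of
  the clock, so each term factors.\<close>

lemma nn_integral_Yp:
  assumes t: "0 < t" and F [measurable]: "F \<in> borel_measurable borel"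
  shows "(\<integral>\<^sup>+\<omega>. F (Yp t \<omega>) \<partial>M) = (\<Sum>k. ennreal (pois t k) * (\<integral>\<^sup>+x. F x \<partial>law k))"
proof -
  have Nm [measurable]: "N t \<in> M \<rightarrow>\<^sub>M count_space UNIV" using t by auto
  have [measurable]: "(\<lambda>\<omega>. indicator {k} (N t \<omega>) :: ennreal) \<in> borel_measurable M" for k
    by (rule measurable_compose[OF Nm]) simp
  have "(\<integral>\<^sup>+\<omega>. F (Yp t \<omega>) \<partial>M) = (\<integral>\<^sup>+\<omega>. (\<Sum>k. F (X k \<omega>) * indicator {k} (N t \<omega>)) \<partial>M)"
  proof (intro nn_integral_cong)
    fix \<omega>
    have "(\<lambda>k. F (X k \<omega>) * indicator {k} (N t \<omega>)) = (\<lambda>k. if k = N t \<omega> then F (X k \<omega>) else 0)"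
      by (auto simp: fun_eq_iff indicator_def)
    then show "F (Yp t \<omega>) = (\<Sum>k. F (X k \<omega>) * indicator {k} (N t \<omega>))"
      using sums_single[of "N t \<omega>" "\<lambda>k. F (X k \<omega>)"] by (simp add: sums_iff time_changed_def)
  qed
  also have "\<dots> = (\<Sum>k. \<integral>\<^sup>+\<omega>. F (X k \<omega>) * indicator {k} (N t \<omega>) \<partial>M)"
    by (rule nn_integral_suminf) measurable
  also have "\<dots> = (\<Sum>k. ennreal (pois t k) * (\<integral>\<^sup>+x. F x \<partial>law k))"
  proof (intro suminf_cong)
    fix k
    let ?D = "distr M (count_space UNIV) (N t)"
    interpret D: prob_space ?D by (rule prob_space_distr) simp
    have pair: "distr M (borel \<Otimes>\<^sub>M count_space UNIV) (\<lambda>\<omega>. (X k \<omega>, N t \<omega>)) = law k \<Otimes>\<^sub>M ?D"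
      using t by (intro distr_pair_gen[OF _ X_gen N_gen]) (auto simp: past_def)
    have [measurable]: "(\<lambda>w. indicator {k} (snd w) :: ennreal) \<in> borel_measurable ((borel :: 'a measure) \<Otimes>\<^sub>M count_space UNIV)"
      by (rule measurable_compose[OF measurable_snd]) simp
    have "(\<integral>\<^sup>+\<omega>. F (X k \<omega>) * indicator {k} (N t \<omega>) \<partial>M) =
        (\<integral>\<^sup>+w. F (fst w) * indicator {k} (snd w) \<partial>(law k \<Otimes>\<^sub>M ?D))"
      unfolding pair[symmetric] by (subst nn_integral_distr) auto
    also have "\<dots> = (\<integral>\<^sup>+x. \<integral>\<^sup>+j. F x * indicator {k} j \<partial>?D \<partial>law k)"
      by (subst D.nn_integral_fst[symmetric]) auto
    also have "\<dots> = (\<integral>\<^sup>+x. F x * ennreal (pois t k) \<partial>law k)"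
    proof (intro nn_integral_cong)
      fix x
      have "(\<integral>\<^sup>+j. F x * indicator {k} j \<partial>?D) = F x * emeasure ?D {k}"
        by (subst nn_integral_cmult_indicator) auto
      also have "emeasure ?D {k} = emeasure M {\<omega> \<in> space M. N t \<omega> = k}"
        by (subst emeasure_distr) (auto intro!: arg_cong[where f = "emeasure M"])
      finally show "(\<integral>\<^sup>+j. F x * indicator {k} j \<partial>?D) = F x * ennreal (pois t k)"
        by (simp add: emeasure_clock[OF t])
    qed
    also have "\<dots> = ennreal (pois t k) * (\<integral>\<^sup>+x. F x \<partial>law k)"
      by (subst nn_integral_multc) (auto simp: mult.commute)
    finally show "(\<integral>\<^sup>+\<omega>. F (X k \<omega>) * indicator {k} (N t \<omega>) \<partial>M) = ennreal (pois t k) * (\<integral>\<^sup>+x. F x \<partial>law k)" .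
  qed
  finally show ?thesis .
qed

lemma KL_Yp_le:
  assumes T: "0 < T"
  shows "KL (distr M borel (Yp T)) (gauss s) \<le>
    ennreal (\<eta>\<^sup>2 * (2 - lam * \<eta>) / (2 * \<sigma>\<^sup>2)) *
      (\<integral>\<^sup>+t\<in>{0..T}. ennreal (exp (- lam * \<eta> * (T - t))) *
         (\<integral>\<^sup>+(\<omega>, u). ennreal ((norm (g (Yp t \<omega>) u))\<^sup>2) \<partial>(M \<Otimes>\<^sub>M \<mu>U)) \<partial>lborel)
    + ennreal (exp (- lam * \<eta> * T)) * KL \<mu>0 (gauss s)"
proof -
  let ?\<pi> = "gauss s :: 'a measure"
  define a where "a = 1 - lam * \<eta>"
  have a: "0 < a" "a < 1" using param by (auto simp: a_def)
  have "a\<^sup>2 < 1" using a by (simp add: power_less_one_iff)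
  then have s: "s > 0" using param by (simp add: s_eq a_def)
  have Ca: "\<eta>\<^sup>2 * (2 - lam * \<eta>) / (2 * \<sigma>\<^sup>2) = \<eta>\<^sup>2 * (1 + a) / (2 * \<sigma>\<^sup>2)"
    by (simp add: a_def)
  define C where "C = ennreal (\<eta>\<^sup>2 * (1 + a) / (2 * \<sigma>\<^sup>2))"
  define G where "G x = (\<integral>\<^sup>+u. ennreal ((norm (g x u))\<^sup>2) \<partial>\<mu>U)" for x
  have [measurable]: "(\<lambda>w. ennreal ((norm (g (fst w) (snd w)))\<^sup>2)) \<in> borel_measurable (borel \<Otimes>\<^sub>M \<mu>U)"
    by measurable
  have Gm [measurable]: "G \<in> borel_measurable borel"
    unfolding G_def[abs_def] by measurable
  define H where "H k = (\<integral>\<^sup>+x. G x \<partial>law k)" for k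
  have H_eq: "H k = (\<integral>\<^sup>+(x, u). ennreal ((norm (g x u))\<^sup>2) \<partial>(law k \<Otimes>\<^sub>M \<mu>U))" for k
    unfolding H_def G_def
    by (subst U.nn_integral_fst[where f = "\<lambda>(x, u). ennreal ((norm (g x u))\<^sup>2)" and ?M1.0 = "law k", symmetric])
      (auto simp: case_prod_beta')
  define K where "K k = KL (law k) ?\<pi>" for k
  have K_rec: "K (Suc k) \<le> ennreal a * K k + C * H k" for k
  proof -
    have "K (Suc k) = KL (distr (law k \<Otimes>\<^sub>M (\<mu>U \<Otimes>\<^sub>M iso_gaussian 0 \<sigma>)) borel
        (\<lambda>(x, u, e). a *\<^sub>R x - \<eta> *\<^sub>R g x u + e)) ?\<pi>"
      unfolding K_def a_def by (simp only: law_Suc)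
    also have "\<dots> \<le> ennreal a * KL (law k) ?\<pi> + C * (\<integral>\<^sup>+(x, u). ennreal ((norm (g x u))\<^sup>2) \<partial>(law k \<Otimes>\<^sub>M \<mu>U))"
      unfolding C_def
      by (rule sgld_step_KL[OF prob_space_law _ U.prob_space_axioms a param(3) _ g]) (auto simp: s_eq a_def)
    finally show ?thesis by (simp add: K_def H_eq)
  qed
  define q where "q j = (\<integral>t. damped_pois a T j t * indicator {0..T} t \<partial>lborel)" for j
  have T0: "0 \<le> T" using T by simp
  note q_facts = pois_integral_nonneg[OF T0, of a, folded q_def] pois_integral_0[OF T0, of a, folded q_def]
    pois_integral_Suc[OF T0, of a, folded q_def] nn_integral_pois[OF T0, of a, folded q_def]
  \<comment> \<open>The gradient at step \<open>j\<close> first enters the entropy at step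
    \<open>Suc j\<close>, so its coefficient is \<open>Q (Suc j) = q j\<close>, while
    \<open>Q 0\<close> belongs to the initial law.\<close>
  define Q where "Q i = (case i of 0 \<Rightarrow> exp (- (1 - a) * T) | Suc j \<Rightarrow> q j)" for i
  have "KL (distr M borel (Yp T)) ?\<pi> \<le> (\<Sum>k. ennreal (pois T k) * K k)"
    unfolding K_def
  proof (rule KL_mixture_le)
    show "prob_space ?\<pi>" by (rule prob_space_iso_gaussian[OF s])
    show "prob_space (distr M borel (Yp T))" using T by (intro prob_space_distr) simp
    show "(\<integral>\<^sup>+x. F x \<partial>distr M borel (Yp T)) = (\<Sum>k. ennreal (pois T k) * (\<integral>\<^sup>+x. F x \<partial>law k))"
      if "F \<in> borel_measurable ?\<pi>" for F
      using that T by (subst nn_integral_distr) (auto simp: nn_integral_Yp)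
    show "(\<Sum>k. ennreal (pois T k)) = 1"
      by (rule suminf_pois[OF T0])
  qed (use T in \<open>auto simp: prob_space_law pois_nonneg\<close>)
  also have "\<dots> \<le> ennreal (Q 0) * K 0 + (\<Sum>k. ennreal (Q (Suc k)) * (C * H k))"
  proof (rule sum_recursion_le[where h = "\<lambda>k. C * H k" and a = a])
    show "K (Suc k) \<le> ennreal a * K k + C * H k" for k by (rule K_rec)
    show "Q k = pois T k + a * Q (Suc k)" for k
    proof (cases k)
      case 0
      then show ?thesis using q_facts(2) by (simp add: Q_def)
    next
      case (Suc j)
      then show ?thesis using q_facts(3)[of j] by (simp add: Q_def)
    qed
    show "0 \<le> Q k" for k using q_facts(1) by (cases k) (simp_all add: Q_def)
  qed (use a T in \<open>auto simp: pois_nonneg\<close>)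
  also have "(\<Sum>k. ennreal (Q (Suc k)) * (C * H k)) = C * (\<Sum>k. ennreal (q k) * H k)"
    by (subst ennreal_suminf_cmult[symmetric]) (simp add: Q_def mult_ac)
  also have "(\<Sum>k. ennreal (q k) * H k) =
      (\<Sum>k. \<integral>\<^sup>+t. H k * (ennreal (damped_pois a T k t) * indicator {0..T} t) \<partial>lborel)"
    unfolding q_facts(4)[symmetric] pois_def by (subst nn_integral_cmult) (auto simp: mult.commute)
  also have "\<dots> = (\<integral>\<^sup>+t. (\<Sum>k. H k * (ennreal (damped_pois a T k t) * indicator {0..T} t)) \<partial>lborel)"
    unfolding pois_def by (rule nn_integral_suminf[symmetric]) measurable
  also have "\<dots> = (\<integral>\<^sup>+t\<in>{0..T}. ennreal (exp (- lam * \<eta> * (T - t))) *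
         (\<integral>\<^sup>+(\<omega>, u). ennreal ((norm (g (Yp t \<omega>) u))\<^sup>2) \<partial>(M \<Otimes>\<^sub>M \<mu>U)) \<partial>lborel)"
  proof (intro nn_integral_cong_AE)
    \<comment> \<open>The mixture formula is available for positive times; the time 0 is a null
      set.\<close>
    have "AE t in lborel. t \<noteq> (0::real)" by (rule AE_lborel_singleton)
    then show "AE t in lborel. (\<Sum>k. H k * (ennreal (damped_pois a T k t) * indicator {0..T} t)) =
        ennreal (exp (- lam * \<eta> * (T - t))) *
         (\<integral>\<^sup>+(\<omega>, u). ennreal ((norm (g (Yp t \<omega>) u))\<^sup>2) \<partial>(M \<Otimes>\<^sub>M \<mu>U)) * indicator {0..T} t"
    proof eventually_elim
      case (elim t)
      show ?case
      proof (cases "t \<in> {0..T}")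
        case True
        with elim have t: "0 < t" by simp
        have [measurable]: "Yp t \<in> borel_measurable M" using t by simp
        have "(\<integral>\<^sup>+(\<omega>, u). ennreal ((norm (g (Yp t \<omega>) u))\<^sup>2) \<partial>(M \<Otimes>\<^sub>M \<mu>U)) = (\<integral>\<^sup>+\<omega>. G (Yp t \<omega>) \<partial>M)"
          unfolding G_def
          by (subst U.nn_integral_fst[where f = "\<lambda>(\<omega>, u). ennreal ((norm (g (Yp t \<omega>) u))\<^sup>2)" and ?M1.0 = M, symmetric])
            (auto simp: case_prod_beta')
        also have "\<dots> = (\<Sum>k. ennreal (pois t k) * H k)"
          unfolding H_def by (rule nn_integral_Yp[OF t]) simp
        finally have "ennreal (exp (- lam * \<eta> * (T - t))) *
            (\<integral>\<^sup>+(\<omega>, u). ennreal ((norm (g (Yp t \<omega>) u))\<^sup>2) \<partial>(M \<Otimes>\<^sub>M \<mu>U)) =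
            (\<Sum>k. ennreal (exp (- lam * \<eta> * (T - t))) * (ennreal (pois t k) * H k))"
          by (simp add: ennreal_suminf_cmult)
        also have "\<dots> = (\<Sum>k. H k * ennreal (damped_pois a T k t))"
          using t by (intro suminf_cong) (simp add: a_def ennreal_mult pois_nonneg mult_ac)
        finally show ?thesis using True by simp
      qed simp
    qed
  qed
  finally show ?thesis
    unfolding Ca by (simp add: Q_def K_def C_def X0_law a_def add.commute)
qed

text \<open>\<open>pois T (Suc k)\<close> is \<open>T / Suc k\<close> times \<open>pois T k\<close>,
  and \<open>law (Suc k)\<close> is the image of \<open>law k\<close>. So the terms of positive
  index are at most \<open>T\<close> times those for the image of the law at time
  \<open>T\<close>.\<close>

lemma nn_integral_Yp_le:
  assumes T: "0 < T" and F [measurable]: "F \<in> borel_measurable borel"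
  shows "(\<integral>\<^sup>+\<omega>. F (Yp T \<omega>) \<partial>M) \<le> (\<integral>\<^sup>+x. F x \<partial>\<mu>0) +
    ennreal T * (\<integral>\<^sup>+x. F x \<partial>bind (distr M borel (Yp T)) kernel)"
proof -
  have km: "kernel \<in> borel \<rightarrow>\<^sub>M subprob_algebra borel"
    by (rule kernel_measurable) simp
  define I where "I k = (\<integral>\<^sup>+x. F x \<partial>law k)" for k
  define J where "J x = (\<integral>\<^sup>+y. F y \<partial>kernel x)" for x
  have [measurable]: "J \<in> borel_measurable borel"
    unfolding J_def[abs_def]
    by (rule measurable_compose[OF km nn_integral_measurable_subprob_algebra]) simp
  have "(\<integral>\<^sup>+x. F x \<partial>bind (distr M borel (Yp T)) kernel) = (\<integral>\<^sup>+x. J x \<partial>distr M borel (Yp T))"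
    unfolding J_def using km by (intro nn_integral_bind) auto
  also have "\<dots> = (\<Sum>k. ennreal (pois T k) * (\<integral>\<^sup>+x. J x \<partial>law k))"
    using T by (subst nn_integral_distr) (auto simp: nn_integral_Yp)
  also have "\<dots> = (\<Sum>k. ennreal (pois T k) * I (Suc k))"
  proof -
    have "(\<integral>\<^sup>+x. J x \<partial>law k) = I (Suc k)" for k
      unfolding J_def I_def law_Suc_bind using km by (intro nn_integral_bind[symmetric]) auto
    then show ?thesis by simp
  qed
  finally have b: "(\<integral>\<^sup>+x. F x \<partial>bind (distr M borel (Yp T)) kernel) = (\<Sum>k. ennreal (pois T k) * I (Suc k))" .
  have "(\<integral>\<^sup>+\<omega>. F (Yp T \<omega>) \<partial>M) = (\<Sum>k. ennreal (pois T k) * I k)"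
    unfolding I_def by (rule nn_integral_Yp[OF T F])
  also have "\<dots> = ennreal (pois T 0) * I 0 + (\<Sum>k. ennreal (pois T (Suc k)) * I (Suc k))"
    by (subst suminf_offset[where i = 1]) (auto simp: add.commute)
  also have "\<dots> \<le> 1 * I 0 + (\<Sum>k. ennreal T * (ennreal (pois T k) * I (Suc k)))"
  proof (intro add_mono mult_right_mono suminf_le)
    show "ennreal (pois T 0) \<le> 1"
      using T by (simp add: pois_def flip: ennreal_1)
    show "ennreal (pois T (Suc k)) * I (Suc k) \<le> ennreal T * (ennreal (pois T k) * I (Suc k))" for k
    proof -
      have "T ^ k * T / (fact k * real (Suc k)) \<le> T ^ k * T / (fact k * 1)"
        using T by (intro divide_left_mono mult_left_mono) auto
      then have "T ^ k * T / (fact k * real (Suc k)) * exp (- T) \<le> T ^ k * T / (fact k * 1) * exp (- T)"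
        by (rule mult_right_mono) simp
      then have "pois T (Suc k) \<le> T * pois T k"
        unfolding pois_def by (simp add: mult_ac)
      then have "ennreal (pois T (Suc k)) \<le> ennreal T * ennreal (pois T k)"
        using T by (simp add: ennreal_mult[symmetric] pois_nonneg ennreal_leI)
      then show ?thesis
        unfolding mult.assoc[symmetric] by (rule mult_right_mono) simp
    qed
  qed auto
  also have "\<dots> = (\<integral>\<^sup>+x. F x \<partial>\<mu>0) + ennreal T * (\<Sum>k. ennreal (pois T k) * I (Suc k))"
    by (simp add: I_def X0_law)
  finally show ?thesis unfolding b .
qed

text \<open>(H.1) propagates absolute continuity along the chain, and a mixture inherits it.\<close>

lemma absolutely_continuous_Yp:
  assumes T: "0 < T" and ac0: "absolutely_continuous (gauss s) \<mu>0"
    and H1: "\<And>\<mu>. prob_space \<mu> \<Longrightarrow> sets \<mu> = sets borel \<Longrightarrow> absolutely_continuous (gauss s) \<mu> \<Longrightarrow>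
      absolutely_continuous (gauss s) (bind \<mu> kernel)"
  shows "absolutely_continuous (gauss s) (distr M borel (Yp T))"
proof -
  let ?\<pi> = "gauss s :: 'a measure"
  have ac: "absolutely_continuous ?\<pi> (law k)" for k
  proof (induction k)
    case 0
    show ?case using ac0 by (simp add: X0_law)
  next
    case (Suc k)
    show ?case unfolding law_Suc_bind using prob_space_law Suc by (intro H1) auto
  qed
  show ?thesis
    unfolding absolutely_continuous_def
  proof (intro subsetI)
    fix A assume A: "A \<in> null_sets ?\<pi>"
    then have [measurable]: "A \<in> sets borel" by auto
    have z: "emeasure (law k) A = 0" for k
      using ac[of k] A unfolding absolutely_continuous_def by auto
    have Ym: "Yp T \<in> borel_measurable M" using T by simp
    have "emeasure (distr M borel (Yp T)) A = (\<integral>\<^sup>+x. indicator A x \<partial>distr M borel (Yp T))"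
      by simp
    also have "\<dots> = (\<integral>\<^sup>+\<omega>. indicator A (Yp T \<omega>) \<partial>M)"
      by (rule nn_integral_distr[OF Ym]) simp
    also have "\<dots> = 0"
      by (subst nn_integral_Yp[OF T]) (auto simp: z simp del: emeasure_distr)
    finally show "A \<in> null_sets (distr M borel (Yp T))"
      by (simp add: null_sets_def)
  qed
qed

text \<open>(H.2) concerns the law at time \<open>T\<close> after one more kernel step, so
  finiteness is obtained for that image; \<open>nn_integral_Yp_le\<close> links it to the law at
  time \<open>T\<close> itself.\<close>

lemma KL_bind_Yp_finite:
  assumes T: "0 < T" and ac0: "absolutely_continuous (gauss s) \<mu>0"
    and H1: "\<And>\<mu>. prob_space \<mu> \<Longrightarrow> sets \<mu> = sets borel \<Longrightarrow> absolutely_continuous (gauss s) \<mu> \<Longrightarrow>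
      absolutely_continuous (gauss s) (bind \<mu> kernel)"
    and H2: "integrable (gauss s)
      (\<lambda>x. Phi (dual_op (gauss s) kernel (rdens (gauss s) (distr M borel (Yp T))) x))"
  shows "KL (bind (distr M borel (Yp T)) kernel) (gauss s) < \<infinity>"
    and "prob_space (bind (distr M borel (Yp T)) kernel)"
    and "sets (bind (distr M borel (Yp T)) kernel) = sets borel"
proof -
  let ?\<pi> = "gauss s :: 'a measure" and ?\<rho> = "distr M borel (Yp T)"
  have "(1 - lam * \<eta>)\<^sup>2 < 1" using param by (simp add: power_less_one_iff)
  then have s: "s > 0" using param by (simp add: s_eq)
  have P: "prob_space ?\<pi>" by (rule prob_space_iso_gaussian[OF s])
  have \<rho>: "prob_space ?\<rho>" using T by (intro prob_space_distr) simp
  have ac: "absolutely_continuous ?\<pi> ?\<rho>"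
    by (rule absolutely_continuous_Yp[OF T ac0 H1])
  let ?b = "bind ?\<rho> kernel"
  have bk: "?b = distr (?\<rho> \<Otimes>\<^sub>M (\<mu>U \<Otimes>\<^sub>M iso_gaussian 0 \<sigma>)) borel sgld_step"
    by (rule bind_kernel[OF \<rho>]) simp
  show sb: "sets ?b = sets borel" unfolding bk by simp
  interpret \<rho>: prob_space ?\<rho> by fact
  interpret E: prob_space "iso_gaussian (0::'a) \<sigma>" by (rule prob_space_iso_gaussian[OF param(3)])
  interpret UE: pair_prob_space \<mu>U "iso_gaussian (0::'a) \<sigma>" ..
  interpret \<rho>UE: pair_prob_space ?\<rho> "\<mu>U \<Otimes>\<^sub>M iso_gaussian (0::'a) \<sigma>" ..
  show b: "prob_space ?b"
    unfolding bk by (rule \<rho>UE.prob_space_distr) (simp add: case_prod_beta')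
  have acb: "absolutely_continuous ?\<pi> ?b"
    by (rule H1[OF \<rho> _ ac]) simp
  have sb\<pi>: "sets ?b = sets ?\<pi>" by (simp add: sb)
  let ?f = "rdens ?\<pi> ?b"
  have "density ?\<pi> (\<lambda>x. ennreal (rdens ?\<pi> ?\<rho> x)) = ?\<rho>"
    by (rule density_rdens[OF P \<rho> _ ac]) simp
  then have "integrable ?\<pi> (\<lambda>x. Phi (?f x))"
    using H2 by (simp add: dual_op_def)
  moreover have "Phi y = y * ln y" for y by (simp add: Phi_def)
  ultimately have i: "integrable ?\<pi> (\<lambda>x. ?f x * ln (?f x))" by simp
  have "prob_space (density ?\<pi> (\<lambda>x. ennreal (?f x)))"
    using b density_rdens[OF P b sb\<pi> acb] by simp
  then have "integrable ?\<pi> ?f"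
    by (rule integrable_prob_density) (auto simp: rdens_nonneg)
  with i have "integrable ?\<pi> (\<lambda>x. ent_fun (?f x))"
    using integrable_ent_fun_iff[OF P] by blast
  then show "KL ?b ?\<pi> < \<infinity>"
    unfolding KL_eq_rdens[OF P b sb\<pi> acb]
    by (subst nn_integral_eq_integral) (auto simp: ent_fun_nonneg rdens_nonneg)
qed

end

section \<open>The PAC-Bayesian bound\<close>

lemma nn_integral_normal_mgf:
  assumes \<tau>: "\<tau> > 0"
  shows "(\<integral>\<^sup>+y. ennreal (normal_density 0 \<tau> y * exp (y * x)) \<partial>lborel) = ennreal (exp (\<tau>\<^sup>2 * x\<^sup>2 / 2))"
proof -
  have e: "normal_density 0 \<tau> y * exp (y * x) = exp (\<tau>\<^sup>2 * x\<^sup>2 / 2) * normal_density (\<tau>\<^sup>2 * x) \<tau> y" for y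
  proof -
    have "- (y - 0)\<^sup>2 / (2 * \<tau>\<^sup>2) + y * x = \<tau>\<^sup>2 * x\<^sup>2 / 2 + - (y - \<tau>\<^sup>2 * x)\<^sup>2 / (2 * \<tau>\<^sup>2)"
      using \<tau> by (simp add: field_simps power2_eq_square)
    then show ?thesis
      unfolding normal_density_def by (simp add: exp_add[symmetric] del: diff_zero)
  qed
  have "(\<integral>\<^sup>+y. ennreal (normal_density 0 \<tau> y * exp (y * x)) \<partial>lborel) =
      ennreal (exp (\<tau>\<^sup>2 * x\<^sup>2 / 2)) * (\<integral>\<^sup>+y. ennreal (normal_density (\<tau>\<^sup>2 * x) \<tau> y) \<partial>lborel)"
    unfolding e by (subst nn_integral_cmult[symmetric]) (auto simp: ennreal_mult)
  also have "(\<integral>\<^sup>+y. ennreal (normal_density (\<tau>\<^sup>2 * x) \<tau> y) \<partial>lborel) = 1"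
    using \<tau> by (subst nn_integral_eq_integral) auto
  finally show ?thesis by simp
qed

text \<open>The extra factor halves the quadratic coefficient, which gives \<open>sqrt 2\<close>
  times a normal density of variance \<open>2 * \<tau>\<^sup>2\<close>.\<close>

lemma nn_integral_normal_exp_square:
  assumes \<tau>: "\<tau> > 0"
  shows "(\<integral>\<^sup>+y. ennreal (normal_density 0 \<tau> y * exp (y\<^sup>2 / (4 * \<tau>\<^sup>2))) \<partial>lborel) = ennreal (sqrt 2)"
proof -
  have e: "normal_density 0 \<tau> y * exp (y\<^sup>2 / (4 * \<tau>\<^sup>2)) = sqrt 2 * normal_density 0 (sqrt 2 * \<tau>) y" for y
  proof -
    have x: "- y\<^sup>2 / (2 * \<tau>\<^sup>2) + y\<^sup>2 / (4 * \<tau>\<^sup>2) = - y\<^sup>2 / (2 * (sqrt 2 * \<tau>)\<^sup>2)"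
      using \<tau> by (simp add: field_simps)
    have "sqrt (2 * pi * (sqrt 2 * \<tau>)\<^sup>2) = sqrt 2 * sqrt (2 * pi * \<tau>\<^sup>2)"
      using \<tau> by (simp add: power_mult_distrib real_sqrt_mult)
    then have c: "1 / sqrt (2 * pi * \<tau>\<^sup>2) = sqrt 2 * (1 / sqrt (2 * pi * (sqrt 2 * \<tau>)\<^sup>2))"
      by simp
    have "normal_density 0 \<tau> y * exp (y\<^sup>2 / (4 * \<tau>\<^sup>2)) =
        1 / sqrt (2 * pi * \<tau>\<^sup>2) * exp (- y\<^sup>2 / (2 * \<tau>\<^sup>2) + y\<^sup>2 / (4 * \<tau>\<^sup>2))"
      by (simp only: normal_density_def exp_add diff_zero mult.assoc)
    also have "\<dots> = sqrt 2 * (1 / sqrt (2 * pi * (sqrt 2 * \<tau>)\<^sup>2)) * exp (- y\<^sup>2 / (2 * (sqrt 2 * \<tau>)\<^sup>2))"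
      by (simp only: c x)
    finally show ?thesis by (simp add: normal_density_def)
  qed
  have "(\<integral>\<^sup>+y. ennreal (normal_density 0 \<tau> y * exp (y\<^sup>2 / (4 * \<tau>\<^sup>2))) \<partial>lborel) =
      ennreal (sqrt 2) * (\<integral>\<^sup>+y. ennreal (normal_density 0 (sqrt 2 * \<tau>) y) \<partial>lborel)"
    unfolding e by (subst nn_integral_cmult[symmetric]) (auto simp: ennreal_mult)
  also have "(\<integral>\<^sup>+y. ennreal (normal_density 0 (sqrt 2 * \<tau>) y) \<partial>lborel) = 1"
    using \<tau> by (subst nn_integral_eq_integral) auto
  finally show ?thesis by simp
qed

text \<open>Despite the name, tail control comes from subgaussianity; the loss itself may be
  unbounded.\<close>

locale bounded_risk = Z: prob_space \<mu>z for \<mu>z :: "'z measure" +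
  fixes l :: "'a::euclidean_space \<Rightarrow> 'z \<Rightarrow> real" and Sig :: real and n :: nat
  assumes l: "(\<lambda>(w, z). l w z) \<in> borel_measurable (borel \<Otimes>\<^sub>M \<mu>z)"
    and subg: "subgaussian_loss \<mu>z Sig l" and n: "n \<ge> 1"
begin

lemma l_compose_measurable [measurable (raw)]:
  assumes "f \<in> borel_measurable R" "h \<in> R \<rightarrow>\<^sub>M \<mu>z"
  shows "(\<lambda>x. l (f x) (h x)) \<in> borel_measurable R"
  using measurable_compose[OF measurable_Pair[OF assms] l] by simp

lemma risk_measurable [measurable]: "risk \<mu>z l \<in> borel_measurable borel"
proof -
  have [measurable]: "(\<lambda>p. l (fst p) (snd p)) \<in> borel_measurable (borel \<Otimes>\<^sub>M \<mu>z)"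
    by measurable
  show ?thesis unfolding risk_def[abs_def] by measurable
qed

abbreviation gap :: "(nat \<Rightarrow> 'z) \<Rightarrow> 'a \<Rightarrow> real" where "gap \<equiv> gen_gap \<mu>z n l"

lemma gap_measurable [measurable (raw)]:
  assumes [measurable]: "f \<in> R \<rightarrow>\<^sub>M samples n \<mu>z" "h \<in> borel_measurable R"
  shows "(\<lambda>x. gap (f x) (h x)) \<in> borel_measurable R"
  unfolding gen_gap_def emp_risk_def by measurable

abbreviation sample_space ("\<SS>") where "\<SS> \<equiv> samples n \<mu>z"

sublocale S: prob_space "samples n \<mu>z"
  by (rule prob_space_PiM) (rule Z.prob_space_axioms)

text \<open>Each coordinate of the sample enters with coefficient \<open>- t / n\<close>, where the
  sign brings in the lower tail of the loss. By independence the \<open>n\<close> variance proxies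
  \<open>Sig\<^sup>2 / n\<^sup>2\<close> add up to \<open>Sig\<^sup>2 / n\<close>.\<close>

lemma gap_subgaussian:
  "(\<integral>\<^sup>+S. ennreal (exp (t * gap S w)) \<partial>\<SS>) \<le> ennreal (exp (t\<^sup>2 * Sig\<^sup>2 / (2 * real n)))"
proof -
  interpret product_sigma_finite "\<lambda>_::nat. \<mu>z" ..
  define c where "c = - t / real n"
  have gap_eq: "t * gap S w = (\<Sum>i<n. c * (l w (S i) - risk \<mu>z l w))" for S
  proof -
    have "(\<Sum>i<n. c * (l w (S i) - risk \<mu>z l w)) = c * ((\<Sum>i<n. l w (S i)) - real n * risk \<mu>z l w)"
      by (simp add: sum_distrib_left[symmetric] sum_subtractf)
    then show ?thesis
      using n by (simp add: gen_gap_def emp_risk_def c_def field_simps)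
  qed
  have "(\<integral>\<^sup>+S. ennreal (exp (t * gap S w)) \<partial>\<SS>) =
      (\<integral>\<^sup>+S. (\<Prod>i<n. ennreal (exp (c * (l w (S i) - risk \<mu>z l w)))) \<partial>\<SS>)"
    unfolding gap_eq by (simp add: exp_sum prod_ennreal)
  also have "\<dots> = (\<Prod>i<n. \<integral>\<^sup>+z. ennreal (exp (c * (l w z - risk \<mu>z l w))) \<partial>\<mu>z)"
    by (rule product_nn_integral_prod) auto
  also have "\<dots> \<le> (\<Prod>i<n. ennreal (exp (c\<^sup>2 * Sig\<^sup>2 / 2)))"
  proof -
    have mono: "x ^ k \<le> y ^ k" if "x \<le> y" for x y :: ennreal and k :: nat
      using that by (induction k) (auto intro!: mult_mono)
    show ?thesis
      using subg by (simp add: mono subgaussian_loss_def)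
  qed
  also have "\<dots> = ennreal (exp (c\<^sup>2 * Sig\<^sup>2 / 2) ^ n)"
    by (simp add: ennreal_power)
  also have "exp (c\<^sup>2 * Sig\<^sup>2 / 2) ^ n = exp (t\<^sup>2 * Sig\<^sup>2 / (2 * real n))"
    using n unfolding exp_of_nat_mult[symmetric]
    by (simp add: c_def power_divide power2_eq_square)
  finally show ?thesis .
qed

text \<open>\<open>exp (n x\<^sup>2 / (4 Sig\<^sup>2))\<close> is a Gaussian mixture of the exponentials \<open>exp (y x)\<close>.\<close>

lemma gap_exp_square:
  assumes Sig: "Sig > 0"
  shows "(\<integral>\<^sup>+S. ennreal (exp (real n / (4 * Sig\<^sup>2) * (gap S w)\<^sup>2)) \<partial>\<SS>) \<le> ennreal (sqrt 2)"
proof -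
  interpret LS: pair_sigma_finite "\<SS>" lborel ..
  \<comment> \<open>This value does two things at once: the mixture of \<open>exp (y x)\<close>
    gives the desired coefficient \<open>n / (4 * Sig\<^sup>2)\<close>, and the subgaussian bound
    becomes \<open>exp (y\<^sup>2 / (4 * \<tau>\<^sup>2))\<close>, still integrable against the
    normal density.\<close>
  define \<tau> where "\<tau> = sqrt (real n / 2) / Sig"
  have \<tau>: "\<tau> > 0" using Sig n by (simp add: \<tau>_def)
  have \<tau>2: "\<tau>\<^sup>2 = real n / (2 * Sig\<^sup>2)"
    using n by (simp add: \<tau>_def power_divide)
  have "(\<integral>\<^sup>+S. ennreal (exp (real n / (4 * Sig\<^sup>2) * (gap S w)\<^sup>2)) \<partial>\<SS>) =
      (\<integral>\<^sup>+S. ennreal (exp (\<tau>\<^sup>2 * (gap S w)\<^sup>2 / 2)) \<partial>\<SS>)"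
    by (simp add: \<tau>2)
  also have "\<dots> = (\<integral>\<^sup>+S. \<integral>\<^sup>+y. ennreal (normal_density 0 \<tau> y * exp (y * gap S w)) \<partial>lborel \<partial>\<SS>)"
    by (simp add: nn_integral_normal_mgf[OF \<tau>])
  also have "\<dots> = (\<integral>\<^sup>+y. \<integral>\<^sup>+S. ennreal (normal_density 0 \<tau> y * exp (y * gap S w)) \<partial>\<SS> \<partial>lborel)"
    by (rule LS.Fubini'[symmetric]) measurable
  also have "\<dots> = (\<integral>\<^sup>+y. ennreal (normal_density 0 \<tau> y) * (\<integral>\<^sup>+S. ennreal (exp (y * gap S w)) \<partial>\<SS>) \<partial>lborel)"
    by (subst nn_integral_cmult[symmetric]) (auto simp: ennreal_mult)
  also have "\<dots> \<le> (\<integral>\<^sup>+y. ennreal (normal_density 0 \<tau> y) * ennreal (exp (y\<^sup>2 * Sig\<^sup>2 / (2 * real n))) \<partial>lborel)"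
    by (intro nn_integral_mono mult_left_mono gap_subgaussian) auto
  also have "\<dots> = (\<integral>\<^sup>+y. ennreal (normal_density 0 \<tau> y * exp (y\<^sup>2 / (4 * \<tau>\<^sup>2))) \<partial>lborel)"
  proof -
    have "y\<^sup>2 * Sig\<^sup>2 / (2 * real n) = y\<^sup>2 / (4 * \<tau>\<^sup>2)" for y
      using Sig n by (simp add: \<tau>2 field_simps)
    then show ?thesis by (simp add: ennreal_mult)
  qed
  also have "\<dots> = ennreal (sqrt 2)"
    by (rule nn_integral_normal_exp_square[OF \<tau>])
  finally show ?thesis .
qed

text \<open>The average is over a law \<open>P\<close> that does not depend on the sample, so Fubini
  and Markov's inequality apply. No time occurs in it, hence one set of samples serves all
  \<open>T\<close>. At level \<open>3 / \<zeta>\<close> the failure probability is at most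
  \<open>\<zeta> * sqrt 2 / 3\<close>.\<close>

lemma gap_exp_square_set:
  fixes P :: "'a measure"
  assumes Sig: "Sig > 0" and P: "prob_space P" and [measurable_cong]: "sets P = sets borel"
    and \<zeta>: "0 < \<zeta>" "\<zeta> < 1"
  shows "\<exists>A\<in>sets (\<SS>). measure (\<SS>) A \<ge> 1 - \<zeta> \<and>
    (\<forall>S\<in>A. (\<integral>\<^sup>+w. ennreal (exp (real n / (4 * Sig\<^sup>2) * (gap S w)\<^sup>2)) \<partial>P) \<le> ennreal (3 / \<zeta>))"
proof -
  interpret P: prob_space P by fact
  interpret SP: pair_sigma_finite "\<SS>" P ..
  define V where "V S = (\<integral>\<^sup>+w. ennreal (exp (real n / (4 * Sig\<^sup>2) * (gap S w)\<^sup>2)) \<partial>P)" for S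
  have [measurable]: "V \<in> borel_measurable (\<SS>)"
    unfolding V_def[abs_def] by measurable
  have "(\<integral>\<^sup>+S. V S \<partial>\<SS>) =
      (\<integral>\<^sup>+w. \<integral>\<^sup>+S. ennreal (exp (real n / (4 * Sig\<^sup>2) * (gap S w)\<^sup>2)) \<partial>\<SS> \<partial>P)"
    unfolding V_def by (rule SP.Fubini'[symmetric]) measurable
  also have "\<dots> \<le> (\<integral>\<^sup>+w. ennreal (sqrt 2) \<partial>P)"
    by (intro nn_integral_mono gap_exp_square[OF Sig])
  also have "\<dots> = ennreal (sqrt 2)" by (simp add: P.emeasure_space_1)
  finally have EV: "(\<integral>\<^sup>+S. V S \<partial>\<SS>) \<le> ennreal (sqrt 2)" .
  define A where "A = {S \<in> space (\<SS>). V S \<le> ennreal (3 / \<zeta>)}"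
  have A [measurable]: "A \<in> sets (\<SS>)" unfolding A_def by measurable
  have "space (\<SS>) - A \<subseteq> {S \<in> space (\<SS>). 1 \<le> ennreal (\<zeta> / 3) * V S}"
  proof
    fix S assume "S \<in> space (\<SS>) - A"
    then have S: "S \<in> space (\<SS>)" "ennreal (3 / \<zeta>) \<le> V S" by (auto simp: A_def)
    have "1 = ennreal (\<zeta> / 3) * ennreal (3 / \<zeta>)"
      using \<zeta> by (subst ennreal_mult[symmetric]) auto
    also have "\<dots> \<le> ennreal (\<zeta> / 3) * V S"
      using S by (intro mult_left_mono) auto
    finally show "S \<in> {S \<in> space (\<SS>). 1 \<le> ennreal (\<zeta> / 3) * V S}" using S by simp
  qed
  then have "emeasure (\<SS>) (space (\<SS>) - A) \<le>
      emeasure (\<SS>) {S \<in> space (\<SS>). 1 \<le> ennreal (\<zeta> / 3) * V S}"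
    by (rule emeasure_mono) measurable
  also have "\<dots> \<le> ennreal (\<zeta> / 3) * (\<integral>\<^sup>+S. V S * indicator (space (\<SS>)) S \<partial>\<SS>)"
    by (rule nn_integral_Markov_inequality) auto
  also have "\<dots> = ennreal (\<zeta> / 3) * (\<integral>\<^sup>+S. V S \<partial>\<SS>)"
    by (intro arg_cong2[where f = "(*)"] refl nn_integral_cong) simp
  also have "\<dots> \<le> ennreal (\<zeta> / 3) * ennreal (sqrt 2)"
    by (intro mult_left_mono EV) auto
  also have "\<dots> = ennreal (\<zeta> * (sqrt 2 / 3))"
    using \<zeta> by (subst ennreal_mult[symmetric]) auto
  also have "\<dots> \<le> ennreal \<zeta>"
  proof -
    have "sqrt 2 / 3 \<le> 1" using real_sqrt_le_mono[of 2 9] by simp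
    then show ?thesis using \<zeta> by (intro ennreal_leI) (simp add: mult_left_le)
  qed
  finally have "measure (\<SS>) (space (\<SS>) - A) \<le> \<zeta>"
    using \<zeta> by (simp add: S.emeasure_eq_measure)
  then have "1 - \<zeta> \<le> measure (\<SS>) A"
    using S.prob_compl[OF A] by linarith
  then show ?thesis
    using A by (intro bexI[of _ A]) (auto simp: A_def V_def)
qed

text \<open>For \<open>Sig = 0\<close> the coefficient \<open>n / (4 * Sig\<^sup>2)\<close> is
  meaningless. Instead, \<open>h x = exp x + exp (- x) - 2\<close> is nonnegative and vanishes only
  at 0; both exponential moments of the gap are at most 1, so the mean of \<open>h\<close> is
  0.\<close>

lemma gap_zero_set:
  fixes P :: "'a measure"
  assumes Sig: "Sig = 0" and P: "prob_space P" and [measurable_cong]: "sets P = sets borel"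
  shows "\<exists>A\<in>sets (\<SS>). measure (\<SS>) A = 1 \<and> (\<forall>S\<in>A. AE w in P. gap S w = 0)"
proof -
  interpret P: prob_space P by fact
  interpret SP: pair_sigma_finite "\<SS>" P ..
  define h :: "real \<Rightarrow> real" where "h x = (exp (x / 2) - exp (- x / 2))\<^sup>2" for x
  have h [measurable]: "h \<in> borel_measurable borel" unfolding h_def by measurable
  have h_eq: "exp x + exp (- x) = 2 + h x" for x
  proof -
    have "exp (x / 2) * exp (x / 2) = exp x" "exp (- x / 2) * exp (- x / 2) = exp (- x)"
      "exp (x / 2) * exp (- x / 2) = 1"
      by (simp_all add: exp_add[symmetric])
    then show ?thesis by (simp add: h_def power2_eq_square algebra_simps)
  qed
  have h0: "0 \<le> h x" "h x = 0 \<longleftrightarrow> x = 0" for x by (auto simp: h_def)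
  have z: "(\<integral>\<^sup>+S. ennreal (h (gap S w)) \<partial>\<SS>) = 0" for w
  proof -
    have "2 + (\<integral>\<^sup>+S. ennreal (h (gap S w)) \<partial>\<SS>) = (\<integral>\<^sup>+S. 2 + ennreal (h (gap S w)) \<partial>\<SS>)"
      by (subst nn_integral_add) (auto simp: S.emeasure_space_1)
    also have "\<dots> = (\<integral>\<^sup>+S. ennreal (exp (1 * gap S w)) + ennreal (exp (- 1 * gap S w)) \<partial>\<SS>)"
    proof (intro nn_integral_cong)
      fix S
      have "2 + ennreal (h (gap S w)) = ennreal (2 + h (gap S w))"
        using h0 by (subst ennreal_plus) auto
      also have "\<dots> = ennreal (exp (1 * gap S w)) + ennreal (exp (- 1 * gap S w))"
        by (subst ennreal_plus[symmetric]) (auto simp: h_eq)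
      finally show "2 + ennreal (h (gap S w)) = ennreal (exp (1 * gap S w)) + ennreal (exp (- 1 * gap S w))" .
    qed
    also have "\<dots> = (\<integral>\<^sup>+S. ennreal (exp (1 * gap S w)) \<partial>\<SS>) +
        (\<integral>\<^sup>+S. ennreal (exp (- 1 * gap S w)) \<partial>\<SS>)"
      by (rule nn_integral_add) measurable
    also have "\<dots> \<le> ennreal (exp (1\<^sup>2 * Sig\<^sup>2 / (2 * real n))) + ennreal (exp ((- 1)\<^sup>2 * Sig\<^sup>2 / (2 * real n)))"
      by (intro add_mono gap_subgaussian)
    also have "\<dots> = 2 + 0" by (simp add: Sig)
    finally have "(\<integral>\<^sup>+S. ennreal (h (gap S w)) \<partial>\<SS>) \<le> 0"
      by (subst (asm) ennreal_add_left_cancel_le) auto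
    then show ?thesis by simp
  qed
  define V where "V S = (\<integral>\<^sup>+w. ennreal (h (gap S w)) \<partial>P)" for S
  have [measurable]: "V \<in> borel_measurable (\<SS>)"
    unfolding V_def[abs_def] by measurable
  have "(\<integral>\<^sup>+S. V S \<partial>\<SS>) = (\<integral>\<^sup>+w. \<integral>\<^sup>+S. ennreal (h (gap S w)) \<partial>\<SS> \<partial>P)"
    unfolding V_def by (rule SP.Fubini'[symmetric]) measurable
  then have "AE S in \<SS>. V S = 0"
    by (subst nn_integral_0_iff_AE[symmetric]) (auto simp: z)
  then have "measure (\<SS>) {S \<in> space (\<SS>). V S = 0} = 1"
    by (subst S.prob_Collect_eq_1) auto
  moreover have "AE w in P. gap S w = 0" if "S \<in> space (\<SS>)" "V S = 0" for S
  proof -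
    have "AE w in P. ennreal (h (gap S w)) = 0"
      using that unfolding V_def by (subst (asm) nn_integral_0_iff_AE) auto
    then show ?thesis
      using h0 by (auto elim!: eventually_mono simp: ennreal_eq_0_iff order_antisym_conv)
  qed
  ultimately show ?thesis
    by (intro bexI[of _ "{S \<in> space (\<SS>). V S = 0}"]) auto
qed

end

text \<open>Truncation at \<open>m\<close> makes the test function bounded without increasing its
  exponential moment; Fatou's lemma removes it.\<close>

lemma nn_integral_le_KL:
  fixes f :: "'a \<Rightarrow> real"
  assumes P: "prob_space P" and \<rho>: "prob_space \<rho>" and s: "sets \<rho> = sets P" and fin: "KL \<rho> P < \<infinity>"
    and f [measurable]: "f \<in> borel_measurable P" and f0: "\<And>x. 0 \<le> f x"
    and Z: "(\<integral>\<^sup>+x. ennreal (exp (f x)) \<partial>P) \<le> ennreal Z" "1 \<le> Z"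
  shows "(\<integral>\<^sup>+x. ennreal (f x) \<partial>\<rho>) \<le> KL \<rho> P + ennreal (ln Z)"
proof -
  have f\<rho> [measurable]: "f \<in> borel_measurable \<rho>" using f by (simp add: measurable_cong_sets[OF s refl])
  define h where "h m x = min (f x) (real m)" for m x
  have hb: "\<bar>h m x\<bar> \<le> real m" for m x using f0[of x] by (simp add: h_def)
  have h0: "0 \<le> h m x" for m x using f0[of x] by (simp add: h_def)
  have [measurable]: "h m \<in> borel_measurable P" "h m \<in> borel_measurable \<rho>" for m
    unfolding h_def by measurable
  have le: "(\<integral>\<^sup>+x. ennreal (h m x) \<partial>\<rho>) \<le> KL \<rho> P + ennreal (ln Z)" for m
  proof -
    have hP: "h m \<in> borel_measurable P" by measurable
    note ie = integral_exp_bounded[OF P hP hb]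
    have "ennreal (\<integral>x. exp (h m x) \<partial>P) = (\<integral>\<^sup>+x. ennreal (exp (h m x)) \<partial>P)"
      using ie(1) by (intro nn_integral_eq_integral[symmetric]) auto
    also have "\<dots> \<le> (\<integral>\<^sup>+x. ennreal (exp (f x)) \<partial>P)"
      by (intro nn_integral_mono ennreal_leI) (simp add: h_def)
    also have "\<dots> \<le> ennreal Z" by (rule Z)
    finally have "(\<integral>x. exp (h m x) \<partial>P) \<le> Z" using Z by (subst (asm) ennreal_le_iff) auto
    then have ln: "ln (\<integral>x. exp (h m x) \<partial>P) \<le> ln Z"
      using ie(4) Z by (subst ln_le_cancel_iff) auto
    have "integrable \<rho> (h m)"
      by (rule prob_space_integrable_bounded[OF \<rho> _ hb]) simp
    then have "(\<integral>\<^sup>+x. ennreal (h m x) \<partial>\<rho>) = ennreal (\<integral>x. h m x \<partial>\<rho>)"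
      using h0 by (intro nn_integral_eq_integral) auto
    also have "\<dots> \<le> ennreal (enn2real (KL \<rho> P) + ln Z)"
      using Donsker_Varadhan[OF P \<rho> s fin hP hb] ln by (intro ennreal_leI) auto
    also have "\<dots> = KL \<rho> P + ennreal (ln Z)"
      using fin Z by (subst ennreal_plus) auto
    finally show ?thesis .
  qed
  have "(\<integral>\<^sup>+x. ennreal (f x) \<partial>\<rho>) = (\<integral>\<^sup>+x. liminf (\<lambda>m. ennreal (h m x)) \<partial>\<rho>)"
  proof (intro nn_integral_cong lim_imp_Liminf[symmetric])
    fix x
    have "\<forall>\<^sub>F m in sequentially. f x \<le> real m"
      using filterlim_real_sequentially by (auto simp: filterlim_at_top)
    then have "\<forall>\<^sub>F m in sequentially. h m x = f x"
      by eventually_elim (simp add: h_def)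
    then show "(\<lambda>m. ennreal (h m x)) \<longlonglongrightarrow> ennreal (f x)"
      by (intro tendsto_eventually) (auto elim: eventually_mono)
  qed simp
  also have "\<dots> \<le> liminf (\<lambda>m. \<integral>\<^sup>+x. ennreal (h m x) \<partial>\<rho>)"
    by (intro nn_integral_liminf) measurable
  also have "\<dots> \<le> KL \<rho> P + ennreal (ln Z)"
    using le by (intro Liminf_le) (auto intro: always_eventually)
  finally show ?thesis .
qed

lemma integral_le_sqrt:
  fixes f :: "'a \<Rightarrow> real"
  assumes P: "prob_space P" and [measurable]: "f \<in> borel_measurable P"
    and c: "c > 0" and B: "0 \<le> B" "(\<integral>\<^sup>+x. ennreal (c * (f x)\<^sup>2) \<partial>P) \<le> ennreal B"
  shows "integrable P f" and "(\<integral>x. f x \<partial>P) \<le> sqrt (B / c)"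
proof -
  interpret prob_space P by fact
  have i2: "integrable P (\<lambda>x. c * (f x)\<^sup>2)"
    using B c by (intro integrableI_nonneg) (auto simp: le_less_trans)
  then have i: "integrable P (\<lambda>x. (f x)\<^sup>2)" using c by simp
  show int: "integrable P f"
    by (rule square_integrable_imp_integrable[OF _ i]) simp
  have "ennreal (\<integral>x. c * (f x)\<^sup>2 \<partial>P) \<le> ennreal B"
    using B(2) c by (subst (asm) nn_integral_eq_integral[OF i2]) auto
  then have "c * (\<integral>x. (f x)\<^sup>2 \<partial>P) \<le> B"
    using B(1) by (subst (asm) ennreal_le_iff) auto
  then have "(\<integral>x. (f x)\<^sup>2 \<partial>P) \<le> B / c" using c by (simp add: field_simps)
  moreover have "(\<integral>x. f x \<partial>P)\<^sup>2 \<le> (\<integral>x. (f x)\<^sup>2 \<partial>P)"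
    using variance_positive[of f] variance_eq[OF int i] by simp
  ultimately show "(\<integral>x. f x \<partial>P) \<le> sqrt (B / c)"
    by (intro real_le_rsqrt) simp
qed

theorem theorem17:
  fixes M :: "'w measure" and \<mu>z :: "'z measure" and \<mu>U :: "'u measure"
    and \<mu>0 \<pi> :: "'a::euclidean_space measure"
    and l :: "'a \<Rightarrow> 'z \<Rightarrow> real"
    and g :: "(nat \<Rightarrow> 'z) \<Rightarrow> 'a \<Rightarrow> 'u \<Rightarrow> 'a"
    and X :: "(nat \<Rightarrow> 'z) \<Rightarrow> nat \<Rightarrow> 'w \<Rightarrow> 'a"
    and U :: "nat \<Rightarrow> 'w \<Rightarrow> 'u" and \<xi> :: "nat \<Rightarrow> 'w \<Rightarrow> 'a" and N :: "real \<Rightarrow> 'w \<Rightarrow> nat"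
    and n :: nat and \<eta> lam \<sigma> \<sigma>\<^sub>\<pi> Sig \<zeta> :: real
  assumes "n \<ge> 1" and "\<eta> > 0" and "lam > 0" and "\<eta> * lam < 1" and "\<sigma> > 0" and "Sig \<ge> 0"
    and "0 < \<zeta>" and "\<zeta> < 1"
    and "prob_space M" and "prob_space \<mu>z" and "prob_space \<mu>U"
    and "prob_space \<mu>0" and "sets \<mu>0 = sets borel"
    and loss_measurable: "(\<lambda>(w, z). l w z) \<in> borel_measurable (borel \<Otimes>\<^sub>M \<mu>z)"
    and loss_nonneg: "\<And>w z. z \<in> space \<mu>z \<Longrightarrow> 0 \<le> l w z"
    and gradient_measurable: "\<And>S. S \<in> space (samples n \<mu>z) \<Longrightarrow>
          (\<lambda>(x, u). g S x u) \<in> borel_measurable (borel \<Otimes>\<^sub>M \<mu>U)"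
    and init: "\<And>S. S \<in> space (samples n \<mu>z) \<Longrightarrow> X S 0 \<in> borel_measurable M"
              "\<And>S. S \<in> space (samples n \<mu>z) \<Longrightarrow> distr M borel (X S 0) = \<mu>0"
    and batches: "\<And>k. U k \<in> M \<rightarrow>\<^sub>M \<mu>U" "\<And>k. distr M \<mu>U (U k) = \<mu>U"
    and noises: "\<And>k. \<xi> k \<in> borel_measurable M" "\<And>k. distr M borel (\<xi> k) = iso_gaussian 0 \<sigma>"
    and clock: "poisson_process M 1 N"
    and independence: "\<And>S. S \<in> space (samples n \<mu>z) \<Longrightarrow>
          independent_sources M \<mu>U (X S 0) U \<xi> N"
    and recursion: "\<And>S k \<omega>. S \<in> space (samples n \<mu>z) \<Longrightarrow> \<omega> \<in> space M \<Longrightarrow>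
          X S (Suc k) \<omega> = (1 - lam * \<eta>) *\<^sub>R X S k \<omega> - \<eta> *\<^sub>R g S (X S k \<omega>) (U k \<omega>) + \<xi> k \<omega>"
    and "\<sigma>\<^sub>\<pi> = \<sigma> / sqrt (1 - (1 - lam * \<eta>)\<^sup>2)"
    and "\<pi> = iso_gaussian 0 \<sigma>\<^sub>\<pi>"
    and "absolutely_continuous \<pi> \<mu>0"
    and "compatible (samples n \<mu>z) \<mu>0 \<pi> (\<lambda>S. sgld_kernel lam \<eta> \<sigma> \<mu>U (g S))
           (\<lambda>S t. distr M borel (time_changed (X S) N t))"
    and "subgaussian_loss \<mu>z Sig l"
  shows "\<exists>A \<in> sets (samples n \<mu>z). measure (samples n \<mu>z) A \<ge> 1 - \<zeta> \<and>
    (\<forall>S\<in>A. \<forall>T>0.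
       integrable M (\<lambda>\<omega>. gen_gap \<mu>z n l S (time_changed (X S) N T \<omega>)) \<and>
       ereal (\<integral>\<omega>. gen_gap \<mu>z n l S (time_changed (X S) N T \<omega>) \<partial>M) \<le>
         ereal (2 * Sig / sqrt (real n)) *
         esqrt (ennreal (\<eta>\<^sup>2 * (2 - lam * \<eta>) / (2 * \<sigma>\<^sup>2)) *
                  (\<integral>\<^sup>+t\<in>{0..T}. ennreal (exp (- lam * \<eta> * (T - t))) *
                     (\<integral>\<^sup>+(\<omega>, u). ennreal ((norm (g S (time_changed (X S) N t \<omega>) u))\<^sup>2)
                        \<partial>(M \<Otimes>\<^sub>M \<mu>U)) \<partial>lborel)
                + ennreal (exp (- lam * \<eta> * T)) * KL \<mu>0 \<pi>
                + ennreal (ln (3 / \<zeta>))))"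
proof -
  interpret PM: prob_space M by fact
  interpret R: bounded_risk \<mu>z l Sig n
    using assms by (simp add: bounded_risk_def bounded_risk_axioms_def)
  let ?Z = "samples n \<mu>z"
  have "(1 - lam * \<eta>)\<^sup>2 < 1"
    using assms(2-4) by (simp add: power_less_one_iff mult.commute)
  then have s\<pi>: "\<sigma>\<^sub>\<pi> > 0" using assms(5) by (simp add: assms(26))
  have P: "prob_space \<pi>" using prob_space_iso_gaussian[OF s\<pi>] by (simp add: assms(27))
  have s\<pi>b [measurable_cong]: "sets \<pi> = sets borel" by (simp add: assms(27))
  interpret P: prob_space \<pi> by fact
  note compat = assms(29)[unfolded compatible_def]
  have proc: "sgld_process M \<mu>U \<mu>0 (g S) (X S) U \<xi> N lam \<eta> \<sigma> \<sigma>\<^sub>\<pi>" if S: "S \<in> space ?Z" for S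
    unfolding sgld_process_def sgld_process_axioms_def
    using assms S by (simp add: mult.commute)
  have Ym: "time_changed (X S) N T \<in> borel_measurable M" if "S \<in> space ?Z" "T > 0" for S T
    using sgld_process.Yp_measurable[OF proc[OF that(1)], of T] that by simp
  have ac: "absolutely_continuous \<pi> (distr M borel (time_changed (X S) N T))" if S: "S \<in> space ?Z" and T: "T > 0" for S T
    using sgld_process.absolutely_continuous_Yp[OF proc[OF S] T] assms compat S by auto
  have gapm: "gen_gap \<mu>z n l S \<in> borel_measurable borel" if "S \<in> space ?Z" for S
    using R.gap_measurable[of "\<lambda>_. S" borel "\<lambda>w. w"] that by simp
  show ?thesis
  proof (cases "Sig = 0")
    \<comment> \<open>The right-hand side is 0 here even if the entropy bound is infinite, as
      \<open>0 * \<infinity> = 0\<close>. So the gap must vanish almost surely at every time;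
      absolute continuity transfers this from \<pi> to the law at time \<open>T\<close>.\<close>
    case True
    obtain A where A: "A \<in> sets ?Z" "measure ?Z A = 1" "\<And>S. S \<in> A \<Longrightarrow> AE w in \<pi>. gen_gap \<mu>z n l S w = 0"
      using R.gap_zero_set[OF True P s\<pi>b] by blast
    have AE0: "AE \<omega> in M. gen_gap \<mu>z n l S (time_changed (X S) N T \<omega>) = 0" if S: "S \<in> A" and T: "T > 0" for S T
    proof -
      have Sp: "S \<in> space ?Z" using sets.sets_into_space[OF A(1)] S by auto
      note [measurable] = Ym[OF Sp T] gapm[OF Sp]
      have "AE w in distr M borel (time_changed (X S) N T). gen_gap \<mu>z n l S w = 0"
        by (rule absolutely_continuous_AE[OF _ ac[OF Sp T] A(3)[OF S]]) (simp add: s\<pi>b)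
      then show ?thesis by (subst (asm) AE_distr_iff) auto
    qed
    show ?thesis
    proof (intro bexI[of _ A] conjI ballI allI impI)
      show "measure ?Z A \<ge> 1 - \<zeta>" using A assms(7) by simp
    next
      fix S and T :: real assume S: "S \<in> A" and T: "T > 0"
      have Sp: "S \<in> space ?Z" using sets.sets_into_space[OF A(1)] S by auto
      note [measurable] = Ym[OF Sp T] gapm[OF Sp]
      have "integrable M (\<lambda>\<omega>. gen_gap \<mu>z n l S (time_changed (X S) N T \<omega>)) \<longleftrightarrow> integrable M (\<lambda>_. 0::real)"
        using AE0[OF S T] by (intro integrable_cong_AE) auto
      then show "integrable M (\<lambda>\<omega>. gen_gap \<mu>z n l S (time_changed (X S) N T \<omega>))" by simp
      have "(\<integral>\<omega>. gen_gap \<mu>z n l S (time_changed (X S) N T \<omega>) \<partial>M) = (\<integral>\<omega>. 0 \<partial>M)"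
        using AE0[OF S T] by (intro integral_cong_AE) auto
      then show "ereal (\<integral>\<omega>. gen_gap \<mu>z n l S (time_changed (X S) N T \<omega>) \<partial>M) \<le>
         ereal (2 * Sig / sqrt (real n)) *
         esqrt (ennreal (\<eta>\<^sup>2 * (2 - lam * \<eta>) / (2 * \<sigma>\<^sup>2)) *
                  (\<integral>\<^sup>+t\<in>{0..T}. ennreal (exp (- lam * \<eta> * (T - t))) *
                     (\<integral>\<^sup>+(\<omega>, u). ennreal ((norm (g S (time_changed (X S) N t \<omega>) u))\<^sup>2)
                        \<partial>(M \<Otimes>\<^sub>M \<mu>U)) \<partial>lborel)
                + ennreal (exp (- lam * \<eta> * T)) * KL \<mu>0 \<pi>
                + ennreal (ln (3 / \<zeta>)))"
        by (simp add: True zero_ereal_def[symmetric])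
    qed (use A in auto)
  next
    case False
    then have Sig: "Sig > 0" using assms(6) by simp
    \<comment> \<open>The inverse of \<open>c\<close> is the square of the factor
      \<open>2 * Sig / sqrt n\<close> in the bound.\<close>
    define c where "c = real n / (4 * Sig\<^sup>2)"
    have c: "c > 0" using Sig assms(1) by (simp add: c_def)
    have z: "1 \<le> 3 / \<zeta>" using assms(7,8) by simp
    obtain A where A: "A \<in> sets ?Z" "measure ?Z A \<ge> 1 - \<zeta>"
      "\<And>S. S \<in> A \<Longrightarrow> (\<integral>\<^sup>+w. ennreal (exp (c * (gen_gap \<mu>z n l S w)\<^sup>2)) \<partial>\<pi>) \<le> ennreal (3 / \<zeta>)"
      using R.gap_exp_square_set[OF Sig P s\<pi>b assms(7,8), folded c_def] by blast
    have dv: "(\<integral>\<^sup>+w. ennreal (c * (gen_gap \<mu>z n l S w)\<^sup>2) \<partial>\<rho>) \<le> KL \<rho> \<pi> + ennreal (ln (3 / \<zeta>))"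
      if S: "S \<in> A" and \<rho>: "prob_space \<rho>" "sets \<rho> = sets borel" "KL \<rho> \<pi> < \<infinity>" for S \<rho>
    proof -
      have Sp: "S \<in> space ?Z" using sets.sets_into_space[OF A(1)] S by auto
      note [measurable] = gapm[OF Sp]
      show ?thesis
        by (rule nn_integral_le_KL[OF P \<rho>(1) _ \<rho>(3) _ _ A(3)[OF S] z]) (use \<rho> c s\<pi>b in auto)
    qed
    show ?thesis
    proof (intro bexI[of _ A] ballI allI impI conjI A(2))
      fix S and T :: real assume S: "S \<in> A" and T: "T > 0"
      have Sp: "S \<in> space ?Z" using sets.sets_into_space[OF A(1)] S by auto
      interpret sgld_process M \<mu>U \<mu>0 "g S" "X S" U \<xi> N lam \<eta> \<sigma> \<sigma>\<^sub>\<pi> by (rule proc[OF Sp])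
      note [measurable] = Ym[OF Sp T] gapm[OF Sp]
      let ?f = "gen_gap \<mu>z n l S"
      let ?\<rho> = "distr M borel (Yp T)"
      let ?B = "ennreal (\<eta>\<^sup>2 * (2 - lam * \<eta>) / (2 * \<sigma>\<^sup>2)) *
                  (\<integral>\<^sup>+t\<in>{0..T}. ennreal (exp (- lam * \<eta> * (T - t))) *
                     (\<integral>\<^sup>+(\<omega>, u). ennreal ((norm (g S (Yp t \<omega>) u))\<^sup>2)
                        \<partial>(M \<Otimes>\<^sub>M \<mu>U)) \<partial>lborel)
                + ennreal (exp (- lam * \<eta> * T)) * KL \<mu>0 \<pi>"
      have KLB: "KL ?\<rho> \<pi> \<le> ?B"
        using KL_Yp_le[OF T] by (simp add: assms(27))
      have \<rho>: "prob_space ?\<rho>" by (rule PM.prob_space_distr) simp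
      have fin: "KL (bind ?\<rho> kernel) \<pi> < \<infinity>" "prob_space (bind ?\<rho> kernel)" "sets (bind ?\<rho> kernel) = sets borel"
        using KL_bind_Yp_finite[OF T] assms(27,28) compat Sp T by auto
      \<comment> \<open>Integrability is required even when the entropy bound is infinite. The
        domination replaces the law at time \<open>T\<close> by \<mu>0 and the image under the
        kernel, both of finite divergence, to which the estimate \<open>dv\<close> applies.\<close>
      have "(\<integral>\<^sup>+\<omega>. ennreal (c * (?f (Yp T \<omega>))\<^sup>2) \<partial>M) \<le>
          (\<integral>\<^sup>+x. ennreal (c * (?f x)\<^sup>2) \<partial>\<mu>0) + ennreal T * (\<integral>\<^sup>+x. ennreal (c * (?f x)\<^sup>2) \<partial>bind ?\<rho> kernel)"
        by (rule nn_integral_Yp_le[OF T]) measurable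
      also have "\<dots> \<le> (KL \<mu>0 \<pi> + ennreal (ln (3 / \<zeta>))) + ennreal T * (KL (bind ?\<rho> kernel) \<pi> + ennreal (ln (3 / \<zeta>)))"
        using compat assms(12,13) fin by (intro add_mono mult_left_mono dv[OF S]) auto
      also have "\<dots> < \<infinity>"
        using compat fin by (simp add: ennreal_mult_less_top)
      finally have f2: "(\<integral>\<^sup>+\<omega>. ennreal (c * (?f (Yp T \<omega>))\<^sup>2) \<partial>M) < \<infinity>" .
      define E where "E = enn2real (\<integral>\<^sup>+\<omega>. ennreal (c * (?f (Yp T \<omega>))\<^sup>2) \<partial>M)"
      have E: "0 \<le> E" "(\<integral>\<^sup>+\<omega>. ennreal (c * (?f (Yp T \<omega>))\<^sup>2) \<partial>M) = ennreal E"
        using f2 by (simp_all add: E_def)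
      note sq = integral_le_sqrt[OF PM.prob_space_axioms _ c E(1), of "\<lambda>\<omega>. ?f (Yp T \<omega>)"]
      show "integrable M (\<lambda>\<omega>. ?f (Yp T \<omega>))"
        by (rule sq(1)) (use E in auto)
      show "ereal (\<integral>\<omega>. ?f (Yp T \<omega>) \<partial>M) \<le> ereal (2 * Sig / sqrt (real n)) * esqrt (?B + ennreal (ln (3 / \<zeta>)))"
      proof (cases "?B = \<infinity>")
        case True
        have "0 < 2 * Sig / sqrt (real n)" using Sig assms(1) by simp
        then show ?thesis using Sig assms(1) unfolding True by (simp add: esqrt_def)
      next
        case False
        define b where "b = enn2real ?B"
        have b: "?B = ennreal b" "0 \<le> b" using False by (simp_all add: b_def less_top)
        have "(\<integral>\<^sup>+\<omega>. ennreal (c * (?f (Yp T \<omega>))\<^sup>2) \<partial>M) = (\<integral>\<^sup>+x. ennreal (c * (?f x)\<^sup>2) \<partial>?\<rho>)"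
          by (subst nn_integral_distr) auto
        also have "\<dots> \<le> KL ?\<rho> \<pi> + ennreal (ln (3 / \<zeta>))"
          using KLB b \<rho> by (intro dv[OF S]) (auto simp: le_less_trans)
        also have "\<dots> \<le> ?B + ennreal (ln (3 / \<zeta>))"
          by (intro add_right_mono KLB)
        also have "\<dots> = ennreal (b + ln (3 / \<zeta>))"
          unfolding b(1) using b(2) z by (subst ennreal_plus) auto
        finally have "E \<le> b + ln (3 / \<zeta>)"
          unfolding E(2) using b(2) z by (subst (asm) ennreal_le_iff) auto
        have "(\<integral>\<omega>. ?f (Yp T \<omega>) \<partial>M) \<le> sqrt (E / c)"
          by (rule sq(2)) (use E in auto)
        also have "\<dots> \<le> sqrt ((b + ln (3 / \<zeta>)) / c)"
          using \<open>E \<le> _\<close> c by (intro real_sqrt_le_mono divide_right_mono) auto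
        also have "\<dots> = sqrt ((2 * Sig / sqrt (real n))\<^sup>2 * (b + ln (3 / \<zeta>)))"
          using assms(1) Sig by (simp add: c_def power_divide power_mult_distrib mult_ac)
        also have "\<dots> = 2 * Sig / sqrt (real n) * sqrt (b + ln (3 / \<zeta>))"
          using Sig by (simp add: real_sqrt_mult)
        finally have "(\<integral>\<omega>. ?f (Yp T \<omega>) \<partial>M) \<le> 2 * Sig / sqrt (real n) * sqrt (b + ln (3 / \<zeta>))" .
        moreover have "esqrt (?B + ennreal (ln (3 / \<zeta>))) = ereal (sqrt (b + ln (3 / \<zeta>)))"
        proof -
          have "?B + ennreal (ln (3 / \<zeta>)) = ennreal (b + ln (3 / \<zeta>))"
            unfolding b(1) using b(2) z by (subst ennreal_plus) auto
          then show ?thesis using b(2) z by (simp add: esqrt_def del: ennreal_plus)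
        qed
        ultimately show ?thesis by simp
      qed
    qed (rule A(1))
  qed
qed

end
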